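(* Let $N\ge 4$ be an integer and $p=1+\frac{4}{N-3}$. Let $n_0$ be an integer and $C_0>0$. Then there exist $\rho_0>1$ and a (real-)analytic positive function $u$ on $[0,\rho_0)$ which is a solution on $(0,\rho_0)$ of $$(1-\rho^{2})u''+\left(\frac{N-1}{\rho}-2(\alpha+1)\rho\right)u'-\alpha(\alpha+1)u+|u|^{p-1}u=0,$$ such that $u(0)>C_0$, $u(1)=b_0$, and $u-u_\infty$ has at least $n_0$ zeros on $(0,1)$.
   Context: Notation: $\alpha=\frac{2}{p-1}$, $b_0=\left[\frac{2(p+1)}{(p-1)^2}\right]^{\frac1{p-1}}$, $b_\infty=\left(\alpha(N-2-\alpha)\right)^{\alpha/2}$, and $u_\infty(\rho)=b_\infty\rho^{-\alpha}$ for $\rho>0$. (When $p=1+\frac4{N-3}$ one has $b_0=b_\infty$.) The prime denotes $d/d\rho$. *)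

theory Defs
  imports "HOL-Analysis.Analysis"
begin

text \<open>
  Expansions are only required to represent \<open>f\<close> on points of \<open>S\<close>. At the endpoint \<open>0\<close> of
  \<open>{0..<r}\<close> this is a one-sided expansion, i.e. \<open>f\<close> extends analytically past \<open>0\<close>; the values of
  \<open>f\<close> outside \<open>S\<close> are irrelevant. Meant for sets without isolated points.
\<close>
definition real_analytic_on :: "(real \<Rightarrow> real) \<Rightarrow> real set \<Rightarrow> bool" (infixl "(real'_analytic'_on)" 50)
  where "f real_analytic_on S \<longleftrightarrow>
    (\<forall>x\<in>S. \<exists>c r. 0 < r \<and>
      (\<forall>y\<in>S. \<bar>y - x\<bar> < r \<longrightarrow> (\<lambda>n. c n * (y - x) ^ n) sums f y))"

definition alpha :: "real \<Rightarrow> real"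
  where "alpha p = 2 / (p - 1)"

definition b_zero :: "real \<Rightarrow> real"
  where "b_zero p = (2 * (p + 1) / (p - 1)\<^sup>2) powr (1 / (p - 1))"

definition b_infty :: "nat \<Rightarrow> real \<Rightarrow> real"
  where "b_infty N p = (alpha p * (real N - 2 - alpha p)) powr (alpha p / 2)"

definition u_infty :: "nat \<Rightarrow> real \<Rightarrow> real \<Rightarrow> real"
  where "u_infty N p \<rho> = b_infty N p * \<rho> powr (- alpha p)"

definition ode_solution_on :: "nat \<Rightarrow> real \<Rightarrow> (real \<Rightarrow> real) \<Rightarrow> real set \<Rightarrow> bool"
  where "ode_solution_on N p u I \<longleftrightarrow>
    (\<exists>u' u''. \<forall>\<rho>\<in>I.
      (u has_real_derivative u' \<rho>) (at \<rho>) \<and>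
      (u' has_real_derivative u'' \<rho>) (at \<rho>) \<and>
      (1 - \<rho>\<^sup>2) * u'' \<rho>
        + ((real N - 1) / \<rho> - 2 * (alpha p + 1) * \<rho>) * u' \<rho>
        - alpha p * (alpha p + 1) * u \<rho>
        + \<bar>u \<rho>\<bar> powr (p - 1) * u \<rho> = 0)"

end

theory Submission
  imports Defs "HOL-Complex_Analysis.Complex_Analysis"
begin

text \<open>
  Put \<open>v = \<rho> powr \<alpha> * u\<close> and \<open>z = 1 / \<rho>\<close>. Exactly for \<open>p = 1 + 4 / (N - 3)\<close> all lower order terms cancel and
  the equation becomes \<open>(z\<^sup>2 - 1) v'' = c v - v\<^sup>p\<close> with \<open>c = \<alpha> (\<alpha> + 1)\<close>, where \<open>u_infty\<close> is the constant solution
  \<open>v = b\<close>. The energy \<open>(z\<^sup>2 - 1) v'\<^sup>2 / 2 + v\<^sup>p\<^sup>+\<^sup>1 / (p + 1) - c v\<^sup>2 / 2\<close> increases in \<open>z\<close> and tends to \<open>0\<close> at the centre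
  \<open>z = \<infinity>\<close>, hence it is negative: every solution regular at the centre stays positive and bounded down to
  the light cone \<open>z = 1\<close>, and it is regular there iff \<open>v 1 = b\<close>.

  Shoot from the centre with \<open>u 0 = \<eta> powr (- \<alpha>)\<close>. As \<open>\<eta> \<rightarrow> 0\<close> the rescaled profiles converge to the Lane--Emden
  solution, which oscillates around \<open>b\<close> infinitely often, so the number of zeros of \<open>v - b\<close> on \<open>(1, \<infinity>)\<close> tends to
  infinity. If \<open>v 1 \<noteq> b\<close> for all small \<open>\<eta>\<close>, this number would be constant. Analyticity at \<open>\<rho> = 0\<close>, at interior
  points and across the light cone comes from solving the local integral equations among holomorphic functions.
\<close>

section \<open>A weighted contraction principle\<close>

text \<open>As \<eta> varies, a zero of \<open>v - b\<close> could disappear in three ways. It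
  cannot escape to the centre, where \<open>v\<close> tends to 0. It cannot cross the light cone
  while \<open>v \<noteq> b\<close> there. It cannot merge with another zero: at a critical point
  the energy is purely potential and at least the potential on the cone, hence strictly above the
  minimum of the potential, which is attained only at \<open>b\<close>. So the count is frozen. This
  needs control uniform in \<eta> up to and including the cone, where the equation degenerates. The
  rescaled profiles are therefore built all at once, as one continuous function of
  \<open>(\<eta>, y)\<close> on the closed region \<open>\<eta> * y \<le> 1\<close>, from an
  integral equation whose kernel vanishes where the coefficient does. Smoothness across the cone is
  a separate matter: with \<open>v = b\<close> there, the right-hand side has a zero that can be
  divided out, which leaves a regular problem. The solution coming from the centre exists on one
  side only and must be recognised as part of the holomorphic one; for this reason the holomorphic
  fixed points come with uniqueness among arbitrary functions on a real interval.\<close>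

text \<open>Banach's principle for the distance sup |f - g| / w, phrased pointwise so that no normed
  function space has to be set up. \<open>P\<close> is the admissible class: continuous functions
  under an exponential weight for the profiles, holomorphic functions under the weight 1 for
  analyticity. \<open>D\<close> bounds the first step, so all iterates keep a finite weighted
  distance from \<open>f0\<close> even if they are unbounded.\<close>

lemma weighted_contraction_fixed_point:
  fixes T :: "('a \<Rightarrow> 'b::banach) \<Rightarrow> 'a \<Rightarrow> 'b" and w :: "'a \<Rightarrow> real"
  assumes w: "\<And>x. x \<in> X \<Longrightarrow> w x > 0" and q: "0 \<le> q" "q < 1"
    and f0: "f0 \<in> P" and D: "\<And>x. x \<in> X \<Longrightarrow> norm (T f0 x - f0 x) \<le> D * w x" and "D \<ge> 0"
    and T: "\<And>f. f \<in> P \<Longrightarrow> T f \<in> P"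
    and contr: "\<And>f g d x. \<lbrakk>f \<in> P; g \<in> P; d \<ge> 0; \<And>y. y \<in> X \<Longrightarrow> norm (f y - g y) \<le> d * w y; x \<in> X\<rbrakk>
      \<Longrightarrow> norm (T f x - T g x) \<le> q * d * w x"
    and closed: "\<And>F f. \<lbrakk>\<And>n. F n \<in> P;
      \<And>e. e > 0 \<Longrightarrow> \<forall>\<^sub>F n in sequentially. \<forall>x\<in>X. norm (F n x - f x) \<le> e * w x\<rbrakk> \<Longrightarrow> f \<in> P"
  obtains f where "f \<in> P" "\<And>x. x \<in> X \<Longrightarrow> T f x = f x"
proof -
  define F where "F = (\<lambda>n. (T ^^ n) f0)"
  have F0: "F 0 = f0" and FS: "F (Suc n) = T (F n)" for n by (simp_all add: F_def)
  have FP: "F n \<in> P" for n by (induction n) (simp_all add: F0 FS f0 T)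
  have step: "\<forall>x\<in>X. norm (F (Suc n) x - F n x) \<le> (q ^ n * D) * w x" for n
  proof (induction n)
    case 0
    then show ?case using D by (simp add: F0 FS)
  next
    case (Suc n)
    have "norm (T (F (Suc n)) x - T (F n) x) \<le> q * (q ^ n * D) * w x" if "x \<in> X" for x
      by (rule contr) (use FP Suc that q \<open>D \<ge> 0\<close> in auto)
    then show ?case by (simp add: FS mult.assoc)
  qed
  \<comment> \<open>The factor \<open>1 - q ^ j\<close> is the exact geometric sum; it makes the
    induction close and is dropped right afterwards.\<close>
  have tele: "norm (F (n + j) x - F n x) \<le> q ^ n * D / (1 - q) * (1 - q ^ j) * w x" if x: "x \<in> X" for n j x
  proof (induction j)
    case (Suc j)
    have "norm (F (n + Suc j) x - F n x)
        \<le> norm (F (Suc (n + j)) x - F (n + j) x) + norm (F (n + j) x - F n x)"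
      by (metis add_Suc_right norm_triangle_sub diff_add_cancel add_diff_eq norm_triangle_ineq)
    also have "\<dots> \<le> q ^ (n + j) * D * w x + q ^ n * D / (1 - q) * (1 - q ^ j) * w x"
      using step[of "n + j"] x Suc by (intro add_mono) auto
    also have "\<dots> = q ^ n * D / (1 - q) * (1 - q ^ Suc j) * w x"
      using q by (simp add: field_simps power_add)
    finally show ?case .
  qed simp
  define C where "C = D / (1 - q)"
  have C: "C \<ge> 0" using \<open>D \<ge> 0\<close> q by (simp add: C_def)
  have tele': "norm (F (n + j) x - F n x) \<le> q ^ n * C * w x" if x: "x \<in> X" for n j x
  proof -
    have "q ^ n * C * (1 - q ^ j) * w x \<le> q ^ n * C * 1 * w x"
      using q C w[OF x] by (intro mult_right_mono mult_left_mono) auto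
    then show ?thesis using tele[OF x, of n j] by (simp add: C_def)
  qed
  have qlim: "(\<lambda>n. q ^ n * C * a) \<longlonglongrightarrow> 0" for a
    using q LIMSEQ_realpow_zero[of q] by (auto intro!: tendsto_mult_left_zero)
  have conv: "convergent (\<lambda>n. F n x)" if x: "x \<in> X" for x
  proof (rule Cauchy_convergent, rule metric_CauchyI)
    fix e :: real assume "e > 0"
    from order_tendstoD(2)[OF qlim[of "w x"] this]
    obtain M where M: "\<And>n. n \<ge> M \<Longrightarrow> q ^ n * C * w x < e"
      by (auto simp: eventually_sequentially)
    have *: "dist (F (n + j) x) (F n x) < e" if "n \<ge> M" for n j
      using tele'[OF x, of n j] M[OF that] by (simp add: dist_norm)
    show "\<exists>M. \<forall>m\<ge>M. \<forall>n\<ge>M. dist (F m x) (F n x) < e"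
      by (metis * dist_commute le_Suc_ex nle_le)
  qed
  define f where "f = (\<lambda>x. lim (\<lambda>n. F n x))"
  have lim: "(\<lambda>n. F n x) \<longlonglongrightarrow> f x" if "x \<in> X" for x
    using conv[OF that] by (simp add: f_def convergent_LIMSEQ_iff)
  have dist: "norm (f x - F n x) \<le> q ^ n * C * w x" if x: "x \<in> X" for n x
  proof (rule LIMSEQ_le_const2)
    show "(\<lambda>j. norm (F (n + j) x - F n x)) \<longlonglongrightarrow> norm (f x - F n x)"
      using LIMSEQ_ignore_initial_segment[OF lim[OF x], of n]
      by (intro tendsto_intros) (simp add: add.commute)
  qed (use tele'[OF x] in auto)
  have fP: "f \<in> P"
  proof (rule closed[OF FP])
    fix e :: real assume "e > 0"
    from order_tendstoD(2)[OF qlim[of 1] this]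
    have "\<forall>\<^sub>F n in sequentially. q ^ n * C < e" by simp
    then show "\<forall>\<^sub>F n in sequentially. \<forall>x\<in>X. norm (F n x - f x) \<le> e * w x"
    proof eventually_elim
      case (elim n)
      show ?case
      proof
        fix x assume x: "x \<in> X"
        have "q ^ n * C * w x \<le> e * w x"
          using elim w[OF x] by (intro mult_right_mono) auto
        then show "norm (F n x - f x) \<le> e * w x"
          using dist[OF x, of n] by (simp add: norm_minus_commute)
      qed
    qed
  qed
  have "T f x = f x" if x: "x \<in> X" for x
  proof -
    have "norm (T f x - f x) \<le> 2 * (q ^ Suc n * C * w x)" for n
    proof -
      have "norm (T f x - T (F n) x) \<le> q * (q ^ n * C) * w x"
        by (rule contr) (use fP FP dist x q C in auto)
      moreover have "norm (F (Suc n) x - f x) \<le> q ^ Suc n * C * w x"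
        using dist[OF x, of "Suc n"] by (simp add: norm_minus_commute)
      moreover have "T f x - f x = (T f x - T (F n) x) + (F (Suc n) x - f x)"
        by (simp add: FS)
      ultimately show ?thesis
        using norm_triangle_ineq[of "T f x - T (F n) x" "F (Suc n) x - f x"] by (simp add: mult.assoc)
    qed
    moreover have "(\<lambda>n. 2 * (q ^ Suc n * C * w x)) \<longlonglongrightarrow> 2 * 0"
      using LIMSEQ_Suc[OF qlim[of "w x"]] by (intro tendsto_mult_left) simp
    ultimately have "norm (T f x - f x) \<le> 0"
      using LIMSEQ_le_const[of "\<lambda>n. 2 * (q ^ Suc n * C * w x)" "2 * 0"] by (metis mult_zero_right)
    then show ?thesis by simp
  qed
  with fP show thesis by (rule that)
qed

section \<open>The rescaled radial profiles\<close>

text \<open>Instantiated with \<open>k = N - 1\<close> and \<open>\<alpha> = (N - 3) / 2\<close>.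
  The equation between them encodes the relation of exponent and dimension that removes the first
  order term; \<open>\<alpha> \<ge> 1 / 2\<close> is \<open>N \<ge> 4\<close>.\<close>

locale supercritical =
  fixes k :: nat and \<alpha> :: real
  assumes k_eq: "real k = 2 * \<alpha> + 2" and \<alpha>_ge: "\<alpha> \<ge> 1 / 2"
begin

definition p where "p = 1 + 2 / \<alpha>"
definition c where "c = \<alpha> * (\<alpha> + 1)"
text \<open>The positive root of \<open>w powr p = c * w\<close>. Both \<open>b_zero p\<close> and
  \<open>b_infty N p\<close> reduce to it, the latter because
  \<open>N - 2 - \<alpha> = \<alpha> + 1\<close>.\<close>

definition b where "b = c powr (\<alpha> / 2)"

text \<open>
  The profile with \<open>u 0 = \<eta> powr (- \<alpha>)\<close> is rescaled to \<open>U (\<eta>, y) = \<eta> powr \<alpha> * u (\<eta> * y)\<close>, which solves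
  \<open>U'' + (k / y) U' = (\<eta>\<^sup>2 c U - U\<^sup>p) / (1 - \<eta>\<^sup>2 y\<^sup>2)\<close>, \<open>U (\<eta>, 0) = 1\<close>; \<open>\<eta> = 0\<close> is the Lane--Emden equation. Integrating
  twice gives the fixed point equation of \<open>volterra\<close>. Clamping makes the nonlinearity globally Lipschitz; it is
  inactive on the solution, where \<open>0 < U \<le> 1\<close>.
\<close>

definition clamp :: "real \<Rightarrow> real"
  where "clamp w = max 0 (min 1 w)"

definition nl :: "real \<Rightarrow> real \<Rightarrow> real"
  where "nl \<eta> w = \<eta>\<^sup>2 * c * w - w powr p"

text \<open>The Green kernel of \<open>U'' + (k / y) U'\<close> on a ray, after exchanging the two
  integrations and substituting \<open>s = t * y\<close>: the inner weight is
  \<open>s * (1 - (s / y) ^ (k - 1)) / (k - 1)\<close>.\<close>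

definition K :: "real \<Rightarrow> real"
  where "K t = t * (1 - t ^ (k - 1)) / (real k - 1)"

text \<open>Contains both delicate edges: the light cone \<open>\<eta> * y = 1\<close>, and the
  slice \<open>\<eta> = 0\<close>, along which \<open>y\<close> is unbounded. Continuity on
  \<open>X\<close> thus covers the Lane-Emden limit and the values at the cone.\<close>

definition X :: "(real \<times> real) set"
  where "X = {(\<eta>, y). 0 \<le> \<eta> \<and> \<eta> \<le> 1 \<and> 0 \<le> y \<and> \<eta> * y \<le> 1}"

definition integrand :: "(real \<times> real \<Rightarrow> real) \<Rightarrow> real \<times> real \<Rightarrow> real \<Rightarrow> real"
  where "integrand f x t = K t / (1 - (fst x * snd x)\<^sup>2 * t\<^sup>2) * nl (fst x) (clamp (f (fst x, t * snd x)))"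

definition volterra :: "(real \<times> real \<Rightarrow> real) \<Rightarrow> real \<times> real \<Rightarrow> real"
  where "volterra f x = 1 + (snd x)\<^sup>2 * integral {0..1} (integrand f x)"

lemma k_ge: "k \<ge> 3" using k_eq \<alpha>_ge by linarith

lemma \<alpha>_pos: "\<alpha> > 0" using \<alpha>_ge by simp

lemma p_gt: "p > 1" using \<alpha>_pos by (simp add: p_def)

lemma c_pos: "c > 0" using \<alpha>_pos by (simp add: c_def)

lemma b_pos: "b > 0" using c_pos by (simp add: b_def)

lemma b_powr: "b powr (p - 1) = c"
  using c_pos \<alpha>_pos by (simp add: b_def p_def powr_powr)

lemma b_powr_p: "b powr p = c * b"
  using b_powr b_pos powr_add[of b "p - 1" 1] by simp

section \<open>Bounds on nonlinearity and kernel, and the Volterra operator\<close>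

lemma nl_Lipschitz:
  assumes "0 \<le> \<eta>" "\<eta> \<le> 1" "0 \<le> w1" "w1 \<le> 1" "0 \<le> w2" "w2 \<le> 1"
  shows "\<bar>nl \<eta> w1 - nl \<eta> w2\<bar> \<le> (c + p) * \<bar>w1 - w2\<bar>"
proof -
  have powr: "y powr p - x powr p \<le> p * (y - x)" "x powr p \<le> y powr p"
    if "0 \<le> x" "x < y" "y \<le> 1" for x y :: real
  proof -
    have "\<exists>l z. x < z \<and> z < y \<and> ((\<lambda>u. u powr p) has_real_derivative l) (at z) \<and> y powr p - x powr p = (y - x) * l"
    proof (rule MVT)
      show "continuous_on {x..y} (\<lambda>u. u powr p)"
        using that p_gt by (intro continuous_on_powr' continuous_intros) auto
      show "(\<lambda>u. u powr p) differentiable (at z)" if "x < z" for z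
        using that \<open>0 \<le> x\<close> unfolding real_differentiable_def
        by (intro exI[of _ "p * z powr (p - 1)"]) (auto intro!: derivative_eq_intros)
    qed (use that in auto)
    then obtain l z where z: "x < z" "z < y" and l: "((\<lambda>u. u powr p) has_real_derivative l) (at z)"
      and eq: "y powr p - x powr p = (y - x) * l" by blast
    have "((\<lambda>u. u powr p) has_real_derivative p * z powr (p - 1)) (at z)"
      using z that by (auto intro!: derivative_eq_intros)
    with l have "l = p * z powr (p - 1)" by (rule DERIV_unique)
    moreover have "z powr (p - 1) \<le> 1"
      using z that p_gt powr_mono2[of "p - 1" z 1] by simp
    ultimately have "l \<le> p" using p_gt by simp
    then have "(y - x) * l \<le> (y - x) * p" using that by (intro mult_left_mono) auto
    then show "y powr p - x powr p \<le> p * (y - x)" by (simp add: eq mult.commute)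
    show "x powr p \<le> y powr p" using that p_gt by (intro powr_mono2) auto
  qed
  have a: "\<bar>w1 powr p - w2 powr p\<bar> \<le> p * \<bar>w1 - w2\<bar>"
    using powr[of w1 w2] powr[of w2 w1] assms by (cases w1 w2 rule: linorder_cases) auto
  have "nl \<eta> w1 - nl \<eta> w2 = \<eta>\<^sup>2 * c * (w1 - w2) - (w1 powr p - w2 powr p)"
    by (simp add: nl_def algebra_simps)
  also have "\<bar>\<dots>\<bar> \<le> \<bar>\<eta>\<^sup>2 * c * (w1 - w2)\<bar> + \<bar>w1 powr p - w2 powr p\<bar>" by (rule abs_triangle_ineq4)
  also have "\<bar>\<eta>\<^sup>2 * c * (w1 - w2)\<bar> \<le> c * \<bar>w1 - w2\<bar>"
    using assms c_pos power_le_one[of \<eta> 2] by (simp add: abs_mult mult_right_mono)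
  finally show ?thesis using a by (simp add: algebra_simps)
qed

lemma clamp_bounds: "0 \<le> clamp w" "clamp w \<le> 1"
  by (auto simp: clamp_def)

lemma clamp_Lipschitz: "\<bar>clamp v - clamp w\<bar> \<le> \<bar>v - w\<bar>"
  by (auto simp: clamp_def max_def min_def)

lemma continuous_clamp: "isCont clamp w"
  unfolding clamp_def by (intro continuous_intros)

lemma nl_clamp_bound:
  assumes "0 \<le> \<eta>" "\<eta> \<le> 1" shows "\<bar>nl \<eta> (clamp w)\<bar> \<le> c + p"
proof -
  have "\<bar>nl \<eta> (clamp w) - nl \<eta> 0\<bar> \<le> (c + p) * \<bar>clamp w - 0\<bar>"
    by (rule nl_Lipschitz) (use assms clamp_bounds in auto)
  also have "\<dots> \<le> (c + p) * 1"
    using clamp_bounds c_pos p_gt by (intro mult_left_mono) auto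
  finally show ?thesis by (simp add: nl_def)
qed

text \<open>Bernoulli's inequality bounds \<open>1 - t ^ (k - 1)\<close> by a multiple of
  \<open>1 - t\<close>. This linear zero at \<open>t = 1\<close> is what compensates the vanishing
  denominator on the light cone.\<close>

lemma K_bounds:
  assumes "0 \<le> t" "t \<le> 1" shows "0 \<le> K t" "K t \<le> t * (1 - t)"
proof -
  have k1: "real k - 1 > 0" using k_ge by simp
  have "1 - t ^ (k - 1) \<le> real (k - 1) * (1 - t)"
  proof -
    have "1 + real (k - 1) * (t - 1) \<le> (1 + (t - 1)) ^ (k - 1)"
      by (rule Bernoulli_inequality) (use assms in auto)
    then show ?thesis by (simp add: algebra_simps)
  qed
  then have "t * (1 - t ^ (k - 1)) \<le> t * (real (k - 1) * (1 - t))"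
    using assms by (intro mult_left_mono) auto
  also have "\<dots> = t * (1 - t) * (real k - 1)" using k_ge by (simp add: of_nat_diff)
  finally show "K t \<le> t * (1 - t)"
    unfolding K_def using k1 by (subst divide_le_eq) simp
  show "0 \<le> K t" using k1 assms power_le_one[of t "k - 1"] by (auto simp: K_def)
qed

text \<open>At \<open>\<mu> = t = 1\<close> the quotient is \<open>0 / 0 = 0\<close>, so the kernel is bounded but not jointly continuous.\<close>

lemma kernel_bounds:
  assumes "0 \<le> t" "t \<le> 1" "0 \<le> \<mu>" "\<mu> \<le> 1"
  shows "0 \<le> K t / (1 - \<mu>\<^sup>2 * t\<^sup>2)" "K t / (1 - \<mu>\<^sup>2 * t\<^sup>2) \<le> t"
proof -
  have "\<mu>\<^sup>2 * t\<^sup>2 \<le> 1 * t\<^sup>2"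
    using assms by (intro mult_right_mono power_le_one) auto
  moreover have "t\<^sup>2 \<le> t" using assms by (simp add: power2_eq_square mult_left_le)
  ultimately have le: "1 - t \<le> 1 - \<mu>\<^sup>2 * t\<^sup>2" by simp
  show "0 \<le> K t / (1 - \<mu>\<^sup>2 * t\<^sup>2)" using K_bounds[OF assms(1,2)] le assms by simp
  show "K t / (1 - \<mu>\<^sup>2 * t\<^sup>2) \<le> t"
  proof (cases "t = 1")
    case False
    with le assms have pos: "1 - \<mu>\<^sup>2 * t\<^sup>2 > 0" by simp
    have "t * (1 - t) \<le> t * (1 - \<mu>\<^sup>2 * t\<^sup>2)" using le assms by (intro mult_left_mono) auto
    with K_bounds[OF assms(1,2)] pos show ?thesis by (simp add: divide_le_eq)
  qed (simp add: K_def)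
qed

lemma integrand_bound:
  assumes "x \<in> X" "0 \<le> t" "t \<le> 1" shows "\<bar>integrand f x t\<bar> \<le> c + p"
proof -
  obtain \<eta> y where x: "x = (\<eta>, y)" and h: "0 \<le> \<eta>" "\<eta> \<le> 1" "0 \<le> y" "\<eta> * y \<le> 1"
    using assms by (auto simp: X_def)
  have "\<bar>integrand f x t\<bar> = K t / (1 - (\<eta> * y)\<^sup>2 * t\<^sup>2) * \<bar>nl \<eta> (clamp (f (\<eta>, t * y)))\<bar>"
    using kernel_bounds(1)[of t "\<eta> * y"] h assms unfolding integrand_def x abs_mult fst_conv snd_conv
    by (subst abs_of_nonneg) auto
  also have "\<dots> \<le> 1 * (c + p)"
    using kernel_bounds[of t "\<eta> * y"] h assms nl_clamp_bound
    by (intro mult_mono) auto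
  finally show ?thesis by simp
qed

lemma X_ray: assumes "(\<eta>, y) \<in> X" "0 \<le> t" "t \<le> 1" shows "(\<eta>, t * y) \<in> X"
proof -
  have h: "0 \<le> \<eta>" "\<eta> \<le> 1" "0 \<le> y" "\<eta> * y \<le> 1" using assms by (auto simp: X_def)
  have "t * y \<le> 1 * y" using h assms by (intro mult_right_mono) auto
  then have "\<eta> * (t * y) \<le> \<eta> * y" using h by (intro mult_left_mono) auto
  with h assms show ?thesis by (simp add: X_def)
qed

lemma tendsto_nl:
  assumes "(a \<longlongrightarrow> \<eta>) F" "(u \<longlongrightarrow> w) F" "\<And>x. u x \<ge> 0"
  shows "((\<lambda>x. nl (a x) (u x)) \<longlongrightarrow> nl \<eta> w) F"
  unfolding nl_def using assms p_gt
  by (intro tendsto_intros tendsto_powr') auto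

text \<open>For \<open>t < 1\<close> the denominator at the limit point is nonzero even on the light
  cone; at \<open>t = 1\<close> all integrands are 0 because \<open>K 1 = 0\<close>. Pointwise
  convergence is what dominated convergence asks for.\<close>

lemma integrand_tendsto:
  assumes f: "continuous_on X f" and x: "\<And>n. x n \<in> X" "a \<in> X" "x \<longlonglongrightarrow> a" and t: "0 \<le> t" "t \<le> 1"
  shows "(\<lambda>n. integrand f (x n) t) \<longlonglongrightarrow> integrand f a t"
proof (cases "t = 1")
  case False
  have lims: "(\<lambda>n. fst (x n)) \<longlonglongrightarrow> fst a" "(\<lambda>n. snd (x n)) \<longlonglongrightarrow> snd a"
    using tendsto_fst[OF x(3)] tendsto_snd[OF x(3)] .
  have m: "\<bar>fst a * snd a\<bar> \<le> 1" using x(2) by (auto simp: X_def)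
  have "(fst a * snd a)\<^sup>2 * t\<^sup>2 \<le> 1 * t\<^sup>2"
    using m by (intro mult_right_mono) (auto simp: abs_square_le_1)
  moreover have "t\<^sup>2 < 1" using t False by (simp add: power_less_one_iff)
  ultimately have ne: "1 - (fst a * snd a)\<^sup>2 * t\<^sup>2 \<noteq> 0" by simp
  have "(\<lambda>n. f (fst (x n), t * snd (x n))) \<longlonglongrightarrow> f (fst a, t * snd a)"
  proof (rule continuous_on_tendsto_compose[OF f])
    show "(\<lambda>n. (fst (x n), t * snd (x n))) \<longlonglongrightarrow> (fst a, t * snd a)"
      using lims by (intro tendsto_Pair tendsto_mult tendsto_const)
    show "(fst a, t * snd a) \<in> X" "\<forall>\<^sub>F n in sequentially. (fst (x n), t * snd (x n)) \<in> X"
      using X_ray t x by simp_all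
  qed
  from isCont_tendsto_compose[OF continuous_clamp this] lims ne x(3) show ?thesis
    unfolding integrand_def by (intro tendsto_intros tendsto_nl) (auto simp: clamp_bounds)
qed (simp add: integrand_def K_def)

lemma integrand_integrable:
  assumes f: "continuous_on X f" and a: "a \<in> X"
  shows "integrand f a integrable_on {0..1}"
proof -
  obtain \<eta> y where ay: "a = (\<eta>, y)" and h: "0 \<le> \<eta>" "\<eta> \<le> 1" "0 \<le> y" "\<eta> * y \<le> 1"
    using a by (auto simp: X_def)
  \<comment> \<open>On the light cone the integrand may jump at \<open>t = 1\<close>. It is reached
    as a dominated limit of the continuous integrands at \<open>(\<eta>, s n * y)\<close>, which lie
    strictly inside the cone.\<close>
  define s where "s = (\<lambda>n. 1 - inverse (real (Suc n)))"
  have s: "0 \<le> s n" "s n < 1" for n by (auto simp: s_def divide_simps)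
  have slim: "s \<longlonglongrightarrow> 1"
    unfolding s_def using tendsto_diff[OF tendsto_const LIMSEQ_inverse_real_of_nat, of 1] by simp
  define x where "x = (\<lambda>n. (\<eta>, s n * y))"
  have xX: "x n \<in> X" for n using X_ray a s[of n] by (simp add: x_def ay less_imp_le)
  have xlim: "x \<longlonglongrightarrow> a"
    unfolding x_def ay using tendsto_mult[OF slim tendsto_const, of y] by (intro tendsto_intros) simp
  show ?thesis
  proof (rule dominated_convergence(1)[where f = "\<lambda>n. integrand f (x n)" and h = "\<lambda>_. c + p"])
    show "integrand f (x n) integrable_on {0..1}" for n
    proof (rule integrable_continuous_real, unfold continuous_on_sequentially comp_def, intro allI ballI impI)
      fix u l assume l: "l \<in> {0..1::real}" and "(\<forall>n. u n \<in> {0..1}) \<and> u \<longlonglongrightarrow> l"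
      then have u: "\<And>n. 0 \<le> u n" "\<And>n. u n \<le> 1" "u \<longlonglongrightarrow> l" by auto
      have m: "\<bar>\<eta> * (s n * y)\<bar> < 1"
      proof -
        have "s n * (\<eta> * y) \<le> s n * 1" using h s[of n] by (intro mult_left_mono) auto
        with h s[of n] show ?thesis by (simp add: abs_mult mult_ac)
      qed
      have "(\<eta> * (s n * y))\<^sup>2 * l\<^sup>2 \<le> (\<eta> * (s n * y))\<^sup>2 * 1"
        using l by (intro mult_left_mono power_le_one) auto
      also have "\<dots> < 1" using m by (simp add: abs_square_less_1)
      finally have ne: "1 - (\<eta> * (s n * y))\<^sup>2 * l\<^sup>2 \<noteq> 0" by simp
      have "(\<lambda>i. f (\<eta>, u i * (s n * y))) \<longlonglongrightarrow> f (\<eta>, l * (s n * y))"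
      proof (rule continuous_on_tendsto_compose[OF f])
        show "(\<lambda>i. (\<eta>, u i * (s n * y))) \<longlonglongrightarrow> (\<eta>, l * (s n * y))"
          using u by (intro tendsto_intros)
        show "(\<eta>, l * (s n * y)) \<in> X" "\<forall>\<^sub>F i in sequentially. (\<eta>, u i * (s n * y)) \<in> X"
          using X_ray[of \<eta> "s n * y"] xX[of n] u l by (simp_all add: x_def)
      qed
      from isCont_tendsto_compose[OF continuous_clamp this] u ne k_ge
      show "(\<lambda>i. integrand f (x n) (u i)) \<longlonglongrightarrow> integrand f (x n) l"
        unfolding integrand_def x_def fst_conv snd_conv K_def
        by (intro tendsto_intros tendsto_nl) (auto simp: clamp_bounds)
    qed
    show "norm (integrand f (x n) t) \<le> c + p" if "t \<in> {0..1}" for n t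
      using integrand_bound[OF xX] that by simp
    show "(\<lambda>n. integrand f (x n) t) \<longlonglongrightarrow> integrand f a t" if "t \<in> {0..1}" for t
      using integrand_tendsto[OF f xX a xlim] that by simp
  qed auto
qed

lemma continuous_on_volterra:
  assumes f: "continuous_on X f" shows "continuous_on X (volterra f)"
proof (rule continuous_on_sequentiallyI)
  fix x a assume x: "\<forall>n. x n \<in> X" "a \<in> X" "x \<longlonglongrightarrow> a"
  have "(\<lambda>n. integral {0..1} (integrand f (x n))) \<longlonglongrightarrow> integral {0..1} (integrand f a)"
  proof (rule dominated_convergence(2)[where h = "\<lambda>_. c + p"])
    show "norm (integrand f (x n) t) \<le> c + p" if "t \<in> {0..1}" for n t
      using integrand_bound[of "x n"] x that by simp
  qed (use x integrand_integrable[OF f] integrand_tendsto[OF f] in auto)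
  then show "(\<lambda>n. volterra f (x n)) \<longlonglongrightarrow> volterra f a"
    unfolding volterra_def using x(3) by (intro tendsto_intros)
qed

text \<open>The weight is tuned to the kernel bound \<open>t\<close>: for \<open>L = c + p\<close>
  the integral of \<open>y^2 * L * t * exp (L * y^2 * t^2)\<close> over [0, 1] is
  \<open>(exp (L * y^2) - 1) / 2\<close>. The factor 1/2 appears for every \<open>L\<close> and
  every \<open>y\<close>, so a single contraction reaches all of the unbounded set
  \<open>X\<close>.\<close>

lemma volterra_contraction:
  assumes f: "continuous_on X f" and g: "continuous_on X g" and "d \<ge> 0"
    and fg: "\<And>x. x \<in> X \<Longrightarrow> \<bar>f x - g x\<bar> \<le> d * exp ((c + p) * (snd x)\<^sup>2)" and x: "x \<in> X"
  shows "\<bar>volterra f x - volterra g x\<bar> \<le> 1 / 2 * d * exp ((c + p) * (snd x)\<^sup>2)"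
proof -
  obtain \<eta> y where xy: "x = (\<eta>, y)" and h: "0 \<le> \<eta>" "\<eta> \<le> 1" "0 \<le> y" "\<eta> * y \<le> 1"
    using x by (auto simp: X_def)
  define L where "L = c + p"
  have L: "L > 0" using c_pos p_gt by (simp add: L_def)
  define G where "G = (\<lambda>t. d * (L * t * exp (L * y\<^sup>2 * t\<^sup>2)))"
  have G: "((\<lambda>t. y\<^sup>2 * G t) has_integral (d * exp (L * y\<^sup>2 * 1\<^sup>2) / 2 - d * exp (L * y\<^sup>2 * 0\<^sup>2) / 2)) {0..1}"
    by (rule fundamental_theorem_of_calculus)
      (auto simp: G_def has_real_derivative_iff_has_vector_derivative[symmetric] intro!: derivative_eq_intros)
  have le: "\<bar>y\<^sup>2 * (integrand f x t - integrand g x t)\<bar> \<le> y\<^sup>2 * G t" if t: "t \<in> {0..1}" for t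
  proof -
    have "\<bar>integrand f x t - integrand g x t\<bar> = K t / (1 - (\<eta> * y)\<^sup>2 * t\<^sup>2) *
        \<bar>nl \<eta> (clamp (f (\<eta>, t * y))) - nl \<eta> (clamp (g (\<eta>, t * y)))\<bar>"
      using kernel_bounds(1)[of t "\<eta> * y"] h t
      unfolding integrand_def xy fst_conv snd_conv right_diff_distrib[symmetric] abs_mult
      by (subst abs_of_nonneg) auto
    also have "\<dots> \<le> t * (L * \<bar>clamp (f (\<eta>, t * y)) - clamp (g (\<eta>, t * y))\<bar>)"
      unfolding L_def using kernel_bounds[of t "\<eta> * y"] h t
      by (intro mult_mono nl_Lipschitz clamp_bounds) auto
    also have "\<dots> \<le> t * (L * (d * exp (L * (t * y)\<^sup>2)))"
      using fg[of "(\<eta>, t * y)"] X_ray[of \<eta> y t] x t L clamp_Lipschitz[of "f (\<eta>, t * y)" "g (\<eta>, t * y)"]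
      by (intro mult_left_mono) (auto simp: xy L_def)
    also have "\<dots> = G t" by (simp add: G_def power_mult_distrib mult_ac)
    finally show ?thesis by (simp add: abs_mult mult_left_mono)
  qed
  have int: "((\<lambda>t. y\<^sup>2 * (integrand f x t - integrand g x t)) has_integral
      (volterra f x - volterra g x)) {0..1}"
    using has_integral_mult_right[OF has_integral_diff[OF
        integrable_integral[OF integrand_integrable[OF f x]] integrable_integral[OF integrand_integrable[OF g x]]], of "y\<^sup>2"]
    by (simp add: volterra_def xy algebra_simps)
  have "\<bar>volterra f x - volterra g x\<bar> \<le> d * exp (L * y\<^sup>2 * 1\<^sup>2) / 2 - d * exp (L * y\<^sup>2 * 0\<^sup>2) / 2"
    using integral_norm_bound_integral[OF has_integral_integrable[OF int] has_integral_integrable[OF G]] le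
    unfolding integral_unique[OF int] integral_unique[OF G] real_norm_def by blast
  then show ?thesis using \<open>d \<ge> 0\<close> by (simp add: xy L_def)
qed

lemma volterra_fixed_point:
  obtains f where "continuous_on X f" "\<And>x. x \<in> X \<Longrightarrow> volterra f x = f x"
proof (rule weighted_contraction_fixed_point[where X = X and P = "{f. continuous_on X f}" and T = volterra
      and w = "\<lambda>x. exp ((c + p) * (snd x)\<^sup>2)" and q = "1 / 2" and D = 1 and ?f0.0 = "\<lambda>_. 1"])
  fix x assume x: "x \<in> X"
  have "norm (integral {0..1} (integrand (\<lambda>_. 1) x)) \<le> integral {0..1::real} (\<lambda>_. c + p)"
    by (rule integral_norm_bound_integral) (use x integrand_integrable integrand_bound in auto)
  then have "\<bar>(snd x)\<^sup>2 * integral {0..1} (integrand (\<lambda>_. 1) x)\<bar> \<le> (snd x)\<^sup>2 * (c + p)"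
    by (simp add: abs_mult mult_left_mono)
  also have "\<dots> \<le> exp ((c + p) * (snd x)\<^sup>2)"
    by (rule order_trans[OF _ exp_ge_add_one_self]) (simp add: mult.commute)
  finally show "norm (volterra (\<lambda>_. 1) x - 1) \<le> 1 * exp ((c + p) * (snd x)\<^sup>2)"
    by (simp add: volterra_def)
next
  fix F f
  let ?w = "\<lambda>x. exp ((c + p) * (snd x)\<^sup>2)"
  assume F: "\<And>n. F n \<in> {f. continuous_on X f}"
    and lim: "\<And>e. e > 0 \<Longrightarrow> \<forall>\<^sub>F n in sequentially. \<forall>x\<in>X. norm (F n x - f x :: real) \<le> e * ?w x"
  \<comment> \<open>Dividing by the weight turns weighted convergence into uniform convergence,
    which preserves continuity.\<close>
  have "uniform_limit X (\<lambda>n x. F n x / ?w x) (\<lambda>x. f x / ?w x) sequentially"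
  proof (rule uniform_limitI)
    fix e :: real assume "e > 0"
    then have "\<forall>\<^sub>F n in sequentially. \<forall>x\<in>X. norm (F n x - f x) \<le> e / 2 * ?w x" by (intro lim) simp
    then show "\<forall>\<^sub>F n in sequentially. \<forall>x\<in>X. dist (F n x / ?w x) (f x / ?w x) < e"
    proof eventually_elim
      case (elim n)
      have "dist (F n x / ?w x) (f x / ?w x) \<le> e / 2" if "x \<in> X" for x
        using elim that by (simp add: dist_norm divide_le_eq flip: diff_divide_distrib)
      then show ?case using \<open>e > 0\<close> by fastforce
    qed
  qed
  then have "continuous_on X (\<lambda>x. f x / ?w x)"
    by (rule uniform_limit_theorem[rotated]) (use F in \<open>auto intro!: always_eventually continuous_intros\<close>)
  then have "continuous_on X (\<lambda>x. f x / ?w x * ?w x)"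
    by (rule continuous_on_mult) (intro continuous_intros)
  then show "f \<in> {f. continuous_on X f}" by simp
qed (use that volterra_contraction continuous_on_volterra in auto)


section \<open>The profile as a classical solution of the rescaled equation\<close>

definition U where "U = (SOME f. continuous_on X f \<and> (\<forall>x\<in>X. volterra f x = f x))"

lemma continuous_on_U: "continuous_on X U"
  and volterra_U: "x \<in> X \<Longrightarrow> volterra U x = U x"
proof -
  obtain f where "continuous_on X f" "\<And>x. x \<in> X \<Longrightarrow> volterra f x = f x"
    using volterra_fixed_point by blast
  then have "\<exists>f. continuous_on X f \<and> (\<forall>x\<in>X. volterra f x = f x)" by blast
  from someI_ex[OF this] show "continuous_on X U" "x \<in> X \<Longrightarrow> volterra U x = U x"
    by (auto simp: U_def)
qed

definition src :: "real \<Rightarrow> real \<Rightarrow> real"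
  where "src \<eta> s = nl \<eta> (clamp (U (\<eta>, s))) / (1 - (\<eta> * s)\<^sup>2)"

text \<open>The equation \<open>(y ^ k * U')' = y ^ k * src\<close> integrated once. At
  \<open>y = 0\<close> division by zero gives 0, which is the correct slope at the centre and makes
  \<open>dU\<close> continuous there.\<close>

definition dU :: "real \<Rightarrow> real \<Rightarrow> real"
  where "dU \<eta> y = integral {0..y} (\<lambda>s. s ^ k * src \<eta> s) / y ^ k"

lemma U_0: "0 \<le> \<eta> \<Longrightarrow> \<eta> \<le> 1 \<Longrightarrow> U (\<eta>, 0) = 1"
  using volterra_U[of "(\<eta>, 0)"] by (simp add: volterra_def X_def)

lemma continuous_on_U_slice: "continuous_on {y. 0 \<le> y \<and> \<eta> * y \<le> 1} (\<lambda>y. U (\<eta>, y))"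
  if "0 \<le> \<eta>" "\<eta> \<le> 1"
  by (rule continuous_on_compose2[OF continuous_on_U]) (use that in \<open>auto simp: X_def intro!: continuous_intros\<close>)

lemma continuous_on_src: 
  assumes "0 \<le> \<eta>" "\<eta> \<le> 1" "\<eta> * y < 1" shows "continuous_on {0..y} (src \<eta>)"
proof -
  have le: "\<eta> * s < 1" if "s \<le> y" for s
    using assms mult_left_mono[OF that, of \<eta>] by simp
  have "continuous_on {0..y} (\<lambda>y. U (\<eta>, y))"
    by (rule continuous_on_subset[OF continuous_on_U_slice]) (use assms le in \<open>auto simp: less_imp_le\<close>)
  then have "continuous_on {0..y} (\<lambda>s. clamp (U (\<eta>, s)))"
    unfolding clamp_def by (intro continuous_intros)
  moreover have "1 - (\<eta> * s)\<^sup>2 \<noteq> 0" if "s \<in> {0..y}" for s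
  proof -
    have "(\<eta> * s)\<^sup>2 < 1" using le[of s] that assms by (simp add: abs_square_less_1)
    then show ?thesis by simp
  qed
  ultimately show ?thesis unfolding src_def nl_def using p_gt
    by (intro continuous_intros continuous_on_powr') (auto simp: clamp_bounds)
qed

lemma integral_scale_ray:
  assumes h: "continuous_on {0..y} h" and "0 \<le> y"
  shows "((\<lambda>t. y * h (t * y)) has_integral integral {0..y} h) {0..1::real}"
proof -
  have "((\<lambda>t. y * h (t * y)) has_integral (integral {0..1 * y} h - integral {0..0 * y} h)) {0..1::real}"
  proof (rule fundamental_theorem_of_calculus)
    fix t :: real assume t: "t \<in> {0..1}"
    then have ty: "t * y \<in> {0..y}" using \<open>0 \<le> y\<close> mult_right_mono[of t 1 y] by auto
    have "((\<lambda>x. integral {0..x} h) has_real_derivative h (t * y)) (at (t * y) within {0..y})"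
      by (rule integral_has_real_derivative[OF h ty])
    then have "((\<lambda>x. integral {0..x} h) has_real_derivative h (t * y)) (at (t * y) within (\<lambda>t. t * y) ` {0..1})"
      by (rule DERIV_subset) (use \<open>0 \<le> y\<close> in \<open>auto intro: mult_left_le_one_le\<close>)
    moreover have "((\<lambda>t. t * y) has_real_derivative y) (at t within {0..1})"
      by (auto intro!: derivative_eq_intros)
    ultimately have "((\<lambda>t. integral {0..t * y} h) has_real_derivative h (t * y) * y) (at t within {0..1})"
      using DERIV_image_chain by (fastforce simp: o_def)
    then show "((\<lambda>t. integral {0..t * y} h) has_vector_derivative y * h (t * y)) (at t within {0..1})"
      by (simp add: has_real_derivative_iff_has_vector_derivative mult.commute)
  qed simp
  then show ?thesis by simp
qed

text \<open>In the scaled form \<open>y\<close> sits inside the integrand. The substitution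
  \<open>s = t * y\<close> moves it into the limits of integration, where it can be differentiated
  without knowing that \<open>U\<close> is differentiable. The light cone is excluded because
  \<open>src\<close> may blow up there.\<close>

lemma U_integral_eq:
  assumes "0 \<le> \<eta>" "\<eta> \<le> 1" "\<eta> * y < 1" "0 < y"
  shows "U (\<eta>, y) = 1 + (integral {0..y} (\<lambda>s. s * src \<eta> s)
    - integral {0..y} (\<lambda>s. s ^ k * src \<eta> s) / y ^ (k - 1)) / (real k - 1)"
proof -
  have c: "continuous_on {0..y} (src \<eta>)" by (rule continuous_on_src) fact+
  have X: "(\<eta>, y) \<in> X" using assms by (simp add: X_def)
  let ?A = "integral {0..y} (\<lambda>s. s * src \<eta> s)" and ?B = "integral {0..y} (\<lambda>s. s ^ k * src \<eta> s)"
  have A: "((\<lambda>t. y * (t * y * src \<eta> (t * y))) has_integral ?A) {0..1}"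
    by (rule integral_scale_ray) (use assms c in \<open>auto intro!: continuous_intros\<close>)
  have B: "((\<lambda>t. y * ((t * y) ^ k * src \<eta> (t * y))) has_integral ?B) {0..1}"
    by (rule integral_scale_ray) (use assms c in \<open>auto intro!: continuous_intros\<close>)
  have I: "((\<lambda>t. (y * (t * y * src \<eta> (t * y)) - y * ((t * y) ^ k * src \<eta> (t * y)) / y ^ (k - 1)) / (real k - 1)) has_integral
      (?A - ?B / y ^ (k - 1)) / (real k - 1)) {0..1}"
    by (intro has_integral_divide has_integral_diff A B)
  have pk: "y ^ k = y ^ (k - 1) * y" "t ^ k = t * t ^ (k - 1)" for t :: real
    using k_ge power_minus_mult[of k y] power_minus_mult[of k t] by (auto simp: mult.commute)
  have yk: "y ^ (k - Suc 0) \<noteq> 0" using assms by simp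
  have eq: "(y * (t * y * src \<eta> (t * y)) - y * ((t * y) ^ k * src \<eta> (t * y)) / y ^ (k - 1)) / (real k - 1)
      = y\<^sup>2 * integrand U (\<eta>, y) t" for t
  proof -
    have 1: "integrand U (\<eta>, y) t = t * (1 - t ^ (k - 1)) / (real k - 1) * src \<eta> (t * y)"
      by (simp add: integrand_def K_def src_def power_mult_distrib mult_ac)
    have 2: "y * ((t * y) ^ k * src \<eta> (t * y)) / y ^ (k - 1) = y\<^sup>2 * t * t ^ (k - 1) * src \<eta> (t * y)"
      using yk by (simp add: power_mult_distrib pk power2_eq_square)
    show ?thesis unfolding 1 2 by (simp add: power2_eq_square diff_divide_distrib algebra_simps)
  qed
  from I have "integral {0..1} (\<lambda>t. y\<^sup>2 * integrand U (\<eta>, y) t) = (?A - ?B / y ^ (k - 1)) / (real k - 1)"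
    unfolding eq by (rule integral_unique)
  then show ?thesis
    using volterra_U[OF X] by (simp add: volterra_def)
qed

lemma U_derivs:
  assumes \<eta>: "0 \<le> \<eta>" "\<eta> \<le> 1" "\<eta> * y < 1" "0 < y"
  shows "((\<lambda>y. U (\<eta>, y)) has_real_derivative dU \<eta> y) (at y)"
    and "(dU \<eta> has_real_derivative src \<eta> y - real k / y * dU \<eta> y) (at y)"
proof -
  have k1: "real k - 1 \<noteq> 0" using k_ge by simp
  \<comment> \<open>Room beyond \<open>y\<close>, but still inside the light cone, gives two-sided
    derivatives.\<close>
  obtain Y where Y: "y < Y" "\<eta> * Y < 1"
  proof (cases "\<eta> = 0")
    case False
    with \<eta> have "y < 1 / \<eta>" by (simp add: field_simps)
    then obtain Y where "y < Y" "Y < 1 / \<eta>" using dense by blast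
    with that False \<eta> show ?thesis by (simp add: field_simps)
  qed (use that[of "y + 1"] in auto)
  have lt: "\<eta> * z < 1" if "z \<le> Y" for z using mult_left_mono[OF that, of \<eta>] \<eta> Y by simp
  have c: "continuous_on {0..Y} (src \<eta>)" by (rule continuous_on_src) (use \<eta> Y in auto)
  have nh: "\<forall>\<^sub>F z in nhds y. z \<in> {0<..<Y}"
    using Y \<eta> by (intro eventually_nhds_in_open) auto
  have at: "at y within {0..Y} = at y" using Y \<eta> by (intro at_within_interior) auto
  have A: "((\<lambda>z. integral {0..z} (\<lambda>s. s * src \<eta> s)) has_real_derivative y * src \<eta> y) (at y)"
    unfolding at[symmetric] by (rule integral_has_real_derivative) (use Y \<eta> c in \<open>auto intro!: continuous_intros\<close>)
  have B: "((\<lambda>z. integral {0..z} (\<lambda>s. s ^ k * src \<eta> s)) has_real_derivative y ^ k * src \<eta> y) (at y)"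
    unfolding at[symmetric] by (rule integral_has_real_derivative) (use Y \<eta> c in \<open>auto intro!: continuous_intros\<close>)
  let ?B = "integral {0..y} (\<lambda>s. s ^ k * src \<eta> s)"
  have ky: "y ^ k = y ^ (k - 1) * y" using k_ge power_minus_mult[of k y] by simp
  have ky2: "y ^ (k - 1) = y ^ (k - 1 - 1) * y" using k_ge power_minus_mult[of "k - 1" y] by simp
  have yne: "y ^ (k - 1 - 1) \<noteq> 0" using \<eta> by simp
  have dpow: "((\<lambda>z. z ^ n) has_real_derivative real n * y ^ (n - 1)) (at y)" for n
    using DERIV_pow[of n y] by simp
  have "((\<lambda>z. 1 + (integral {0..z} (\<lambda>s. s * src \<eta> s)
    - integral {0..z} (\<lambda>s. s ^ k * src \<eta> s) / z ^ (k - 1)) / (real k - 1)) has_real_derivative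
    (y * src \<eta> y - (y ^ k * src \<eta> y * y ^ (k - 1) - ?B * (real (k - 1) * y ^ (k - 1 - 1))) / (y ^ (k - 1) * y ^ (k - 1))) / (real k - 1)) (at y)"
    using DERIV_add[OF DERIV_const[of 1] DERIV_cdivide[OF DERIV_diff[OF A DERIV_divide[OF B dpow[of "k - 1"]]], of "real k - 1"]] \<eta>
    by simp
  moreover have "(y * src \<eta> y - (y ^ k * src \<eta> y * y ^ (k - 1) - ?B * (real (k - 1) * y ^ (k - 1 - 1))) / (y ^ (k - 1) * y ^ (k - 1))) / (real k - 1) = dU \<eta> y"
    unfolding dU_def ky ky2 using \<eta> yne k1 k_ge by (simp add: of_nat_diff field_simps)
  ultimately have "((\<lambda>z. 1 + (integral {0..z} (\<lambda>s. s * src \<eta> s)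
    - integral {0..z} (\<lambda>s. s ^ k * src \<eta> s) / z ^ (k - 1)) / (real k - 1)) has_real_derivative dU \<eta> y) (at y)"
    by simp
  then show "((\<lambda>y. U (\<eta>, y)) has_real_derivative dU \<eta> y) (at y)"
    by (rule DERIV_cong_ev[THEN iffD2, rotated -1, OF _ refl _ refl])
      (use eventually_mono[OF nh] U_integral_eq \<eta> lt in \<open>auto elim!: eventually_mono\<close>)
  have "(dU \<eta> has_real_derivative (y ^ k * src \<eta> y * y ^ k - ?B * (real k * y ^ (k - 1))) / (y ^ k * y ^ k)) (at y)"
    unfolding dU_def[abs_def] using \<eta> by (intro DERIV_divide B dpow) auto
  moreover have "(y ^ k * src \<eta> y * y ^ k - ?B * (real k * y ^ (k - 1))) / (y ^ k * y ^ k) = src \<eta> y - real k / y * dU \<eta> y"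
    unfolding dU_def ky using \<eta> yne by (simp add: field_simps)
  ultimately show "(dU \<eta> has_real_derivative src \<eta> y - real k / y * dU \<eta> y) (at y)" by simp
qed

text \<open>\<open>src\<close> is bounded by its numerator over the smallest denominator on the
  interval, and integrating over [0, y] contributes the factor \<open>y\<close>. Hence the slope
  vanishes linearly at the centre.\<close>

lemma dU_bound:
  assumes \<eta>: "0 \<le> \<eta>" "\<eta> \<le> 1" "\<eta> * y < 1" "0 < y"
  shows "\<bar>dU \<eta> y\<bar> \<le> y * (c + p) / (1 - (\<eta> * y)\<^sup>2)"
proof -
  define M where "M = (c + p) / (1 - (\<eta> * y)\<^sup>2)"
  have pos: "1 - (\<eta> * y)\<^sup>2 > 0" using \<eta> by (simp add: abs_square_less_1)
  have "norm (integral {0..y} (\<lambda>s. s ^ k * src \<eta> s)) \<le> integral {0..y} (\<lambda>s. y ^ k * M)"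
  proof (rule integral_norm_bound_integral)
    show "(\<lambda>s. s ^ k * src \<eta> s) integrable_on {0..y}"
      by (intro integrable_continuous_real continuous_intros continuous_on_src) (use \<eta> in auto)
    show "norm (s ^ k * src \<eta> s) \<le> y ^ k * M" if "s \<in> {0..y}" for s
    proof -
      have "(\<eta> * s)\<^sup>2 \<le> (\<eta> * y)\<^sup>2" using that \<eta> by (intro power_mono mult_left_mono) auto
      with pos have "\<bar>src \<eta> s\<bar> \<le> M"
        using nl_clamp_bound[of \<eta> "U (\<eta>, s)"] \<eta> unfolding src_def M_def by (auto simp: abs_divide intro!: frac_le)
      with that show ?thesis by (auto simp: abs_mult intro!: mult_mono power_mono)
    qed
  qed auto
  then have "\<bar>integral {0..y} (\<lambda>s. s ^ k * src \<eta> s)\<bar> \<le> y ^ k * (y * M)" using \<eta> by (simp add: mult_ac)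
  then show ?thesis using \<eta> by (simp add: dU_def M_def abs_divide divide_le_eq mult_ac)
qed

text \<open>In the original scale \<open>\<eta>\<^sup>2 * c < 1\<close> says that \<open>u 0\<close>
  lies above the constant solution \<open>b\<close>. Then
  \<open>src \<eta> 0 = \<eta>\<^sup>2 * c - 1\<close> is negative and the profile starts by
  decreasing.\<close>

lemma dU_neg:
  assumes \<eta>: "0 \<le> \<eta>" "\<eta> \<le> 1" "\<eta>\<^sup>2 * c < 1"
  obtains \<delta> where "\<delta> > 0" "\<eta> * \<delta> < 1" "\<And>y. 0 < y \<Longrightarrow> y \<le> \<delta> \<Longrightarrow> dU \<eta> y < 0"
proof -
  have h: "\<eta> * (1/2) < 1" using \<eta> by simp
  have cont: "continuous_on {0..1/2} (src \<eta>)" by (rule continuous_on_src) (use \<eta> in auto)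
  have "src \<eta> 0 < 0" using \<eta> by (simp add: src_def U_0 clamp_def nl_def)
  have "\<exists>\<delta>>0. \<forall>x\<in>{0..1/2}. dist x 0 < \<delta> \<longrightarrow> dist (src \<eta> x) (src \<eta> 0) < - src \<eta> 0"
    using cont \<open>src \<eta> 0 < 0\<close> unfolding continuous_on_iff by (metis atLeastAtMost_iff half_gt_zero_iff less_eq_real_def neg_0_less_iff_less order_refl zero_less_one)
  then obtain \<delta> where d0: "\<delta> > 0"
    "\<And>x. x \<in> {0..1/2} \<Longrightarrow> dist x 0 < \<delta> \<Longrightarrow> dist (src \<eta> x) (src \<eta> 0) < - src \<eta> 0" by blast
  have d: "\<delta> > 0" "\<And>x. 0 \<le> x \<Longrightarrow> x \<le> 1/2 \<Longrightarrow> x < \<delta> \<Longrightarrow> src \<eta> x < 0"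
  proof -
    fix x :: real assume "0 \<le> x" "x \<le> 1/2" "x < \<delta>"
    with d0(2)[of x] have "\<bar>src \<eta> x - src \<eta> 0\<bar> < - src \<eta> 0" by (simp add: dist_real_def)
    then show "src \<eta> x < 0" by linarith
  qed fact
  define \<epsilon> where "\<epsilon> = min (\<delta> / 2) (1 / 2)"
  have e: "\<epsilon> > 0" "\<epsilon> < \<delta>" "\<epsilon> \<le> 1/2" using d by (auto simp: \<epsilon>_def)
  have "dU \<eta> y < 0" if y: "0 < y" "y \<le> \<epsilon>" for y
  proof -
    have c': "continuous_on {0..y} (\<lambda>s. - (s ^ k * src \<eta> s))"
      using y e by (intro continuous_intros continuous_on_subset[OF cont]) auto
    have nn: "0 \<le> - (s ^ k * src \<eta> s)" if "s \<in> {0..y}" for s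
      using d(2)[of s] that y e by (simp add: mult_nonneg_nonpos)
    have "integral {0..y} (\<lambda>s. - (s ^ k * src \<eta> s)) \<noteq> 0"
    proof
      assume "integral {0..y} (\<lambda>s. - (s ^ k * src \<eta> s)) = 0"
      with integral_eq_0_iff[OF c' y(1) nn] have "\<forall>s\<in>{0..y}. - (s ^ k * src \<eta> s) = 0" by simp
      from bspec[OF this, of y] have "y ^ k * src \<eta> y = 0" using y by simp
      with d(2)[of y] y e show False by auto
    qed
    moreover have "0 \<le> integral {0..y} (\<lambda>s. - (s ^ k * src \<eta> s))"
      by (intro integral_nonneg integrable_continuous_real c' nn)
    ultimately show ?thesis using y by (simp add: dU_def divide_neg_pos)
  qed
  moreover have "\<eta> * \<epsilon> < 1" using e \<eta> mult_mono[of \<eta> 1 \<epsilon> "1/2"] by simp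
  ultimately show thesis using that e by blast
qed

end

section \<open>Energy and a priori bounds\<close>

text \<open>The weighted inversion serves in both directions: from \<open>U\<close> to
  \<open>v\<close>, and at the end from the continued \<open>V\<close> back to
  \<open>u\<close>.\<close>

lemma inversion_deriv:
  fixes V dV :: "real \<Rightarrow> real"
  assumes x: "x > 0" and V: "(V has_real_derivative dV (1 / x)) (at (1 / x))"
  shows "((\<lambda>x. x powr - \<alpha> * V (1 / x)) has_real_derivative
    - \<alpha> * x powr (- \<alpha> - 1) * V (1 / x) - x powr (- \<alpha> - 2) * dV (1 / x)) (at x)"
proof -
  have inv: "((\<lambda>x. 1 / x) has_real_derivative - (1 / x\<^sup>2)) (at x)"
    using x by (auto intro!: derivative_eq_intros simp: power2_eq_square)
  have "((\<lambda>x. V (1 / x)) has_real_derivative dV (1 / x) * - (1 / x\<^sup>2)) (at x)"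
    using DERIV_chain2[OF V inv] .
  moreover have "((\<lambda>x. x powr - \<alpha>) has_real_derivative - \<alpha> * x powr (- \<alpha> - 1)) (at x)"
    using x by (auto intro!: derivative_eq_intros)
  ultimately have "((\<lambda>x. x powr - \<alpha> * V (1 / x)) has_real_derivative
     - \<alpha> * x powr (- \<alpha> - 1) * V (1 / x) + dV (1 / x) * - (1 / x\<^sup>2) * x powr - \<alpha>) (at x)"
    by (intro DERIV_mult)
  moreover have "x powr (- \<alpha> - 2) = x powr - \<alpha> / x\<^sup>2"
    using x by (simp add: powr_diff)
  ultimately show ?thesis by (simp add: mult.commute)
qed

lemma inversion_deriv2:
  fixes V dV :: "real \<Rightarrow> real"
  assumes x: "x > 0" and V: "(V has_real_derivative dV (1 / x)) (at (1 / x))"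
    and dV: "(dV has_real_derivative V2) (at (1 / x))"
  shows "((\<lambda>x. - \<alpha> * x powr (- \<alpha> - 1) * V (1 / x) - x powr (- \<alpha> - 2) * dV (1 / x)) has_real_derivative
    x powr (- \<alpha> - 4) * (\<alpha> * (\<alpha> + 1) * x\<^sup>2 * V (1 / x) + 2 * (\<alpha> + 1) * x * dV (1 / x) + V2)) (at x)"
proof -
  have inv: "((\<lambda>x. 1 / x) has_real_derivative - (1 / x\<^sup>2)) (at x)"
    using x by (auto intro!: derivative_eq_intros simp: power2_eq_square)
  note dV' = DERIV_chain2[OF dV inv] and V' = DERIV_chain2[OF V inv]
  have pw: "((\<lambda>x. x powr a) has_real_derivative a * x powr (a - 1)) (at x)" for a
    using x by (auto intro!: derivative_eq_intros)
  have "((\<lambda>x. - \<alpha> * (x powr (- \<alpha> - 1) * V (1 / x)) - x powr (- \<alpha> - 2) * dV (1 / x)) has_real_derivative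
     - \<alpha> * ((- \<alpha> - 1) * x powr (- \<alpha> - 1 - 1) * V (1 / x) + dV (1 / x) * - (1 / x\<^sup>2) * x powr (- \<alpha> - 1))
      - ((- \<alpha> - 2) * x powr (- \<alpha> - 2 - 1) * dV (1 / x) + V2 * - (1 / x\<^sup>2) * x powr (- \<alpha> - 2))) (at x)"
    by (intro DERIV_diff DERIV_cmult DERIV_mult pw dV' V')
  moreover
  \<comment> \<open>With one real power factored out, all other powers of \<open>x\<close> are
    natural ones and a rational identity remains.\<close>
  define q where "q = x powr (- \<alpha> - 4)"
  have pq: "x powr a = q * x ^ n" if "a = - \<alpha> - 4 + real n" for a n
    using x by (simp only: that q_def powr_add powr_realpow)
  have "x powr (- \<alpha> - 1) = q * x ^ 3" "x powr (- \<alpha> - 1 - 1) = q * x ^ 2" "x powr (- \<alpha> - 2) = q * x ^ 2"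
    "x powr (- \<alpha> - 2 - 1) = q * x ^ 1"
    by (rule pq; simp)+
  ultimately show ?thesis
    using x by (simp add: q_def[symmetric] field_simps power2_eq_square power3_eq_cube)
qed

context supercritical
begin

text \<open>In the rescaled variable \<open>z = 1 / y\<close> the centre is \<open>z = \<infinity>\<close> and the light cone is \<open>z = \<eta>\<close>.\<close>

definition v :: "real \<Rightarrow> real \<Rightarrow> real"
  where "v \<eta> z = z powr - \<alpha> * U (\<eta>, 1 / z)"

definition dv :: "real \<Rightarrow> real \<Rightarrow> real"
  where "dv \<eta> z = - \<alpha> * z powr (- \<alpha> - 1) * U (\<eta>, 1 / z) - z powr (- \<alpha> - 2) * dU \<eta> (1 / z)"

definition F :: "real \<Rightarrow> real"
  where "F w = w powr (p + 1) / (p + 1) - c * w\<^sup>2 / 2"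

definition energy :: "real \<Rightarrow> real \<Rightarrow> real"
  where "energy \<eta> z = (z\<^sup>2 - \<eta>\<^sup>2) * (dv \<eta> z)\<^sup>2 / 2 + F (v \<eta> z)"

lemma DERIV_F: "w > 0 \<Longrightarrow> (F has_real_derivative w powr p - c * w) (at w)"
proof -
  assume w: "w > 0"
  have "((\<lambda>w. w powr (p + 1)) has_real_derivative (p + 1) * w powr p) (at w)"
    using w by (auto intro!: derivative_eq_intros)
  from DERIV_cdivide[OF this, of "p + 1"] have "((\<lambda>w. w powr (p + 1) / (p + 1)) has_real_derivative w powr p) (at w)"
    using p_gt by simp
  moreover have "((\<lambda>w. c * w\<^sup>2 / 2) has_real_derivative c * w) (at w)"
    by (auto intro!: derivative_eq_intros)
  ultimately show ?thesis unfolding F_def[abs_def] by (rule DERIV_diff)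
qed

lemma v_deriv:
  assumes "0 \<le> \<eta>" "\<eta> \<le> 1" "\<eta> < z" "0 < z"
  shows "(v \<eta> has_real_derivative dv \<eta> z) (at z)"
  unfolding v_def[abs_def] dv_def
  by (rule inversion_deriv) (use U_derivs(1)[of \<eta> "1 / z"] assms in auto)

text \<open>Here the lower order terms cancel: the inversion produces
  \<open>2 * (\<alpha> + 1) * z * dU\<close>, the radial Laplacian produces
  \<open>k * z * dU\<close>, and these agree by \<open>k_eq\<close>. The relation
  \<open>\<alpha> * p = \<alpha> + 2\<close> matches the powers of \<open>z\<close> in the nonlinear
  term. The bounds on \<open>U\<close> make the clamp inactive.\<close>

lemma dv_deriv:
  assumes \<eta>: "0 \<le> \<eta>" "\<eta> \<le> 1" "\<eta> < z" "0 < z" and U: "0 < U (\<eta>, 1 / z)" "U (\<eta>, 1 / z) \<le> 1"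
  shows "(dv \<eta> has_real_derivative (c * v \<eta> z - v \<eta> z powr p) / (z\<^sup>2 - \<eta>\<^sup>2)) (at z)"
proof -
  let ?U = "U (\<eta>, 1 / z)"
  have cl: "clamp ?U = ?U" using U by (simp add: clamp_def)
  have ne: "z\<^sup>2 - \<eta>\<^sup>2 \<noteq> 0" using \<eta> by (simp add: power2_eq_iff)
  have "(dv \<eta> has_real_derivative z powr (- \<alpha> - 4) * (\<alpha> * (\<alpha> + 1) * z\<^sup>2 * ?U
     + 2 * (\<alpha> + 1) * z * dU \<eta> (1 / z) + (src \<eta> (1 / z) - real k / (1 / z) * dU \<eta> (1 / z)))) (at z)"
    unfolding dv_def[abs_def]
    by (rule inversion_deriv2) (use U_derivs[of \<eta> "1 / z"] \<eta> in auto)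
  also have "\<alpha> * (\<alpha> + 1) * z\<^sup>2 * ?U + 2 * (\<alpha> + 1) * z * dU \<eta> (1 / z)
      + (src \<eta> (1 / z) - real k / (1 / z) * dU \<eta> (1 / z)) = c * z\<^sup>2 * ?U + src \<eta> (1 / z)"
    by (simp add: k_eq c_def algebra_simps)
  also have "src \<eta> (1 / z) = z\<^sup>2 * (\<eta>\<^sup>2 * c * ?U - ?U powr p) / (z\<^sup>2 - \<eta>\<^sup>2)"
    using \<eta> ne unfolding src_def cl nl_def by (simp add: field_simps power_divide)
  also have "c * z\<^sup>2 * ?U + z\<^sup>2 * (\<eta>\<^sup>2 * c * ?U - ?U powr p) / (z\<^sup>2 - \<eta>\<^sup>2) = z\<^sup>2 * (c * z\<^sup>2 * ?U - ?U powr p) / (z\<^sup>2 - \<eta>\<^sup>2)"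
    using ne by (simp add: divide_simps) (simp add: algebra_simps)
  also have "z powr (- \<alpha> - 4) * (z\<^sup>2 * (c * z\<^sup>2 * ?U - ?U powr p) / (z\<^sup>2 - \<eta>\<^sup>2))
      = (z powr (- \<alpha> - 4) * z\<^sup>2 * z\<^sup>2 * (c * ?U) - z powr (- \<alpha> - 4) * z\<^sup>2 * ?U powr p) / (z\<^sup>2 - \<eta>\<^sup>2)"
    by (simp add: algebra_simps diff_divide_distrib)
  also have "z powr (- \<alpha> - 4) * z\<^sup>2 * z\<^sup>2 = z powr - \<alpha>"
    using \<eta> by (simp add: powr_diff power2_eq_square powr_numeral power4_eq_xxxx)
  also have "z powr (- \<alpha> - 4) * z\<^sup>2 * ?U powr p = v \<eta> z powr p"
  proof -
    have "- \<alpha> * p = - \<alpha> - 2" using \<alpha>_pos by (simp add: p_def algebra_simps)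
    moreover have "z powr (- \<alpha> - 4) * z\<^sup>2 = z powr (- \<alpha> - 2)"
      using \<eta> by (simp add: powr_diff powr_numeral power2_eq_square power4_eq_xxxx)
    ultimately show ?thesis using U \<eta> by (simp add: v_def powr_mult powr_powr)
  qed
  finally show ?thesis by (simp add: v_def mult_ac)
qed

text \<open>Since the equation has no first order term, inserting it leaves only the derivative of
  the coefficient \<open>z\<^sup>2 - \<eta>\<^sup>2\<close>.\<close>

lemma energy_deriv:
  assumes \<eta>: "0 \<le> \<eta>" "\<eta> \<le> 1" "\<eta> < z" "0 < z" and U: "0 < U (\<eta>, 1 / z)" "U (\<eta>, 1 / z) \<le> 1"
  shows "(energy \<eta> has_real_derivative z * (dv \<eta> z)\<^sup>2) (at z)"
proof -
  have v: "v \<eta> z > 0" using \<eta> U by (simp add: v_def)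
  have ne: "z\<^sup>2 - \<eta>\<^sup>2 \<noteq> 0" using \<eta> by (simp add: power2_eq_iff)
  have Fv: "((\<lambda>z. F (v \<eta> z)) has_real_derivative (v \<eta> z powr p - c * v \<eta> z) * dv \<eta> z) (at z)"
    by (rule DERIV_chain2[where g = "v \<eta>"]) (intro DERIV_F v v_deriv \<eta>)+
  have "(energy \<eta> has_real_derivative ((2 * z * (dv \<eta> z)\<^sup>2 +
       (z\<^sup>2 - \<eta>\<^sup>2) * (2 * dv \<eta> z * ((c * v \<eta> z - v \<eta> z powr p) / (z\<^sup>2 - \<eta>\<^sup>2)))) / 2
       + (v \<eta> z powr p - c * v \<eta> z) * dv \<eta> z)) (at z)"
    unfolding energy_def[abs_def]
    by (rule derivative_eq_intros Fv dv_deriv \<eta> U refl | simp)+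
  also have "(z\<^sup>2 - \<eta>\<^sup>2) * (2 * dv \<eta> z * ((c * v \<eta> z - v \<eta> z powr p) / (z\<^sup>2 - \<eta>\<^sup>2)))
     = 2 * dv \<eta> z * (c * v \<eta> z - v \<eta> z powr p)" using ne by simp
  finally show ?thesis by (simp add: add_divide_distrib diff_divide_distrib algebra_simps)
qed

section \<open>Asymptotics at the centre\<close>

lemma tendsto_U_infinity:
  assumes "0 \<le> \<eta>" "\<eta> \<le> 1"
  shows "((\<lambda>z. U (\<eta>, 1 / z)) \<longlongrightarrow> 1) at_top" "((\<lambda>z. 1 / z * dU \<eta> (1 / z)) \<longlongrightarrow> 0) at_top"
proof -
  have inv: "((\<lambda>z::real. 1 / z) \<longlongrightarrow> 0) at_top" by (rule tendsto_divide_0) (auto intro: filterlim_ident filterlim_at_top_imp_at_infinity)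
  have "((\<lambda>z. U (\<eta>, 1 / z)) \<longlongrightarrow> U (\<eta>, 0)) at_top"
  proof (rule continuous_on_tendsto_compose[OF continuous_on_U_slice[OF assms] inv])
    show "\<forall>\<^sub>F z in at_top. 1 / z \<in> {y. 0 \<le> y \<and> \<eta> * y \<le> 1}"
      using eventually_ge_at_top[of 1] by eventually_elim (use assms in \<open>auto simp: divide_le_eq\<close>)
  qed auto
  then show "((\<lambda>z. U (\<eta>, 1 / z)) \<longlongrightarrow> 1) at_top" using U_0 assms by simp
  show "((\<lambda>z. 1 / z * dU \<eta> (1 / z)) \<longlongrightarrow> 0) at_top"
  proof (rule Lim_null_comparison)
    show "\<forall>\<^sub>F z in at_top. norm (1 / z * dU \<eta> (1 / z)) \<le> 1 / z * (1 / z * (2 * (c + p)))"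
      using eventually_ge_at_top[of 2]
    proof eventually_elim
      case (elim z)
      have "(\<eta> * (1 / z))\<^sup>2 \<le> (1 / 2)\<^sup>2"
        using elim assms by (intro power_mono) (auto simp: field_simps)
      also have "(1 / 2)\<^sup>2 \<le> (1 / 2 :: real)" by (simp add: power2_eq_square)
      finally have "1 / 2 \<le> 1 - (\<eta> * (1 / z))\<^sup>2" by linarith
      then have "(c + p) / (1 - (\<eta> * (1 / z))\<^sup>2) \<le> (c + p) / (1 / 2)"
        using c_pos p_gt by (intro divide_left_mono mult_pos_pos) linarith+
      then have "1 / z * ((c + p) / (1 - (\<eta> * (1 / z))\<^sup>2)) \<le> 1 / z * (2 * (c + p))"
        using elim by (intro mult_left_mono) auto
      moreover have "\<eta> * (1 / z) < 1" using elim assms by (simp add: field_simps)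
      ultimately have "\<bar>dU \<eta> (1 / z)\<bar> \<le> 1 / z * (2 * (c + p))"
        using dU_bound[of \<eta> "1 / z"] assms elim by simp
      then have "1 / z * \<bar>dU \<eta> (1 / z)\<bar> \<le> 1 / z * (1 / z * (2 * (c + p)))"
        using elim by (intro mult_left_mono) auto
      then show ?case using elim by (simp add: abs_mult)
    qed
    show "((\<lambda>z. 1 / z * (1 / z * (2 * (c + p)))) \<longlongrightarrow> 0) at_top"
      using tendsto_mult[OF inv tendsto_mult[OF inv tendsto_const]] by simp
  qed
qed

lemma z_dv_eq: "z > 0 \<Longrightarrow> z * dv \<eta> z = - (z powr - \<alpha>) * (\<alpha> * U (\<eta>, 1 / z) + 1 / z * dU \<eta> (1 / z))"
  unfolding dv_def powr_diff by (simp add: power2_eq_square field_simps)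

lemma tendsto_v_infinity:
  assumes "0 \<le> \<eta>" "\<eta> \<le> 1"
  shows "(v \<eta> \<longlongrightarrow> 0) at_top" "((\<lambda>z. z * dv \<eta> z) \<longlongrightarrow> 0) at_top" "\<forall>\<^sub>F z in at_top. dv \<eta> z < 0"
proof -
  have pw: "((\<lambda>z::real. z powr - \<alpha>) \<longlongrightarrow> 0) at_top"
    using \<alpha>_pos by (intro tendsto_neg_powr filterlim_ident) auto
  show "(v \<eta> \<longlongrightarrow> 0) at_top"
    unfolding v_def[abs_def] using tendsto_mult[OF pw tendsto_U_infinity(1)[OF assms]] by simp
  have A: "((\<lambda>z. \<alpha> * U (\<eta>, 1 / z) + 1 / z * dU \<eta> (1 / z)) \<longlongrightarrow> \<alpha> * 1 + 0) at_top"
    by (intro tendsto_intros tendsto_U_infinity assms)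
  have "((\<lambda>z. - (z powr - \<alpha>) * (\<alpha> * U (\<eta>, 1 / z) + 1 / z * dU \<eta> (1 / z))) \<longlongrightarrow> - 0 * (\<alpha> * 1 + 0)) at_top"
    by (intro tendsto_mult tendsto_minus pw A)
  then have "((\<lambda>z. - (z powr - \<alpha>) * (\<alpha> * U (\<eta>, 1 / z) + 1 / z * dU \<eta> (1 / z))) \<longlongrightarrow> 0) at_top"
    by (simp only: minus_zero mult_zero_left)
  then show "((\<lambda>z. z * dv \<eta> z) \<longlongrightarrow> 0) at_top"
    by (rule Lim_transform_eventually)
      (use eventually_gt_at_top[of 0] in eventually_elim, simp only: z_dv_eq)
  from A have "\<forall>\<^sub>F z in at_top. \<alpha> * U (\<eta>, 1 / z) + 1 / z * dU \<eta> (1 / z) > 0"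
    using \<alpha>_pos by (intro order_tendstoD) auto
  then show "\<forall>\<^sub>F z in at_top. dv \<eta> z < 0"
    using eventually_gt_at_top[of 0]
  proof eventually_elim
    case (elim z)
    then have "z * dv \<eta> z < 0" by (subst z_dv_eq) (auto intro: mult_neg_pos)
    with elim show ?case by (simp add: mult_less_0_iff)
  qed
qed

lemma tendsto_energy_infinity:
  assumes "0 \<le> \<eta>" "\<eta> \<le> 1" shows "(energy \<eta> \<longlongrightarrow> 0) at_top"
proof -
  note v = tendsto_v_infinity[OF assms]
  have pos: "\<forall>\<^sub>F z in at_top. 0 \<le> v \<eta> z"
    using order_tendstoD(1)[OF tendsto_U_infinity(1)[OF assms], of 0, OF zero_less_one]
    by (rule eventually_mono) (simp add: v_def)
  have "((\<lambda>z. v \<eta> z powr (p + 1)) \<longlongrightarrow> 0 powr (p + 1)) at_top"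
    using p_gt pos by (intro tendsto_powr' v tendsto_const) auto
  then have F: "((\<lambda>z. F (v \<eta> z)) \<longlongrightarrow> 0) at_top"
    using tendsto_diff[OF tendsto_divide[OF _ tendsto_const[of "p + 1"]]
        tendsto_divide[OF tendsto_mult[OF tendsto_const[of c] tendsto_power[OF v(1), of 2]] tendsto_const[of 2]]] p_gt
    unfolding F_def by fastforce
  have "((\<lambda>z. (z * dv \<eta> z)\<^sup>2 / 2) \<longlongrightarrow> 0) at_top"
    using tendsto_divide[OF tendsto_power[OF v(2), of 2] tendsto_const[of 2]] by simp
  moreover have "\<forall>\<^sub>F z in at_top. norm ((z\<^sup>2 - \<eta>\<^sup>2) * (dv \<eta> z)\<^sup>2 / 2) \<le> (z * dv \<eta> z)\<^sup>2 / 2"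
    using eventually_ge_at_top[of 1]
  proof eventually_elim
    case (elim z)
    have "\<eta>\<^sup>2 \<le> z\<^sup>2" using elim assms by (intro power_mono) auto
    then show ?case by (simp add: power_mult_distrib abs_mult mult_right_mono)
  qed
  ultimately have "((\<lambda>z. (z\<^sup>2 - \<eta>\<^sup>2) * (dv \<eta> z)\<^sup>2 / 2) \<longlongrightarrow> 0) at_top" by (rule Lim_null_comparison[rotated])
  from tendsto_add[OF this F] show ?thesis by (simp add: energy_def[abs_def])
qed

section \<open>Sign of the energy and bounds up to the light cone\<close>

text \<open>The lower end \<open>z0\<close> is free because the bounds on \<open>U\<close> are
  themselves derived from this lemma: there \<open>z0\<close> is a hypothetical point of first exit,
  and later it is the cone.\<close>

lemma energy_mono:
  assumes \<eta>: "0 \<le> \<eta>" "\<eta> \<le> 1" "\<eta> \<le> z0" "0 \<le> z0" 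
    and U: "\<And>z. z0 < z \<Longrightarrow> 0 < U (\<eta>, 1 / z) \<and> U (\<eta>, 1 / z) \<le> 1"
    and z: "z0 < z1" "z1 \<le> z2"
  shows "energy \<eta> z1 \<le> energy \<eta> z2"
proof (rule DERIV_nonneg_imp_nondecreasing[OF z(2)])
  fix z assume "z1 \<le> z" "z \<le> z2"
  then show "\<exists>y. (energy \<eta> has_real_derivative y) (at z) \<and> 0 \<le> y"
    using energy_deriv[of \<eta> z] U[of z] \<eta> z by (intro exI[of _ "z * (dv \<eta> z)\<^sup>2"]) auto
qed

text \<open>A nondecreasing function with limit 0 is at most 0; it is strictly below because far out
  \<open>dv \<eta> z < 0\<close> makes the energy strictly increasing.\<close>

lemma energy_neg:
  assumes \<eta>: "0 \<le> \<eta>" "\<eta> \<le> 1" "\<eta> \<le> z0" "0 \<le> z0" 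
    and U: "\<And>z. z0 < z \<Longrightarrow> 0 < U (\<eta>, 1 / z) \<and> U (\<eta>, 1 / z) \<le> 1"
    and z: "z0 < z"
  shows "energy \<eta> z < 0"
proof -
  obtain B where B: "\<And>z. z \<ge> B \<Longrightarrow> dv \<eta> z < 0"
    using tendsto_v_infinity(3)[OF \<eta>(1,2)] by (auto simp: eventually_at_top_linorder)
  define z1 where "z1 = max B z"
  have "energy \<eta> z1 < energy \<eta> (z1 + 1)"
  proof (rule DERIV_pos_imp_increasing[where f = "energy \<eta>" and a = z1 and b = "z1 + 1"])
    fix x assume x: "z1 \<le> x" "x \<le> z1 + 1"
    then have "x * (dv \<eta> x)\<^sup>2 > 0" using B[of x] \<eta> z by (auto simp: z1_def)
    then show "\<exists>y. (energy \<eta> has_real_derivative y) (at x) \<and> 0 < y"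
      using energy_deriv[of \<eta> x] U[of x] \<eta> z x by (intro exI[of _ "x * (dv \<eta> x)\<^sup>2"]) (auto simp: z1_def)
  qed simp
  moreover have "energy \<eta> z \<le> energy \<eta> z1"
    by (rule energy_mono[where ?z0.0 = z0]) (use \<eta> U z in \<open>auto simp: z1_def\<close>)
  moreover have "energy \<eta> (z1 + 1) \<le> 0"
  proof (rule tendsto_lowerbound[OF tendsto_energy_infinity[OF \<eta>(1,2)]])
    show "\<forall>\<^sub>F x in at_top. energy \<eta> (z1 + 1) \<le> energy \<eta> x"
      using eventually_ge_at_top[of "z1 + 1"]
    proof eventually_elim
      case (elim x)
      show ?case by (rule energy_mono[where ?z0.0 = z0]) (use \<eta> U z elim in \<open>auto simp: z1_def\<close>)
    qed
  qed simp
  ultimately show ?thesis by simp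
qed

text \<open>Consider the first point where \<open>U\<close> leaves the open interval (0, 1). If it
  reaches 0 there, the energy has a nonnegative limit at that point, although it is nondecreasing in
  \<open>z\<close> and negative. If it returns to 1, a second energy, taken in the variable
  \<open>y\<close>, would be back at its initial value although it is dissipated.\<close>

lemma U_bounds:
  assumes \<eta>: "0 \<le> \<eta>" "\<eta> \<le> 1" "\<eta>\<^sup>2 * c < 1" and y: "0 < y" "\<eta> * y < 1"
  shows "0 < U (\<eta>, y) \<and> U (\<eta>, y) < 1"
proof -
  have mono: "\<eta> * s < 1" if "s \<le> y" for s using mult_left_mono[OF that, of \<eta>] \<eta> y by simp
  have cont: "continuous_on {0..y} (\<lambda>y. U (\<eta>, y))"
    by (rule continuous_on_subset[OF continuous_on_U_slice]) (use \<eta> mono in \<open>auto simp: less_imp_le\<close>)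
  obtain \<delta> where \<delta>: "\<delta> > 0" "\<eta> * \<delta> < 1" "\<And>y. 0 < y \<Longrightarrow> y \<le> \<delta> \<Longrightarrow> dU \<eta> y < 0"
    using dU_neg[OF \<eta>] by metis
  have "\<exists>d>0. \<forall>x\<in>{0..y}. dist x 0 < d \<longrightarrow> dist (U (\<eta>, x)) (U (\<eta>, 0)) < 1"
    using cont y unfolding continuous_on_iff by (metis atLeastAtMost_iff less_eq_real_def order_refl zero_less_one)
  then obtain d where d: "d > 0" "\<And>x. x \<in> {0..y} \<Longrightarrow> dist x 0 < d \<Longrightarrow> dist (U (\<eta>, x)) (U (\<eta>, 0)) < 1" by blast
  have dpos: "U (\<eta>, x) > 0" if "0 \<le> x" "x \<le> y" "x < d" for x
    using d(2)[of x] that U_0[OF \<eta>(1,2)] by (simp add: dist_real_def)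
  define e where "e = min \<delta> (min (d / 2) y)"
  have e: "0 < e" "e \<le> \<delta>" "e < d" "e \<le> y" using \<delta> d y by (auto simp: e_def)
  have small: "0 < U (\<eta>, s)" "U (\<eta>, s) < 1" if s: "0 < s" "s \<le> e" for s
  proof -
    show "0 < U (\<eta>, s)" using dpos s e by simp
    have "U (\<eta>, s) < U (\<eta>, 0)"
    proof (rule DERIV_neg_imp_decreasing_open[OF s(1)])
      fix x assume "0 < x" "x < s"
      then show "\<exists>l. ((\<lambda>y. U (\<eta>, y)) has_real_derivative l) (at x) \<and> l < 0"
        using U_derivs(1)[of \<eta> x] \<delta>(3)[of x] \<eta> mono[of x] s e by (intro exI[of _ "dU \<eta> x"]) auto
    next
      show "continuous_on {0..s} (\<lambda>y. U (\<eta>, y))"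
        by (rule continuous_on_subset[OF cont]) (use s e in auto)
    qed
    then show "U (\<eta>, s) < 1" using U_0 \<eta> by simp
  qed
  define S where "S = {s \<in> {e..y}. U (\<eta>, s) \<in> {0, 1}}"
  have exit: "\<exists>r\<in>{e..s}. U (\<eta>, r) \<in> {0, 1}" if s: "e \<le> s" "s \<le> y" and ne: "\<not> (0 < U (\<eta>, s) \<and> U (\<eta>, s) < 1)" for s
  proof -
    have c: "continuous_on {e..s} (\<lambda>y. U (\<eta>, y))" by (rule continuous_on_subset[OF cont]) (use s e in auto)
    from ne consider "U (\<eta>, s) \<le> 0" | "U (\<eta>, s) \<ge> 1" by linarith
    then show ?thesis
    proof cases
      case 1
      then show ?thesis using IVT2'[of "\<lambda>y. U (\<eta>, y)" s 0 e] c s small[of e] e by auto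
    next
      case 2
      then show ?thesis using IVT'[of "\<lambda>y. U (\<eta>, y)" e 1 s] c s small[of e] e by auto
    qed
  qed
  show ?thesis
  proof (rule ccontr)
    assume "\<not> ?thesis"
    with exit[of y] e have "S \<noteq> {}" by (auto simp: S_def)
    moreover have "closed S"
    proof -
      have "closed ({e..y} \<inter> (\<lambda>y. U (\<eta>, y)) -` {0, 1})"
        by (rule continuous_closed_preimage[OF continuous_on_subset[OF cont]]) (use e in auto)
      then show ?thesis by (simp add: S_def vimage_def Int_def)
    qed
    moreover have bdd: "bdd_below S" by (auto simp: S_def intro: bdd_belowI[of _ e])
    ultimately have IS: "Inf S \<in> S" by (intro closed_contains_Inf)
    define y1 where "y1 = Inf S"
    have y1: "e \<le> y1" "y1 \<le> y" "U (\<eta>, y1) \<in> {0, 1}" using IS by (auto simp: S_def y1_def)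
    have ey: "e < y1" using y1 small[of e] e by (cases "e = y1") auto
    have before: "0 < U (\<eta>, s) \<and> U (\<eta>, s) < 1" if s: "0 < s" "s < y1" for s
    proof (cases "s \<le> e")
      case False
      show ?thesis
      proof (rule ccontr)
        assume "\<not> ?thesis"
        with exit[of s] False s y1 obtain r where "r \<in> {e..s}" "U (\<eta>, r) \<in> {0, 1}" by auto
        then have "r \<in> S" using s y1 by (auto simp: S_def)
        then have "y1 \<le> r" unfolding y1_def by (rule cInf_lower) (rule bdd)
        with \<open>r \<in> {e..s}\<close> s show False by auto
      qed
    qed (use small s in auto)
    from y1(3) consider "U (\<eta>, y1) = 0" | "U (\<eta>, y1) = 1" by auto
    then show False
    proof cases
      case 1
      have z1: "\<eta> < 1 / y1" "0 < 1 / y1" using mono[OF y1(2)] ey e by (auto simp: field_simps)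
      have Uz: "0 < U (\<eta>, 1 / z) \<and> U (\<eta>, 1 / z) \<le> 1" if "1 / y1 < z" for z
        using before[of "1 / z"] that ey e z1 by (auto simp: field_simps)
      define z2 where "z2 = 1 / y1 + 1"
      have E: "energy \<eta> z \<le> energy \<eta> z2" if "1 / y1 < z" "z \<le> z2" for z
        by (rule energy_mono[where ?z0.0 = "1 / y1"]) (use \<eta> z1 Uz that in auto)
      \<comment> \<open>The energy is known to be differentiable only where \<open>U > 0\<close>, so
        at the zero itself it is reached through a limit from the right.\<close>
      have dvc: "isCont (dv \<eta>) (1 / y1)" "isCont (v \<eta>) (1 / y1)"
      proof -
        have y: "1 / (1 / y1) = y1" by simp
        have u: "((\<lambda>y. U (\<eta>, y)) has_real_derivative dU \<eta> (1 / (1 / y1))) (at (1 / (1 / y1)))"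
          "(dU \<eta> has_real_derivative src \<eta> y1 - real k / y1 * dU \<eta> y1) (at (1 / (1 / y1)))"
          unfolding y by (rule U_derivs; use \<eta> ey e mono[OF y1(2)] in auto)+
        show "isCont (dv \<eta>) (1 / y1)"
          unfolding dv_def[abs_def] by (rule DERIV_isCont[OF inversion_deriv2[OF z1(2) u]])
        show "isCont (v \<eta>) (1 / y1)"
          by (rule DERIV_isCont[OF v_deriv]) (use \<eta> z1 in auto)
      qed
      then have lim: "(dv \<eta> \<longlongrightarrow> dv \<eta> (1 / y1)) (at_right (1 / y1))" "(v \<eta> \<longlongrightarrow> v \<eta> (1 / y1)) (at_right (1 / y1))"
        by (auto simp: isCont_def filterlim_at_split)
      have v0: "v \<eta> (1 / y1) = 0" using 1 by (simp add: v_def)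
      have near: "\<forall>\<^sub>F z in at_right (1 / y1). 1 / y1 < z \<and> z \<le> z2"
        unfolding z2_def by (auto simp: eventually_at_right_field intro!: exI[of _ "1 / y1 + 1"])
      have vp: "((\<lambda>z. v \<eta> z powr (p + 1)) \<longlongrightarrow> 0 powr (p + 1)) (at_right (1 / y1))"
      proof (rule tendsto_powr'[OF lim(2)[unfolded v0] tendsto_const])
        show "0 \<noteq> (0::real) \<or> 0 < p + 1 \<and> (\<forall>\<^sub>F z in at_right (1 / y1). 0 \<le> v \<eta> z)"
          using p_gt eventually_mono[OF near, of "\<lambda>z. 0 \<le> v \<eta> z"] Uz by (auto simp: v_def less_imp_le)
      qed
      have "(energy \<eta> \<longlongrightarrow> ((1 / y1)\<^sup>2 - \<eta>\<^sup>2) * (dv \<eta> (1 / y1))\<^sup>2 / 2 + (0 powr (p + 1) / (p + 1) - c * (v \<eta> (1 / y1))\<^sup>2 / 2)) (at_right (1 / y1))"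
        unfolding energy_def[abs_def] F_def using p_gt
        by (intro tendsto_add tendsto_divide tendsto_diff tendsto_mult tendsto_power tendsto_const tendsto_ident_at lim vp) auto
      then have "((1 / y1)\<^sup>2 - \<eta>\<^sup>2) * (dv \<eta> (1 / y1))\<^sup>2 / 2 + (0 powr (p + 1) / (p + 1) - c * (v \<eta> (1 / y1))\<^sup>2 / 2) \<le> energy \<eta> z2"
        by (rule tendsto_upperbound) (rule eventually_mono[OF near], use E in auto)
      moreover have "energy \<eta> z2 < 0"
        by (rule energy_neg[where ?z0.0 = "1 / y1"]) (use \<eta> z1 Uz in \<open>auto simp: z2_def\<close>)
      moreover have "\<eta>\<^sup>2 \<le> (1 / y1)\<^sup>2" using \<eta> z1 by (intro power_mono) auto
      then have "((1 / y1)\<^sup>2 - \<eta>\<^sup>2) * (dv \<eta> (1 / y1))\<^sup>2 \<ge> 0" by (intro mult_nonneg_nonneg) auto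
      ultimately show False by (simp add: v0)
    next
      case 2
      \<comment> \<open>Energy of the rescaled equation in \<open>y\<close>. It is lost to the
        friction \<open>k / y\<close> and to the decrease of
        \<open>1 - (\<eta> * y)\<^sup>2\<close>. At the centre, where the slope is 0, it is exactly
        the potential at 1, which is a lower bound for \<open>G\<close> wherever
        \<open>U = 1\<close>.\<close>
      define G where "G = (\<lambda>s. (1 - (\<eta> * s)\<^sup>2) * (dU \<eta> s)\<^sup>2 / 2 + U (\<eta>, s) powr (p + 1) / (p + 1) - \<eta>\<^sup>2 * c * (U (\<eta>, s))\<^sup>2 / 2)"
      have Gd: "(G has_real_derivative - (dU \<eta> s)\<^sup>2 * ((1 - (\<eta> * s)\<^sup>2) * (real k / s) + \<eta>\<^sup>2 * s)) (at s)" if s: "0 < s" "s < y1" for s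
      proof -
        note b = before[OF s]
        have lt: "\<eta> * s < 1" using mono[of s] s y1 by simp
        have ne: "1 - (\<eta> * s)\<^sup>2 \<noteq> 0"
          using lt s \<eta> abs_square_less_1[of "\<eta> * s"] by auto
        note u = U_derivs[OF \<eta>(1,2) lt s(1)]
        have "((\<lambda>w. w powr (p + 1)) has_real_derivative (p + 1) * U (\<eta>, s) powr p) (at (U (\<eta>, s)))"
          using b by (auto intro!: derivative_eq_intros)
        from DERIV_cdivide[OF DERIV_chain2[OF this u(1)], of "p + 1"]
        have Up: "((\<lambda>s. U (\<eta>, s) powr (p + 1) / (p + 1)) has_real_derivative U (\<eta>, s) powr p * dU \<eta> s) (at s)"
          using p_gt by simp
        have "(G has_real_derivative (- (2 * (\<eta> * s) * \<eta>) * (dU \<eta> s)\<^sup>2 + (2 * dU \<eta> s * (src \<eta> s - real k / s * dU \<eta> s)) * (1 - (\<eta> * s)\<^sup>2)) / 2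
          + U (\<eta>, s) powr p * dU \<eta> s - \<eta>\<^sup>2 * c * (2 * U (\<eta>, s) * dU \<eta> s) / 2) (at s)"
          unfolding G_def by (rule derivative_eq_intros Up u refl | simp)+
        also have "(2 * dU \<eta> s * (src \<eta> s - real k / s * dU \<eta> s)) * (1 - (\<eta> * s)\<^sup>2)
          = 2 * dU \<eta> s * ((1 - (\<eta> * s)\<^sup>2) * src \<eta> s) - 2 * (dU \<eta> s)\<^sup>2 * ((1 - (\<eta> * s)\<^sup>2) * (real k / s))"
          by (simp only: power2_eq_square ring_distribs mult_ac)
        also have "(1 - (\<eta> * s)\<^sup>2) * src \<eta> s = \<eta>\<^sup>2 * c * U (\<eta>, s) - U (\<eta>, s) powr p"
          using ne b by (simp add: src_def nl_def clamp_def)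
        finally show ?thesis by (rule DERIV_cong) (simp add: field_simps power2_eq_square)
      qed
      have sgn: "0 < (1 - (\<eta> * s)\<^sup>2) * (real k / s) + \<eta>\<^sup>2 * s" if s: "0 < s" "s < y1" for s
      proof -
        have "(\<eta> * s)\<^sup>2 < 1" using mono[of s] s y1 \<eta> by (simp add: abs_square_less_1)
        then have "0 < (1 - (\<eta> * s)\<^sup>2) * (real k / s)" using s k_ge by simp
        moreover have "0 \<le> \<eta>\<^sup>2 * s" using s by simp
        ultimately show ?thesis by linarith
      qed
      \<comment> \<open>At the centre continuity comes from the linear bound on \<open>dU\<close>
        and its value 0; elsewhere from differentiability.\<close>
      have dUc: "continuous_on {0..y1} (dU \<eta>)"
        unfolding continuous_on_eq_continuous_within
      proof
        fix s assume s: "s \<in> {0..y1}"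
        show "continuous (at s within {0..y1}) (dU \<eta>)"
        proof (cases "s = 0")
          case True
          define C where "C = (c + p) / (1 - (\<eta> * y1)\<^sup>2)"
          have lt1: "(\<eta> * y1)\<^sup>2 < 1" using mono[of y1] y1 ey e \<eta> by (simp add: abs_square_less_1)
          have "(dU \<eta> \<longlongrightarrow> 0) (at 0 within {0..y1})"
          proof (rule Lim_null_comparison)
            show "\<forall>\<^sub>F x in at 0 within {0..y1}. norm (dU \<eta> x) \<le> x * C"
              unfolding eventually_at_filter
            proof (rule always_eventually, intro allI impI)
              fix x assume "x \<noteq> 0" and x: "x \<in> {0..y1}"
              have le: "(\<eta> * x)\<^sup>2 \<le> (\<eta> * y1)\<^sup>2" using x \<eta> by (intro power_mono mult_left_mono) auto
              have "\<bar>dU \<eta> x\<bar> \<le> x * (c + p) / (1 - (\<eta> * x)\<^sup>2)"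
                using dU_bound[of \<eta> x] \<eta> mono[of x] x y1 \<open>x \<noteq> 0\<close> by auto
              also have "\<dots> \<le> x * (c + p) / (1 - (\<eta> * y1)\<^sup>2)"
                using le lt1 x c_pos p_gt by (intro divide_left_mono mult_nonneg_nonneg mult_pos_pos) auto
              finally show "norm (dU \<eta> x) \<le> x * C" by (simp add: C_def)
            qed
            show "((\<lambda>x. x * C) \<longlongrightarrow> 0) (at 0 within {0..y1})" by (auto intro!: tendsto_eq_intros)
          qed
          then show ?thesis using True k_ge by (simp add: continuous_within dU_def)
        next
          case False
          have "isCont (dU \<eta>) s"
            by (rule DERIV_isCont[OF U_derivs(2)]) (use False s \<eta> mono y1 in auto)
          then show ?thesis by (rule continuous_at_imp_continuous_within)
        qed
      qed
      have Unn: "0 \<le> U (\<eta>, s)" if "s \<in> {0..y1}" for s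
        using that before[of s] U_0[OF \<eta>(1,2)] 2 by (cases "s = 0 \<or> s = y1") auto
      have Gc: "continuous_on {0..y1} G"
        unfolding G_def using p_gt Unn y1
        by (intro continuous_intros continuous_on_powr' dUc continuous_on_subset[OF cont]) auto
      have "G e < G 0"
      proof (rule DERIV_neg_imp_decreasing_open[OF e(1)])
        fix x assume x: "0 < x" "x < e"
        then have "(dU \<eta> x)\<^sup>2 > 0" using \<delta>(3)[of x] e by auto
        then have "- (dU \<eta> x)\<^sup>2 * ((1 - (\<eta> * x)\<^sup>2) * (real k / x) + \<eta>\<^sup>2 * x) < 0"
          using sgn[of x] x ey by (simp add: mult_neg_pos)
        then show "\<exists>l. (G has_real_derivative l) (at x) \<and> l < 0"
          using Gd[of x] x ey by (intro exI conjI) auto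
      next
        show "continuous_on {0..e} G" by (rule continuous_on_subset[OF Gc]) (use ey in auto)
      qed
      moreover have "G y1 \<le> G e"
      proof (rule DERIV_nonpos_imp_decreasing_open[where f = G and a = e and b = y1])
        fix x assume x: "e < x" "x < y1"
        have "- (dU \<eta> x)\<^sup>2 * ((1 - (\<eta> * x)\<^sup>2) * (real k / x) + \<eta>\<^sup>2 * x) \<le> 0"
          using sgn[of x] x e by (intro mult_nonpos_nonneg) auto
        then show "\<exists>l. (G has_real_derivative l) (at x) \<and> l \<le> 0"
          using Gd[of x] x e by (intro exI conjI) auto
      next
        show "continuous_on {e..y1} G" by (rule continuous_on_subset[OF Gc]) (use e in auto)
      qed (use ey in auto)
      moreover have "G 0 = 1 / (p + 1) - \<eta>\<^sup>2 * c / 2" using U_0 \<eta> k_ge by (simp add: G_def dU_def)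
      moreover have "G y1 \<ge> 1 / (p + 1) - \<eta>\<^sup>2 * c / 2"
      proof -
        have "(\<eta> * y1)\<^sup>2 < 1" using mono[of y1] y1 ey e \<eta> by (simp add: abs_square_less_1)
        then show ?thesis unfolding G_def 2 by simp
      qed
      ultimately show False by simp
    qed
  qed
qed

end

section \<open>Oscillation of the Lane--Emden limit\<close>

lemma ln_less_near_0:
  fixes M z' :: real assumes "z' > 0"
  obtains z where "0 < z" "z < z'" "ln z < M"
proof
  define z where "z = min (z' / 2) (exp (M - 1))"
  show "0 < z" "z < z'" using assms by (auto simp: z_def min_def)
  then have "ln z \<le> ln (exp (M - 1))" by (intro ln_mono) (auto simp: z_def)
  then show "ln z < M" by simp
qed

text \<open>
  A solution of \<open>s'' + q s / z\<^sup>2 = 0\<close> with \<open>q > 1 / 4\<close> oscillates: the function \<open>r = z s' / s\<close>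
  satisfies \<open>z r' = r - r\<^sup>2 - q\<close>, so \<open>arctan ((r - 1/2) / \<omega>) + \<omega> ln z\<close> decreases. Where \<open>s\<close> is not small only
  \<open>q \<ge> \<delta>\<close> is known; concavity then drives \<open>s\<close> to \<open>0\<close>.
\<close>
lemma no_positive_solution:
  fixes s ds q :: "real \<Rightarrow> real"
  assumes z1: "z1 > 0" and \<delta>: "\<delta> > 0" and \<omega>: "\<omega> > 0" and \<epsilon>: "\<epsilon> > 0"
    and s: "\<And>z. 0 < z \<Longrightarrow> z < z1 \<Longrightarrow> (s has_real_derivative ds z) (at z)"
    and ds: "\<And>z. 0 < z \<Longrightarrow> z < z1 \<Longrightarrow> (ds has_real_derivative - (q z * s z / z\<^sup>2)) (at z)"
    and pos: "\<And>z. 0 < z \<Longrightarrow> z < z1 \<Longrightarrow> s z > 0"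
    and q: "\<And>z. 0 < z \<Longrightarrow> z < z1 \<Longrightarrow> q z \<ge> \<delta>"
    and q': "\<And>z. 0 < z \<Longrightarrow> z < z1 \<Longrightarrow> s z < \<epsilon> \<Longrightarrow> q z \<ge> 1 / 4 + \<omega>\<^sup>2"
  shows False
proof -
  note mono = DERIV_nonneg_imp_nondecreasing and anti = DERIV_nonpos_imp_nonincreasing
  \<comment> \<open>If \<open>z * ds z - s z\<close> were some \<kappa> > 0, concavity would keep it
    at least \<kappa> all the way to 0. Then \<open>s y / y + \<kappa> / y\<close> would be
    nondecreasing, so \<open>s y \<le> B * y - \<kappa>\<close>, which is not positive for small
    \<open>y\<close>.\<close>
  have le: "z * ds z - s z \<le> 0" if z: "0 < z" "z < z1" for z
  proof (rule ccontr)
    define \<kappa> where "\<kappa> = z * ds z - s z"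
    assume "\<not> ?thesis"
    then have \<kappa>: "\<kappa> > 0" by (simp add: \<kappa>_def)
    have ge: "y * ds y - s y \<ge> \<kappa>" if y: "0 < y" "y \<le> z" for y
      unfolding \<kappa>_def
    proof (rule anti[where f = "\<lambda>y. y * ds y - s y", OF y(2)])
      fix x assume x: "y \<le> x" "x \<le> z"
      have "((\<lambda>y. y * ds y - s y) has_real_derivative x * - (q x * s x / x\<^sup>2)) (at x)"
        using x y z by (auto intro!: derivative_eq_intros s ds)
      moreover have "x * - (q x * s x / x\<^sup>2) \<le> 0"
        using x y z q[of x] pos[of x] \<delta> by (simp add: mult_nonneg_nonpos)
      ultimately show "\<exists>l. ((\<lambda>y. y * ds y - s y) has_real_derivative l) (at x) \<and> l \<le> 0" by blast
    qed
    have B_bound: "s y / y + \<kappa> / y \<le> s z / z + \<kappa> / z" if y: "0 < y" "y \<le> z" for y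
    proof (rule mono[where f = "\<lambda>y. s y / y + \<kappa> / y", OF y(2)])
      fix x assume x: "y \<le> x" "x \<le> z"
      have "((\<lambda>y. s y / y + \<kappa> / y) has_real_derivative (ds x * x - s x) / (x * x) + (- \<kappa>) / (x * x)) (at x)"
        using x y z by (auto intro!: derivative_eq_intros s)
      moreover have "(ds x * x - s x) / (x * x) + (- \<kappa>) / (x * x) \<ge> 0"
        using ge[of x] x y by (simp add: mult.commute[of "ds x"] divide_right_mono)
      ultimately show "\<exists>l. ((\<lambda>y. s y / y + \<kappa> / y) has_real_derivative l) (at x) \<and> 0 \<le> l" by blast
    qed
    define B where "B = s z / z + \<kappa> / z"
    have B: "B > 0" using pos[of z] z \<kappa> by (simp add: B_def add_pos_pos)
    define y where "y = min z (\<kappa> / B)"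
    have y: "0 < y" "y \<le> z" "y \<le> \<kappa> / B" using \<kappa> B z by (auto simp: y_def)
    have "s y / y + \<kappa> / y \<le> B" unfolding B_def using y by (intro B_bound)
    then have "s y + \<kappa> \<le> B * y" using y by (simp add: field_simps)
    moreover have "B * y \<le> \<kappa>" using y B by (simp add: field_simps)
    ultimately show False using pos[of y] y z by simp
  qed
  have ds_anti: "ds z \<le> ds y" if "0 < y" "y \<le> z" "z < z1" for y z
  proof (rule anti[where f = ds, OF that(2)])
    fix x assume x: "y \<le> x" "x \<le> z"
    have "- (q x * s x / x\<^sup>2) \<le> 0" using x that q[of x] pos[of x] \<delta> by simp
    then show "\<exists>l. (ds has_real_derivative l) (at x) \<and> l \<le> 0" using ds[of x] x that by auto
  qed
  define z' where "z' = z1 / 2"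
  have z': "0 < z'" "z' < z1" using z1 by (auto simp: z'_def)
  define m where "m = s z' / z'"
  have m: "m > 0" using pos z' by (simp add: m_def)
  \<comment> \<open>By the previous step \<open>s y / y\<close> is nonincreasing, so
    \<open>s\<close> lies above its chord from the origin.\<close>
  have lin: "s y \<ge> m * y" if y: "0 < y" "y \<le> z'" for y
  proof -
    have "s z' / z' \<le> s y / y"
    proof (rule anti[where f = "\<lambda>y. s y / y", OF y(2)])
      fix x assume x: "y \<le> x" "x \<le> z'"
      have "((\<lambda>y. s y / y) has_real_derivative (ds x * x - s x) / (x * x)) (at x)"
        using x y z' by (auto intro!: derivative_eq_intros s)
      moreover have "(ds x * x - s x) / (x * x) \<le> 0"
        using le[of x] x y z' by (simp add: mult.commute divide_nonpos_nonneg)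
      ultimately show "\<exists>l. ((\<lambda>y. s y / y) has_real_derivative l) (at x) \<and> l \<le> 0" by blast
    qed
    then show ?thesis using y by (simp add: m_def field_simps)
  qed
  \<comment> \<open>With the linear lower bound the second derivative is at most
    \<open>- \<delta> * m / x\<close>, so towards 0 the slope grows at least logarithmically and
    becomes positive.\<close>
  obtain z2 where z2: "0 < z2" "z2 < z'" "ds z2 > 0"
  proof -
    have ge: "ds z' + \<delta> * m * ln z' \<le> ds y + \<delta> * m * ln y" if y: "0 < y" "y \<le> z'" for y
    proof (rule anti[where f = "\<lambda>y. ds y + \<delta> * m * ln y", OF y(2)])
      fix x assume x: "y \<le> x" "x \<le> z'"
      have "((\<lambda>y. ds y + \<delta> * m * ln y) has_real_derivative - (q x * s x / x\<^sup>2) + \<delta> * m / x) (at x)"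
        using x y z' by (auto intro!: derivative_eq_intros ds)
      moreover have "\<delta> * (m * x) \<le> q x * s x"
        using x y z' q[of x] lin[of x] \<delta> m by (intro mult_mono) auto
      then have "- (q x * s x / x\<^sup>2) + \<delta> * m / x \<le> 0" using x y by (simp add: field_simps power2_eq_square)
      ultimately show "\<exists>l. ((\<lambda>y. ds y + \<delta> * m * ln y) has_real_derivative l) (at x) \<and> l \<le> 0" by blast
    qed
    obtain y where y: "0 < y" "y < z'" "ln y < (ds z' + \<delta> * m * ln z') / (\<delta> * m)"
      using ln_less_near_0[OF z'(1)] by blast
    have "\<delta> * m * ln y < ds z' + \<delta> * m * ln z'" using y(3) \<delta> m by (simp add: field_simps)
    with ge[of y] y have "ds y > 0" by simp
    with y show thesis by (intro that[of y]) auto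
  qed
  have ds_pos: "ds y > 0" if "0 < y" "y \<le> z2" for y using ds_anti[of y z2] that z2 z' by simp
  \<comment> \<open>If \<open>s\<close> stayed at least \<epsilon>, the second derivative would be
    at most \<open>- \<delta> * \<epsilon> / x^2\<close>. Integrating twice bounds
    \<open>s y\<close> by \<open>\<delta> * \<epsilon> * ln y\<close> plus bounded terms, which
    tends to minus infinity.\<close>
  obtain z3 where z3: "0 < z3" "z3 \<le> z2" "s z3 < \<epsilon>"
  proof (rule ccontr)
    assume "\<not> thesis"
    with that have big: "s y \<ge> \<epsilon>" if "0 < y" "y \<le> z2" for y using that not_le by metis
    define B where "B = \<delta> * \<epsilon> / z2 - ds z2"
    have ge: "- B \<le> ds y - \<delta> * \<epsilon> / y" if y: "0 < y" "y \<le> z2" for y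
    proof -
      have "ds z2 - \<delta> * \<epsilon> / z2 \<le> ds y - \<delta> * \<epsilon> / y"
      proof (rule anti[where f = "\<lambda>y. ds y - \<delta> * \<epsilon> / y", OF y(2)])
        fix x assume x: "y \<le> x" "x \<le> z2"
        have "((\<lambda>y. ds y - \<delta> * \<epsilon> / y) has_real_derivative - (q x * s x / x\<^sup>2) + \<delta> * \<epsilon> / x\<^sup>2) (at x)"
          using x y z2 z' by (auto intro!: derivative_eq_intros ds simp: power2_eq_square)
        moreover have "\<delta> * \<epsilon> \<le> q x * s x"
          using x y z2 z' q[of x] big[of x] \<delta> \<epsilon> by (intro mult_mono) auto
        then have "- (q x * s x / x\<^sup>2) + \<delta> * \<epsilon> / x\<^sup>2 \<le> 0"
          using x y by (simp add: divide_right_mono)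
        ultimately show "\<exists>l. ((\<lambda>y. ds y - \<delta> * \<epsilon> / y) has_real_derivative l) (at x) \<and> l \<le> 0" by blast
      qed
      then show ?thesis by (simp add: B_def)
    qed
    have up: "s y - \<delta> * \<epsilon> * ln y + B * y \<le> s z2 - \<delta> * \<epsilon> * ln z2 + B * z2" if y: "0 < y" "y \<le> z2" for y
    proof (rule mono[where f = "\<lambda>y. s y - \<delta> * \<epsilon> * ln y + B * y", OF y(2)])
      fix x assume x: "y \<le> x" "x \<le> z2"
      have "((\<lambda>y. s y - \<delta> * \<epsilon> * ln y + B * y) has_real_derivative ds x - \<delta> * \<epsilon> / x + B) (at x)"
        using x y z2 z' by (auto intro!: derivative_eq_intros s)
      moreover have "0 \<le> ds x - \<delta> * \<epsilon> / x + B" using ge[of x] x y by simp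
      ultimately show "\<exists>l. ((\<lambda>y. s y - \<delta> * \<epsilon> * ln y + B * y) has_real_derivative l) (at x) \<and> 0 \<le> l" by blast
    qed
    define D where "D = s z2 - \<delta> * \<epsilon> * ln z2 + B * z2 + \<bar>B\<bar> * z2"
    obtain y where y: "0 < y" "y < z2" "ln y < - D / (\<delta> * \<epsilon>)"
      using ln_less_near_0[OF z2(1)] by blast
    have "\<delta> * \<epsilon> * ln y < - D" using y(3) \<delta> \<epsilon> by (simp add: field_simps)
    moreover have "- (B * y) \<le> \<bar>B\<bar> * z2"
      using mult_right_mono[OF abs_ge_minus_self[of B], of y] mult_left_mono[of y z2 "\<bar>B\<bar>"] y by simp
    ultimately have "s y < 0" using up[of y] y unfolding D_def by linarith
    with pos[of y] y z2 z' show False by simp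
  qed
  have small: "s y < \<epsilon>" if y: "0 < y" "y \<le> z3" for y
  proof -
    have "s y \<le> s z3"
    proof (rule mono[where f = s, OF y(2)])
      fix x assume x: "y \<le> x" "x \<le> z3"
      then show "\<exists>l. (s has_real_derivative l) (at x) \<and> 0 \<le> l"
        using s[of x] ds_pos[of x] y z3 z2 z' by (intro exI[of _ "ds x"]) auto
    qed
    with z3 show ?thesis by simp
  qed
  define r where "r = (\<lambda>z. z * ds z / s z)"
  define g where "g = (\<lambda>z. arctan ((r z - 1 / 2) / \<omega>) + \<omega> * ln z)"
  have g: "g z3 \<le> g y" if y: "0 < y" "y \<le> z3" for y
  proof (rule anti[where f = g, OF y(2)])
    fix x assume x: "y \<le> x" "x \<le> z3"
    then have x': "0 < x" "x < z1" using y z3 z2 z' by auto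
    have sx: "s x > 0" using pos x' by simp
    have r': "(r has_real_derivative ((ds x + - (q x * s x / x\<^sup>2) * x) * s x - x * ds x * ds x) / (s x * s x)) (at x)"
      unfolding r_def using sx by (auto intro!: derivative_eq_intros s[OF x'] ds[OF x'])
    have "((ds x + - (q x * s x / x\<^sup>2) * x) * s x - x * ds x * ds x) / (s x * s x) = (r x - q x - (r x)\<^sup>2) / x"
      unfolding r_def using sx x' by (simp add: field_simps power2_eq_square)
    with r' have r': "(r has_real_derivative (r x - q x - (r x)\<^sup>2) / x) (at x)" by simp
    define h where "h = (r x - 1 / 2)\<^sup>2 + \<omega>\<^sup>2"
    have h: "h > 0" using \<omega> by (simp add: h_def add_nonneg_pos)
    have "(g has_real_derivative inverse (1 + ((r x - 1 / 2) / \<omega>)\<^sup>2) * ((r x - q x - (r x)\<^sup>2) / x / \<omega>) + \<omega> / x) (at x)"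
      unfolding g_def using x' \<omega> by (auto intro!: derivative_eq_intros r')
    moreover have "inverse (1 + ((r x - 1 / 2) / \<omega>)\<^sup>2) * ((r x - q x - (r x)\<^sup>2) / x / \<omega>) + \<omega> / x
      = \<omega> / x * ((r x - q x - (r x)\<^sup>2) / h + 1)"
    proof -
      have "1 + ((r x - 1 / 2) / \<omega>)\<^sup>2 = h / \<omega>\<^sup>2" using \<omega> by (simp add: h_def power_divide add_divide_distrib)
      moreover define A where "A = r x - q x - (r x)\<^sup>2"
      moreover have "inverse (h / \<omega>\<^sup>2) * (A / x / \<omega>) + \<omega> / x = \<omega> / x * (A / h + 1)"
        using \<omega> x' h by (simp add: field_simps power2_eq_square)
      ultimately show ?thesis by simp
    qed
    moreover have "r x - q x - (r x)\<^sup>2 \<le> - h"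
      using q'[of x] small[of x] x y x' by (simp add: h_def power2_eq_square algebra_simps)
    then have "(r x - q x - (r x)\<^sup>2) / h + 1 \<le> 0" using h by (simp add: field_simps)
    then have "\<omega> / x * ((r x - q x - (r x)\<^sup>2) / h + 1) \<le> 0" using \<omega> x' by (intro mult_nonneg_nonpos) auto
    ultimately show "\<exists>l. (g has_real_derivative l) (at x) \<and> l \<le> 0" by auto
  qed
  \<comment> \<open>Towards 0 the logarithm tends to minus infinity while \<open>g\<close> stays at
    least \<open>g z3\<close>, so the arctangent would have to exceed pi.\<close>
  obtain y where y: "0 < y" "y < z3" "ln y < (g z3 - pi) / \<omega>" using ln_less_near_0[OF z3(1)] by blast
  have "\<omega> * ln y < g z3 - pi" using y(3) \<omega> by (simp add: field_simps)
  with g[of y] y have "arctan ((r y - 1 / 2) / \<omega>) > pi" by (simp add: g_def)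
  moreover have "arctan ((r y - 1 / 2) / \<omega>) < pi" using arctan_ubound[of "(r y - 1 / 2) / \<omega>"] pi_gt_zero by linarith
  ultimately show False by simp
qed

context supercritical
begin

section \<open>Linearisation about the constant solution\<close>

text \<open>The divided difference of \<open>w powr p - c * w\<close> at \<open>b\<close>, completed
  by the derivative \<open>p * c - c\<close>. With \<open>q = secant v\<close> the difference
  \<open>v - b\<close> of two nonlinear solutions satisfies an exactly linear equation.\<close>

definition secant :: "real \<Rightarrow> real"
  where "secant w = (if w = b then (p - 1) * c else (w powr p - c * w) / (w - b))"

lemma secant_eq: "w powr p - c * w = secant w * (w - b)"
  using b_powr_p by (simp add: secant_def)

lemma isCont_secant: assumes "w > 0" shows "isCont secant w"
proof (cases "w = b")
  case True
  have "((\<lambda>w. w powr p - c * w) has_real_derivative p * b powr (p - 1) - c) (at b)"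
    using b_pos by (auto intro!: derivative_eq_intros)
  then have "((\<lambda>w. w powr p - c * w) has_real_derivative (p - 1) * c) (at b)"
    by (simp add: b_powr algebra_simps)
  then have "(\<lambda>w. ((w powr p - c * w) - (b powr p - c * b)) / (w - b)) \<midarrow>b\<rightarrow> (p - 1) * c"
    by (simp add: has_field_derivative_iff)
  then have "(\<lambda>w. (w powr p - c * w) / (w - b)) \<midarrow>b\<rightarrow> (p - 1) * c" by (simp add: b_powr_p)
  then have "secant \<midarrow>b\<rightarrow> (p - 1) * c"
    by (rule Lim_transform_eventually) (auto simp: eventually_at_filter secant_def)
  then show ?thesis by (simp add: True isCont_def secant_def)
next
  case False
  have "\<forall>\<^sub>F x in nhds w. x \<noteq> b" using False by (rule t1_space_nhds)
  then have ev: "\<forall>\<^sub>F x in nhds w. secant x = (x powr p - c * x) / (x - b)"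
    by (rule eventually_mono) (simp add: secant_def)
  show ?thesis
    unfolding isCont_cong[OF ev] using False assms by (intro continuous_intros) auto
qed

lemma secant_pos: assumes "w > 0" shows "secant w > 0"
proof -
  have eq: "w powr p - c * w = w * (w powr (p - 1) - c)"
    using assms powr_add[of w "p - 1" 1] by (simp add: algebra_simps)
  consider "w = b" | "w > b" | "w < b" by linarith
  then show ?thesis
  proof cases
    case 1
    then show ?thesis using p_gt c_pos by (simp add: secant_def)
  next
    case 2
    then have "w powr (p - 1) > c" using b_pos p_gt powr_less_mono2[of "p - 1" b w] b_powr by simp
    then show ?thesis using 2 assms by (simp add: secant_def eq)
  next
    case 3
    then have "w powr (p - 1) < c" using assms p_gt powr_less_mono2[of "p - 1" w b] b_powr by simp
    then have "w * (w powr (p - 1) - c) < 0" using assms by (intro mult_pos_neg) auto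
    then show ?thesis using 3 assms by (auto simp add: secant_def eq intro: divide_neg_neg)
  qed
qed

text \<open>The value is \<open>2 * (\<alpha> + 1)\<close>, smallest for
  \<open>\<alpha> = 1 / 2\<close>, that is in dimension 4. It is far above the oscillation threshold
  1/4.\<close>

lemma secant_b: "secant b \<ge> 3"
  using \<alpha>_ge \<alpha>_pos by (simp add: secant_def p_def c_def)

lemma v_pos:
  assumes "0 \<le> \<eta>" "\<eta> \<le> 1" "\<eta>\<^sup>2 * c < 1" "\<eta> < z" "0 < z" shows "v \<eta> z > 0"
  using U_bounds[of \<eta> "1 / z"] assms by (simp add: v_def)

lemma U_bounds_inv:
  assumes "0 \<le> \<eta>" "\<eta> \<le> 1" "\<eta>\<^sup>2 * c < 1" "\<eta> < z"
  shows "0 < U (\<eta>, 1 / z) \<and> U (\<eta>, 1 / z) \<le> 1"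
  using U_bounds[of \<eta> "1 / z"] assms by auto

lemma v_derivs:
  assumes "0 \<le> \<eta>" "\<eta> \<le> 1" "\<eta>\<^sup>2 * c < 1" "\<eta> < z"
  shows "(v \<eta> has_real_derivative dv \<eta> z) (at z)"
    "(dv \<eta> has_real_derivative (c * v \<eta> z - v \<eta> z powr p) / (z\<^sup>2 - \<eta>\<^sup>2)) (at z)"
    "(energy \<eta> has_real_derivative z * (dv \<eta> z)\<^sup>2) (at z)"
    "energy \<eta> z < 0"
  using v_deriv[of \<eta> z] dv_deriv[of \<eta> z] energy_deriv[of \<eta> z] U_bounds_inv[OF assms] assms
    energy_neg[of \<eta> \<eta> z, OF _ _ _ _ U_bounds_inv]
  by auto

text \<open>The positive zero of the potential \<open>F\<close>: negative energy confines
  \<open>v\<close> to the interval between 0 and this value.\<close>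

definition v_max where "v_max = (c * (p + 1) / 2) powr (\<alpha> / 2)"

lemma F_neg_bound: assumes "w > 0" "F w < 0" shows "w \<le> v_max"
proof -
  have "w powr (p + 1) = w powr (p - 1) * w\<^sup>2"
    using assms powr_add[of w "p - 1" 2] by (simp add: powr_numeral add.commute)
  then have "w\<^sup>2 * (w powr (p - 1) / (p + 1) - c / 2) < 0"
    using assms by (simp add: F_def algebra_simps)
  then have "w powr (p - 1) / (p + 1) < c / 2" using assms by (simp add: mult_less_0_iff)
  then have "w powr (p - 1) \<le> c * (p + 1) / 2" using p_gt by (simp add: field_simps)
  then have "(w powr (p - 1)) powr (\<alpha> / 2) \<le> v_max"
    unfolding v_max_def using \<alpha>_pos by (intro powr_mono2) auto
  moreover have "(p - 1) * (\<alpha> / 2) = 1" using \<alpha>_pos by (simp add: p_def)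
  ultimately show ?thesis using assms by (simp add: powr_powr)
qed

lemma F_v_le_energy: "\<bar>\<eta>\<bar> \<le> z \<Longrightarrow> F (v \<eta> z) \<le> energy \<eta> z"
  using power_mono[of "\<bar>\<eta>\<bar>" z 2] by (simp add: energy_def)

lemma v_bounds:
  assumes "0 \<le> \<eta>" "\<eta> \<le> 1" "\<eta>\<^sup>2 * c < 1" "\<eta> < z"
  shows "0 < v \<eta> z" "v \<eta> z \<le> v_max"
proof -
  show 1: "0 < v \<eta> z" using v_pos assms by simp
  show "v \<eta> z \<le> v_max"
    using F_neg_bound[OF 1] F_v_le_energy[of \<eta> z] v_derivs(4)[OF assms] assms by simp
qed

section \<open>Zeros of the Lane-Emden solution and their persistence\<close>

text \<open>Gronwall's inequality for the linear equation of \<open>v 0 - b\<close>: a double zero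
  at \<open>z0\<close> would force \<open>v 0 = b\<close> for all larger \<open>z\<close>, whereas
  \<open>v 0\<close> tends to 0 at the centre.\<close>

lemma lane_emden_not_constant:
  assumes z0: "z0 > 0" and v: "v 0 z0 = b" and dv: "dv 0 z0 = 0" shows False
proof -
  have "\<forall>\<^sub>F z in at_top. v 0 z < b"
    using tendsto_v_infinity(1)[of 0] b_pos by (intro order_tendstoD) auto
  then obtain Z where Z: "Z > z0" "v 0 Z < b"
    using eventually_conj[OF _ eventually_gt_at_top[of z0]] eventually_happens'[OF trivial_limit_at_top_linorder] by fastforce
  have d: "(v 0 has_real_derivative dv 0 z) (at z)"
    "(dv 0 has_real_derivative - (secant (v 0 z) * (v 0 z - b) / z\<^sup>2)) (at z)" "v 0 z > 0" if "z > 0" for z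
    using v_derivs(1,2)[of 0 z] v_pos[of 0 z] that
    by (simp_all add: secant_eq[symmetric] minus_divide_left del: minus_divide_left[symmetric])
  have "isCont (\<lambda>z. \<bar>1 - secant (v 0 z) / z\<^sup>2\<bar>) z" if "z > 0" for z
    using that isCont_o2[OF DERIV_isCont[OF d(1)[OF that]] isCont_secant[OF d(3)[OF that]]]
    by (intro continuous_intros) auto
  then have "\<exists>M. \<forall>z. z0 \<le> z \<and> z \<le> Z \<longrightarrow> \<bar>1 - secant (v 0 z) / z\<^sup>2\<bar> \<le> M"
    using z0 Z by (intro isCont_bounded) auto
  then obtain M where M: "\<And>z. z0 \<le> z \<Longrightarrow> z \<le> Z \<Longrightarrow> \<bar>1 - secant (v 0 z) / z\<^sup>2\<bar> \<le> M" by blast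
  \<comment> \<open>Its derivative is \<open>1 - secant (v 0 z) / z^2\<close> times the mixed
    product \<open>2 * (v 0 z - b) * dv 0 z\<close>, and that product is at most \<open>W\<close> in
    absolute value.\<close>
  define W where "W = (\<lambda>z. (v 0 z - b)\<^sup>2 + (dv 0 z)\<^sup>2)"
  have "W Z * exp (- (M * Z)) \<le> W z0 * exp (- (M * z0))"
  proof (rule DERIV_nonpos_imp_nonincreasing[where f = "\<lambda>z. W z * exp (- (M * z))"])
    fix z assume z: "z0 \<le> z" "z \<le> Z"
    then have zp: "z > 0" using z0 by simp
    define k where "k = 1 - secant (v 0 z) / z\<^sup>2"
    have "(W has_real_derivative 2 * (v 0 z - b) * dv 0 z + 2 * dv 0 z * - (secant (v 0 z) * (v 0 z - b) / z\<^sup>2)) (at z)"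
      unfolding W_def
      by (rule DERIV_cong, (rule derivative_intros d zp)+) (simp add: mult_ac)
    also have "2 * (v 0 z - b) * dv 0 z + 2 * dv 0 z * - (secant (v 0 z) * (v 0 z - b) / z\<^sup>2)
      = k * (2 * (v 0 z - b) * dv 0 z)" by (simp add: k_def algebra_simps diff_divide_distrib)
    finally have W: "(W has_real_derivative k * (2 * (v 0 z - b) * dv 0 z)) (at z)" .
    have "((\<lambda>z. W z * exp (- (M * z))) has_real_derivative
       k * (2 * (v 0 z - b) * dv 0 z) * exp (- (M * z)) + - M * exp (- (M * z)) * W z) (at z)"
      by (auto intro!: derivative_eq_intros W)
    moreover have "k * (2 * (v 0 z - b) * dv 0 z) \<le> M * W z"
    proof -
      have "\<bar>2 * (v 0 z - b) * dv 0 z\<bar> \<le> W z"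
        using sum_squares_bound[of "\<bar>v 0 z - b\<bar>" "\<bar>dv 0 z\<bar>"] by (simp only: W_def abs_mult abs_numeral power2_abs)
      then have "\<bar>k\<bar> * \<bar>2 * (v 0 z - b) * dv 0 z\<bar> \<le> M * W z"
        using M[OF z] by (intro mult_mono) (auto simp: k_def)
      then show ?thesis by (metis abs_ge_self abs_mult order_trans)
    qed
    then have "(k * (2 * (v 0 z - b) * dv 0 z) - M * W z) * exp (- (M * z)) \<le> 0"
      by (intro mult_nonpos_nonneg) auto
    then have "k * (2 * (v 0 z - b) * dv 0 z) * exp (- (M * z)) + - M * exp (- (M * z)) * W z \<le> 0"
      by (simp add: algebra_simps)
    ultimately show "\<exists>l. ((\<lambda>z. W z * exp (- (M * z))) has_real_derivative l) (at z) \<and> l \<le> 0" by blast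
  qed (use Z in simp)
  then have "W Z \<le> 0" using v dv by (simp add: W_def mult_le_0_iff)
  moreover have "W Z > 0" using Z by (simp add: W_def add_pos_nonneg)
  ultimately show False by simp
qed

text \<open>If \<open>v 0\<close> stayed on one side of \<open>b\<close> near 0, any contact with
  \<open>b\<close> would be tangential, hence a double zero. So
  \<open>\<sigma> * (v 0 z - b)\<close> would be a positive solution of the linear equation, which
  oscillates because \<open>secant v\<close> is bounded below by a positive constant and exceeds the
  threshold near \<open>b\<close>.\<close>

lemma lane_emden_oscillates:
  assumes z1: "z1 > 0" and \<sigma>: "\<sigma> = 1 \<or> \<sigma> = - 1"
  shows "\<exists>z. 0 < z \<and> z < z1 \<and> \<sigma> * (v 0 z - b) < 0"
proof (rule ccontr)
  assume "\<not> ?thesis"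
  then have nonneg: "\<sigma> * (v 0 z - b) \<ge> 0" if "0 < z" "z < z1" for z using that by force
  have d: "(v 0 has_real_derivative dv 0 z) (at z)"
    "(dv 0 has_real_derivative - (secant (v 0 z) * (v 0 z - b) / z\<^sup>2)) (at z)" if "z > 0" for z
    using v_derivs(1,2)[of 0 z] that
    by (simp_all add: secant_eq[symmetric] minus_divide_left del: minus_divide_left[symmetric])
  have pos: "\<sigma> * (v 0 z - b) > 0" if z: "0 < z" "z < z1" for z
  proof (rule ccontr)
    assume "\<not> ?thesis"
    with nonneg[OF z] have 0: "\<sigma> * (v 0 z - b) = 0" by simp
    then have vb: "v 0 z = b" using \<sigma> by auto
    have "((\<lambda>z. \<sigma> * (v 0 z - b)) has_real_derivative \<sigma> * dv 0 z) (at z)"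
      using z by (auto intro!: derivative_eq_intros d)
    then have "\<sigma> * dv 0 z = 0"
    proof (rule DERIV_local_min)
      show "0 < min z (z1 - z)" using z by simp
      show "\<forall>y. \<bar>z - y\<bar> < min z (z1 - z) \<longrightarrow> \<sigma> * (v 0 z - b) \<le> \<sigma> * (v 0 y - b)"
        unfolding 0 by (auto intro!: nonneg)
    qed
    then show False using lane_emden_not_constant[OF z(1) vb] \<sigma> by auto
  qed
  define e where "e = - energy 0 (z1 / 2)"
  have e: "e > 0" using v_derivs(4)[of 0 "z1 / 2"] z1 by (simp add: e_def)
  \<comment> \<open>Near 0 the energy is at most \<open>- e\<close>. Its kinetic part and the power
    in \<open>F\<close> are nonnegative, so \<open>c * v^2 / 2\<close> is at least \<open>e\<close>;
    this keeps \<open>v\<close> in a compact interval on which \<open>secant\<close> has a positive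
    minimum.\<close>
  define m where "m = sqrt (2 * e / c)"
  have m: "m > 0" using e c_pos by (simp add: m_def)
  have vm: "m \<le> v 0 z" "v 0 z \<le> v_max" if z: "0 < z" "z < z1 / 2" for z
  proof -
    show "v 0 z \<le> v_max" using v_bounds[of 0 z] z by simp
    have "F (v 0 z) \<le> energy 0 z" using F_v_le_energy[of 0 z] z by simp
    also have "\<dots> \<le> energy 0 (z1 / 2)"
      by (rule energy_mono[where ?z0.0 = 0]) (use U_bounds_inv[of 0] z in auto)
    finally have "F (v 0 z) \<le> - e" by (simp add: e_def)
    moreover have "0 \<le> v 0 z powr (p + 1) / (p + 1)" using p_gt by (intro divide_nonneg_pos) auto
    ultimately have "e \<le> c * (v 0 z)\<^sup>2 / 2" unfolding F_def by linarith
    then have "2 * e / c \<le> (v 0 z)\<^sup>2" using c_pos by (simp add: field_simps)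
    then show "m \<le> v 0 z" unfolding m_def using v_bounds[of 0 z] z
      by (intro real_le_lsqrt) auto
  qed
  have "m \<le> v_max" using vm[of "z1 / 4"] z1 by simp
  moreover have "continuous_on {m..v_max} secant"
    using isCont_secant m by (intro continuous_at_imp_continuous_on) auto
  ultimately obtain w where w: "w \<in> {m..v_max}" "\<And>x. x \<in> {m..v_max} \<Longrightarrow> secant w \<le> secant x"
    using continuous_attains_inf[of "{m..v_max}" secant] by (metis atLeastatMost_empty_iff2 compact_Icc not_le)
  \<comment> \<open>The bound 1 leaves ample room: with \<open>\<omega> = 1 / 2\<close> the required
    value is 1/4 + 1/4.\<close>
  have "\<forall>\<^sub>F x in at b. secant x > 1"
    using isCont_secant[OF b_pos] secant_b by (intro order_tendstoD(1)) (auto simp: isCont_def)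
  then obtain \<epsilon> where \<epsilon>: "\<epsilon> > 0" "\<And>x. \<bar>x - b\<bar> < \<epsilon> \<Longrightarrow> secant x > 1"
    using secant_b unfolding eventually_at by (force simp: dist_real_def)
  show False
  proof (rule no_positive_solution[where s = "\<lambda>z. \<sigma> * (v 0 z - b)" and ds = "\<lambda>z. \<sigma> * dv 0 z" and q = "\<lambda>z. secant (v 0 z)"
        and ?z1.0 = "z1 / 2" and \<delta> = "secant w" and \<omega> = "1 / 2" and \<epsilon> = \<epsilon>])
    fix z assume z: "0 < z" "z < z1 / 2"
    show "((\<lambda>z. \<sigma> * (v 0 z - b)) has_real_derivative \<sigma> * dv 0 z) (at z)"
      using z by (auto intro!: derivative_eq_intros d)
    show "((\<lambda>z. \<sigma> * dv 0 z) has_real_derivative - (secant (v 0 z) * (\<sigma> * (v 0 z - b)) / z\<^sup>2)) (at z)"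
      using DERIV_cmult[OF d(2)[OF z(1)], of \<sigma>] by (simp add: mult_ac)
    show "\<sigma> * (v 0 z - b) > 0" using pos z by simp
    show "secant w \<le> secant (v 0 z)" using w vm z by auto
    assume "\<sigma> * (v 0 z - b) < \<epsilon>"
    with pos[of z] z \<sigma> have "\<bar>v 0 z - b\<bar> < \<epsilon>" by auto
    from \<epsilon>(2)[OF this] show "1 / 4 + (1 / 2)\<^sup>2 \<le> secant (v 0 z)" by (simp add: power2_eq_square)
  qed (use z1 \<epsilon> secant_pos[of w] w m in auto)
qed

lemma lane_emden_alternates:
  obtains z :: "nat \<Rightarrow> real"
  where "\<And>i. 0 < z i" "\<And>i. z (Suc i) < z i" "\<And>i. (- 1) ^ i * (v 0 (z i) - b) < 0"
proof -
  have "\<exists>z. \<forall>i. (0 < z i \<and> (- 1) ^ i * (v 0 (z i) - b) < 0) \<and> z (Suc i) < z i"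
  proof (rule dependent_nat_choice)
    show "\<exists>x. 0 < x \<and> (- 1) ^ 0 * (v 0 x - b) < 0"
      using lane_emden_oscillates[of 1 1] by auto
  next
    fix x :: real and n
    assume x: "0 < x \<and> (- 1) ^ n * (v 0 x - b) < 0"
    show "\<exists>y. (0 < y \<and> (- 1) ^ Suc n * (v 0 y - b) < 0) \<and> y < x"
      using lane_emden_oscillates[of x "(- 1) ^ Suc n"] x by (auto simp: power_minus1_odd minus_one_power_iff)
  qed
  then show thesis using that by blast
qed

text \<open>The strict signs of \<open>v 0 - b\<close> at the \<open>n + 1\<close> sample points
  \<open>z 0, ..., z n\<close> persist for small \<eta> by continuity of \<open>U\<close> at \<eta>
  = 0, and the intermediate value theorem puts one crossing into each of the \<open>n\<close>
  gaps.\<close>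

lemma many_crossings:
  "\<exists>\<eta>0>0. \<forall>\<eta>. 0 < \<eta> \<and> \<eta> < \<eta>0 \<longrightarrow> (\<exists>Z \<subseteq> {z. \<eta> < z \<and> v \<eta> z = b}. finite Z \<and> card Z = n)"
proof -
  obtain z :: "nat \<Rightarrow> real" where z: "\<And>i. 0 < z i" "\<And>i. z (Suc i) < z i"
    "\<And>i. (- 1) ^ i * (v 0 (z i) - b) < 0"
    using lane_emden_alternates by blast
  have anti: "decseq z" by (intro decseq_SucI less_imp_le z)
  have nice: "\<forall>\<^sub>F \<eta> in at_right 0. 0 < \<eta> \<and> \<eta> \<le> 1 \<and> \<eta>\<^sup>2 * c < 1"
  proof -
    have "((\<lambda>\<eta>. \<eta>\<^sup>2 * c) \<longlongrightarrow> 0\<^sup>2 * c) (at_right 0)" by (intro tendsto_intros)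
    then have "\<forall>\<^sub>F \<eta> in at_right 0. \<eta>\<^sup>2 * c < 1" by (rule order_tendstoD) simp
    moreover have "\<forall>\<^sub>F \<eta> in at_right (0::real). 0 < \<eta> \<and> \<eta> \<le> 1"
      by (auto simp: eventually_at_right_field intro!: exI[of _ 1])
    ultimately show ?thesis by eventually_elim auto
  qed
  have ev: "\<forall>\<^sub>F \<eta> in at_right 0. (- 1) ^ i * (v \<eta> (z i) - b) < 0 \<and> \<eta> < z i" for i
  proof -
    have zi: "\<forall>\<^sub>F \<eta> in at_right 0. \<eta> < z i"
      using z(1)[of i] by (auto simp: eventually_at_right_field)
    have "((\<lambda>\<eta>. U (\<eta>, 1 / z i)) \<longlongrightarrow> U (0, 1 / z i)) (at_right 0)"
    proof (rule continuous_on_tendsto_compose[OF continuous_on_U])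
      show "((\<lambda>\<eta>. (\<eta>, 1 / z i)) \<longlongrightarrow> (0, 1 / z i)) (at_right 0)" by (intro tendsto_intros)
      show "(0, 1 / z i) \<in> X" using z(1)[of i] by (simp add: X_def less_imp_le)
      show "\<forall>\<^sub>F \<eta> in at_right 0. (\<eta>, 1 / z i) \<in> X"
        using nice zi by eventually_elim (use z(1)[of i] in \<open>auto simp: X_def less_imp_le\<close>)
    qed
    then have "((\<lambda>\<eta>. (- 1) ^ i * (v \<eta> (z i) - b)) \<longlongrightarrow> (- 1) ^ i * (v 0 (z i) - b)) (at_right 0)"
      unfolding v_def by (intro tendsto_intros)
    from order_tendstoD(2)[OF this z(3)] zi show ?thesis by eventually_elim auto
  qed
  have "\<forall>\<^sub>F \<eta> in at_right 0. (0 < \<eta> \<and> \<eta> \<le> 1 \<and> \<eta>\<^sup>2 * c < 1) \<and> (\<forall>i\<in>{..n}. (- 1) ^ i * (v \<eta> (z i) - b) < 0 \<and> \<eta> < z i)"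
    by (intro eventually_conj nice eventually_ball_finite ballI ev) auto
  then obtain \<eta>0 where \<eta>0: "\<eta>0 > 0" and all: "\<And>\<eta>. 0 < \<eta> \<Longrightarrow> \<eta> < \<eta>0 \<Longrightarrow>
     (0 < \<eta> \<and> \<eta> \<le> 1 \<and> \<eta>\<^sup>2 * c < 1) \<and> (\<forall>i\<in>{..n}. (- 1) ^ i * (v \<eta> (z i) - b) < 0 \<and> \<eta> < z i)"
    unfolding eventually_at_right_field by blast
  have "\<exists>Z \<subseteq> {z. \<eta> < z \<and> v \<eta> z = b}. finite Z \<and> card Z = n" if \<eta>: "0 < \<eta>" "\<eta> < \<eta>0" for \<eta>
  proof -
    note h = all[OF \<eta>]
    have "\<exists>x. z (Suc i) < x \<and> x < z i \<and> v \<eta> x = b" if i: "i < n" for i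
    proof -
      have s: "(- 1) ^ i * (v \<eta> (z i) - b) < 0" "(- 1) ^ i * (v \<eta> (z (Suc i)) - b) > 0" "\<eta> < z (Suc i)"
        using h i by (auto dest: bspec[of _ _ i] bspec[of _ _ "Suc i"])
      have "isCont (\<lambda>x. (- 1) ^ i * (v \<eta> x - b)) x" if "z (Suc i) \<le> x" "x \<le> z i" for x
        using v_derivs(1)[of \<eta> x] h that s by (intro continuous_intros DERIV_isCont) auto
      then obtain x where x: "z (Suc i) \<le> x" "x \<le> z i" "(- 1) ^ i * (v \<eta> x - b) = 0"
        using IVT2[of "\<lambda>x. (- 1) ^ i * (v \<eta> x - b)" "z i" 0 "z (Suc i)"] s z(2)[of i] by auto
      then have "x \<noteq> z i" "x \<noteq> z (Suc i)" using s by auto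
      with x show ?thesis by (intro exI[of _ x]) auto
    qed
    then obtain x where x: "\<And>i. i < n \<Longrightarrow> z (Suc i) < x i \<and> x i < z i \<and> v \<eta> (x i) = b" by metis
    have "x i > x j" if "i < j" "j < n" for i j
    proof -
      have "z j \<le> z (Suc i)" using that by (intro decseqD[OF anti]) auto
      then show ?thesis using x[of i] x[of j] that by auto
    qed
    then have "inj_on x {..<n}" by (intro inj_onI) (metis lessThan_iff less_irrefl nat_neq_iff)
    then have "card (x ` {..<n}) = n" by (simp add: card_image)
    moreover have "x ` {..<n} \<subseteq> {z. \<eta> < z \<and> v \<eta> z = b}"
    proof clarify
      fix i assume "i < n"
      then have "\<eta> < z (Suc i)" using h by (auto dest: bspec[of _ _ "Suc i"])
      then show "\<eta> < x i \<and> v \<eta> (x i) = b" using x[OF \<open>i < n\<close>] by simp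
    qed
    ultimately show ?thesis by (intro exI[of _ "x ` {..<n}"]) auto
  qed
  with \<eta>0 show ?thesis by blast
qed

end

section \<open>Shooting\<close>

text \<open>Points at distance at least \<delta> have different values of
  \<open>\<lfloor>x / \<delta>\<rfloor>\<close>, and only finitely many integers occur on
  [0, 1].\<close>

lemma finite_separated:
  fixes Z :: "real set"
  assumes "\<delta> > 0" and Z: "Z \<subseteq> {0..1}" and sep: "\<And>x y. x \<in> Z \<Longrightarrow> y \<in> Z \<Longrightarrow> x < y \<Longrightarrow> \<delta> \<le> y - x"
  shows "finite Z"
proof (rule finite_imageD)
  have "\<lfloor>x / \<delta>\<rfloor> < \<lfloor>y / \<delta>\<rfloor>" if "x \<in> Z" "y \<in> Z" "x < y" for x y
  proof -
    have "(x + \<delta>) / \<delta> \<le> y / \<delta>" using sep[OF that] \<open>\<delta> > 0\<close> by (intro divide_right_mono) auto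
    then have "x / \<delta> + 1 \<le> y / \<delta>" using \<open>\<delta> > 0\<close> by (simp add: add_divide_distrib)
    then show ?thesis by linarith
  qed
  then show "inj_on (\<lambda>x. \<lfloor>x / \<delta>\<rfloor>) Z" by (intro inj_onI) (metis less_irrefl linorder_neqE)
  have "(\<lambda>x. \<lfloor>x / \<delta>\<rfloor>) ` Z \<subseteq> {0..\<lfloor>1 / \<delta>\<rfloor>}"
  proof
    fix i assume "i \<in> (\<lambda>x. \<lfloor>x / \<delta>\<rfloor>) ` Z"
    then obtain x where x: "x \<in> Z" "i = \<lfloor>x / \<delta>\<rfloor>" by blast
    then have "0 \<le> x / \<delta>" "x / \<delta> \<le> 1 / \<delta>" using Z \<open>\<delta> > 0\<close> by (auto intro!: divide_right_mono)
    then show "i \<in> {0..\<lfloor>1 / \<delta>\<rfloor>}" using x(2) by (auto intro!: floor_mono)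
  qed
  then show "finite ((\<lambda>x. \<lfloor>x / \<delta>\<rfloor>) ` Z)" by (rule finite_subset) simp
qed

text \<open>The count is locally constant on a connected interval. Sign changes survive small
  perturbations, so no zero is lost; away from the old zeros the function is bounded below, so none
  appears; uniform separation makes the matching of old and new zeros one to one.\<close>

lemma card_zeros_constant:
  fixes \<phi> :: "real \<Rightarrow> real \<Rightarrow> real"
  assumes ab: "\<eta>1 \<in> {a..b}" "\<eta>2 \<in> {a..b}" and \<delta>: "\<delta> > 0"
    and cont: "continuous_on ({a..b} \<times> {0..1}) (\<lambda>(\<eta>, x). \<phi> \<eta> x)"
    and sep: "\<And>\<eta> x y. \<lbrakk>\<eta> \<in> {a..b}; 0 \<le> x; x < y; y \<le> 1; \<phi> \<eta> x = 0; \<phi> \<eta> y = 0\<rbrakk> \<Longrightarrow> \<delta> \<le> y - x"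
    and cross: "\<And>\<eta> x e. \<lbrakk>\<eta> \<in> {a..b}; 0 \<le> x; x \<le> 1; \<phi> \<eta> x = 0; e > 0\<rbrakk> \<Longrightarrow>
       \<exists>x1 x2. 0 \<le> x1 \<and> x - e < x1 \<and> x1 < x2 \<and> x2 < x + e \<and> x2 \<le> 1 \<and> \<phi> \<eta> x1 * \<phi> \<eta> x2 < 0"
  defines "Z \<equiv> \<lambda>\<eta>. {x \<in> {0..1}. \<phi> \<eta> x = 0}"
  shows "card (Z \<eta>1) = card (Z \<eta>2)"
proof (rule connected_local_const[where f = "\<lambda>\<eta>. card (Z \<eta>)" and A = "{a..b}"])
  have finZ: "finite (Z \<eta>)" if "\<eta> \<in> {a..b}" for \<eta>
    by (rule finite_separated[OF \<delta>]) (use sep that in \<open>auto simp: Z_def\<close>)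
  have uc: "uniformly_continuous_on ({a..b} \<times> {0..1}) (\<lambda>(\<eta>, x). \<phi> \<eta> x)"
    by (intro compact_uniformly_continuous cont compact_Times) auto
  have near: "\<exists>s>0. \<forall>\<eta>'\<in>{a..b}. \<bar>\<eta>' - \<eta>\<bar> < s \<longrightarrow> (\<forall>x\<in>{0..1}. \<bar>\<phi> \<eta>' x - \<phi> \<eta> x\<bar> < m)" if "\<eta> \<in> {a..b}" "m > 0" for \<eta> m
  proof -
    obtain s where s: "s > 0" "\<And>u u'. \<lbrakk>u \<in> {a..b} \<times> {0..1}; u' \<in> {a..b} \<times> {0..1}; dist u' u < s\<rbrakk> \<Longrightarrow>
       dist ((\<lambda>(\<eta>, x). \<phi> \<eta> x) u') ((\<lambda>(\<eta>, x). \<phi> \<eta> x) u) < m"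
      using uc \<open>m > 0\<close> unfolding uniformly_continuous_on_def by metis
    have "\<bar>\<phi> \<eta>' x - \<phi> \<eta> x\<bar> < m" if "\<eta>' \<in> {a..b}" "\<bar>\<eta>' - \<eta>\<bar> < s" "x \<in> {0..1}" for \<eta>' x
      using s(2)[of "(\<eta>, x)" "(\<eta>', x)"] that \<open>\<eta> \<in> {a..b}\<close> by (simp add: dist_Pair_Pair dist_real_def)
    with s(1) show ?thesis by blast
  qed
  have slice: "continuous_on {0..1} (\<phi> \<eta>)" if "\<eta> \<in> {a..b}" for \<eta>
  proof -
    have "continuous_on {0..1} (\<lambda>x. (\<lambda>(\<eta>, x). \<phi> \<eta> x) (\<eta>, x))"
      by (rule continuous_on_compose2[OF cont]) (use that in \<open>auto intro!: continuous_intros\<close>)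
    then show ?thesis by simp
  qed
  show "\<forall>\<eta>\<in>{a..b}. \<forall>\<^sub>F \<eta>' in at \<eta> within {a..b}. card (Z \<eta>) = card (Z \<eta>')"
  proof
    fix \<eta> assume \<eta>: "\<eta> \<in> {a..b}"
    \<comment> \<open>A third of the separation: two zeros for the same parameter that are both
      within \<open>e\<close> of one point are less than \<open>2 * e < \<delta>\<close> apart,
      hence equal.\<close>
    define e where "e = \<delta> / 3"
    have e: "e > 0" using \<delta> by (simp add: e_def)
    have lower: "\<forall>\<^sub>F \<eta>' in at \<eta> within {a..b}. \<exists>z\<in>Z \<eta>'. \<bar>z - x\<bar> < e" if x: "x \<in> Z \<eta>" for x
    proof -
      obtain x1 x2 where xx: "0 \<le> x1" "x - e < x1" "x1 < x2" "x2 < x + e" "x2 \<le> 1" "\<phi> \<eta> x1 * \<phi> \<eta> x2 < 0"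
        using cross[OF \<eta> _ _ _ e, of x] x by (auto simp: Z_def)
      define m where "m = min \<bar>\<phi> \<eta> x1\<bar> \<bar>\<phi> \<eta> x2\<bar>"
      have m: "m > 0" using xx(6) by (auto simp: m_def)
      obtain s where s: "s > 0" "\<And>\<eta>' x. \<eta>'\<in>{a..b} \<Longrightarrow> \<bar>\<eta>' - \<eta>\<bar> < s \<Longrightarrow> x\<in>{0..1} \<Longrightarrow> \<bar>\<phi> \<eta>' x - \<phi> \<eta> x\<bar> < m"
        using near[OF \<eta> m] by blast
      have "\<exists>z\<in>Z \<eta>'. \<bar>z - x\<bar> < e" if \<eta>': "\<eta>' \<in> {a..b}" "\<bar>\<eta>' - \<eta>\<bar> < s" for \<eta>'
      proof -
        have c: "continuous_on {x1..x2} (\<phi> \<eta>')"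
          by (rule continuous_on_subset[OF slice[OF \<eta>'(1)]]) (use xx in auto)
        have n: "\<bar>\<phi> \<eta>' x1 - \<phi> \<eta> x1\<bar> < m" "\<bar>\<phi> \<eta>' x2 - \<phi> \<eta> x2\<bar> < m" using s(2)[OF \<eta>'] xx by auto
        have "\<exists>z. x1 \<le> z \<and> z \<le> x2 \<and> \<phi> \<eta>' z = 0"
        proof (cases "\<phi> \<eta> x1 < 0")
          case True
          then have "\<phi> \<eta> x2 > 0" using xx(6) by (auto simp: mult_less_0_iff)
          with True n have "\<phi> \<eta>' x1 \<le> 0" "0 \<le> \<phi> \<eta>' x2" by (auto simp: m_def)
          then show ?thesis using IVT'[of "\<phi> \<eta>'" x1 0 x2] c xx by auto
        next
          case False
          then have "\<phi> \<eta> x1 > 0" "\<phi> \<eta> x2 < 0" using xx(6) by (auto simp: mult_less_0_iff)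
          with n have "0 \<le> \<phi> \<eta>' x1" "\<phi> \<eta>' x2 \<le> 0" by (auto simp: m_def)
          then show ?thesis using IVT2'[of "\<phi> \<eta>'" x2 0 x1] c xx by auto
        qed
        then obtain z where "x1 \<le> z" "z \<le> x2" "\<phi> \<eta>' z = 0" by blast
        then show ?thesis using xx by (intro bexI[of _ z]) (auto simp: Z_def)
      qed
      then show ?thesis using s(1) unfolding eventually_at by (intro exI[of _ s]) (auto simp: dist_real_def)
    qed
    have upper: "\<forall>\<^sub>F \<eta>' in at \<eta> within {a..b}. \<forall>z\<in>Z \<eta>'. \<exists>x\<in>Z \<eta>. \<bar>z - x\<bar> < e"
    proof -
      \<comment> \<open>On the compact complement of the \<open>e\<close>-balls around the zeros the
        modulus has a positive minimum, so nearby parameters have no zeros there.\<close>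
      define C where "C = {0..1} - (\<Union>x\<in>Z \<eta>. ball x e)"
      have C: "compact C" "C \<subseteq> {0..1}" unfolding C_def by (auto intro!: compact_diff open_UN)
      have nz: "\<phi> \<eta> x \<noteq> 0" if "x \<in> C" for x using that e by (auto simp: C_def Z_def)
      obtain m where m: "m > 0" "\<And>x. x \<in> C \<Longrightarrow> m \<le> \<bar>\<phi> \<eta> x\<bar>"
      proof (cases "C = {}")
        case False
        have "continuous_on C (\<lambda>x. \<bar>\<phi> \<eta> x\<bar>)"
          using C by (intro continuous_intros continuous_on_subset[OF slice[OF \<eta>]])
        then obtain w where "w \<in> C" "\<forall>x\<in>C. \<bar>\<phi> \<eta> w\<bar> \<le> \<bar>\<phi> \<eta> x\<bar>"
          using continuous_attains_inf[OF C(1) False] by blast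
        then show thesis using that[of "\<bar>\<phi> \<eta> w\<bar>"] nz by auto
      qed (use that[of 1] in auto)
      obtain s where s: "s > 0" "\<And>\<eta>' x. \<eta>'\<in>{a..b} \<Longrightarrow> \<bar>\<eta>' - \<eta>\<bar> < s \<Longrightarrow> x\<in>{0..1} \<Longrightarrow> \<bar>\<phi> \<eta>' x - \<phi> \<eta> x\<bar> < m"
        using near[OF \<eta> m(1)] by blast
      have "\<exists>x\<in>Z \<eta>. \<bar>z - x\<bar> < e" if "\<eta>' \<in> {a..b}" "\<bar>\<eta>' - \<eta>\<bar> < s" "z \<in> Z \<eta>'" for \<eta>' z
      proof (rule ccontr)
        assume "\<not> ?thesis"
        then have "z \<in> C" using that by (auto simp: C_def Z_def dist_real_def abs_minus_commute)
        then show False using m(2)[of z] s(2)[OF that(1,2), of z] that(3) by (auto simp: Z_def)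
      qed
      then show ?thesis using s(1) unfolding eventually_at by (intro exI[of _ s]) (auto simp: dist_real_def)
    qed
    have "\<forall>\<^sub>F \<eta>' in at \<eta> within {a..b}. \<forall>x\<in>Z \<eta>. \<exists>z\<in>Z \<eta>'. \<bar>z - x\<bar> < e"
      by (rule eventually_ball_finite[OF finZ[OF \<eta>]]) (use lower in blast)
    moreover have "\<forall>\<^sub>F \<eta>' in at \<eta> within {a..b}. \<eta>' \<in> {a..b}" by (auto simp: eventually_at_filter)
    ultimately show "\<forall>\<^sub>F \<eta>' in at \<eta> within {a..b}. card (Z \<eta>) = card (Z \<eta>')"
      using upper
    proof eventually_elim
      case (elim \<eta>')
      from elim(1) obtain f where f: "\<And>x. x \<in> Z \<eta> \<Longrightarrow> f x \<in> Z \<eta>' \<and> \<bar>f x - x\<bar> < e" by metis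
      have far: "\<bar>x - y\<bar> \<ge> 3 * e" if "x \<in> Z \<zeta>" "y \<in> Z \<zeta>" "x \<noteq> y" "\<zeta> \<in> {a..b}" for x y \<zeta>
        using sep[of \<zeta> x y] sep[of \<zeta> y x] that by (cases "x < y") (auto simp: Z_def e_def)
      have "bij_betw f (Z \<eta>) (Z \<eta>')"
        unfolding bij_betw_def
      proof
        show "inj_on f (Z \<eta>)"
        proof (rule inj_onI, rule ccontr)
          fix x y assume "x \<in> Z \<eta>" "y \<in> Z \<eta>" "f x = f y" "x \<noteq> y"
          then show False using f[of x] f[of y] far[of x \<eta> y] \<eta> by auto
        qed
        show "f ` Z \<eta> = Z \<eta>'"
        proof
          show "f ` Z \<eta> \<subseteq> Z \<eta>'" using f by auto
          show "Z \<eta>' \<subseteq> f ` Z \<eta>"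
          proof
            fix z assume z: "z \<in> Z \<eta>'"
            then obtain x where x: "x \<in> Z \<eta>" "\<bar>z - x\<bar> < e" using elim by blast
            have "z = f x"
            proof (rule ccontr)
              assume "z \<noteq> f x"
              then show False using far[of z \<eta>' "f x"] f[OF x(1)] x z elim(2) e by auto
            qed
            then show "z \<in> f ` Z \<eta>" using x by blast
          qed
        qed
      qed
      then show ?case by (rule bij_betw_same_card)
    qed
  qed
qed (use ab in auto)

context supercritical
begin

text \<open>Here \<open>x = \<eta> * y\<close> is the original variable \<open>\<rho>\<close>, so the light cone is \<open>x = 1\<close> for every \<open>\<eta>\<close>.\<close>

definition psi :: "real \<Rightarrow> real \<Rightarrow> real"
  where "psi \<eta> x = (x / \<eta>) powr \<alpha> * U (\<eta>, x / \<eta>)"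

lemma psi_eq_v: "\<eta> > 0 \<Longrightarrow> x > 0 \<Longrightarrow> psi \<eta> x = v \<eta> (\<eta> / x)"
  by (simp add: psi_def v_def powr_minus powr_divide)

lemma psi_0: "psi \<eta> 0 = 0" by (simp add: psi_def)

lemma continuous_on_psi:
  assumes "0 < a" "b' \<le> 1" shows "continuous_on ({a..b'} \<times> {0..1}) (\<lambda>(\<eta>, x). psi \<eta> x)"
proof -
  have "continuous_on ({a..b'} \<times> {0..1}) (\<lambda>u. U (fst u, snd u / fst u))"
    by (rule continuous_on_compose2[OF continuous_on_U])
      (use assms in \<open>auto simp: X_def intro!: continuous_intros\<close>)
  then have "continuous_on ({a..b'} \<times> {0..1}) (\<lambda>u. (snd u / fst u) powr \<alpha> * U (fst u, snd u / fst u))"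
    using assms \<alpha>_pos by (intro continuous_intros continuous_on_powr') auto
  then show ?thesis by (simp add: psi_def case_prod_unfold)
qed

lemma continuous_on_F: "continuous_on {0..} F"
  unfolding F_def using p_gt by (intro continuous_intros continuous_on_powr') auto

section \<open>Energy gap and the shooting argument\<close>

text \<open>Strictness is the point: it turns \<open>psi \<eta> 1 \<noteq> b\<close> into a positive
  gap between \<open>F (psi \<eta> 1)\<close> and \<open>F b\<close>.\<close>

lemma F_min: assumes "w \<ge> 0" "w \<noteq> b" shows "F b < F w"
proof (cases "w > b")
  case True
  show ?thesis
  proof (rule DERIV_pos_imp_increasing_open[OF True])
    fix x assume x: "b < x" "x < w"
    then have "0 < x powr p - c * x" using secant_pos[of x] b_pos by (simp add: secant_eq)
    then show "\<exists>y. (F has_real_derivative y) (at x) \<and> 0 < y" using DERIV_F[of x] x b_pos by auto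
  next
    show "continuous_on {b..w} F" by (rule continuous_on_subset[OF continuous_on_F]) (use b_pos in auto)
  qed
next
  case False
  with assms have "w < b" by simp
  then show ?thesis
  proof (rule DERIV_neg_imp_decreasing_open)
    fix x assume x: "w < x" "x < b"
    then have "x powr p - c * x < 0" using secant_pos[of x] assms by (simp add: secant_eq mult_pos_neg)
    then show "\<exists>y. (F has_real_derivative y) (at x) \<and> y < 0" using DERIV_F[of x] x assms by auto
  next
    show "continuous_on {w..b} F" by (rule continuous_on_subset[OF continuous_on_F]) (use assms in auto)
  qed
qed

lemma psi_deriv:
  assumes "0 < \<eta>" "\<eta> \<le> 1" "\<eta>\<^sup>2 * c < 1" "0 < x" "x < 1"
  shows "(psi \<eta> has_real_derivative dv \<eta> (\<eta> / x) * - (\<eta> / x\<^sup>2)) (at x)"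
proof -
  have lt: "\<eta> < \<eta> / x" using assms by (simp add: field_simps)
  have "((\<lambda>x. \<eta> / x) has_real_derivative - (\<eta> / x\<^sup>2)) (at x)"
    using assms by (auto intro!: derivative_eq_intros simp: power2_eq_square)
  then have "((\<lambda>x. v \<eta> (\<eta> / x)) has_real_derivative dv \<eta> (\<eta> / x) * - (\<eta> / x\<^sup>2)) (at x)"
    by (rule DERIV_chain2[where g = "\<lambda>x. \<eta> / x", rotated]) (use v_derivs(1)[of \<eta> "\<eta> / x"] lt assms in auto)
  moreover have "\<forall>\<^sub>F x in nhds x. v \<eta> (\<eta> / x) = psi \<eta> x"
    using eventually_nhds_in_open[of "{0<..}" x] assms
    by (auto elim!: eventually_mono simp: psi_eq_v)
  ultimately show ?thesis using DERIV_cong_ev[of x x "\<lambda>x. v \<eta> (\<eta> / x)" "psi \<eta>"] by simp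
qed

lemma continuous_on_psi_slice:
  assumes "0 < \<eta>" "\<eta> \<le> 1" shows "continuous_on {0..1} (psi \<eta>)"
proof -
  have "continuous_on {0..1} (\<lambda>x. (\<lambda>(\<eta>, x). psi \<eta> x) (\<eta>, x))"
    by (rule continuous_on_compose2[OF continuous_on_psi[of \<eta> \<eta>]]) (use assms in \<open>auto intro!: continuous_intros\<close>)
  then show ?thesis by simp
qed

lemma psi_nonneg:
  assumes "0 < \<eta>" "\<eta> \<le> 1" "\<eta>\<^sup>2 * c < 1" "0 \<le> x" "x \<le> 1"
  shows "psi \<eta> x \<ge> 0"
proof -
  have pos: "psi \<eta> y > 0" if "0 < y" "y < 1" for y
    using v_pos[of \<eta> "\<eta> / y"] that assms by (simp add: psi_eq_v field_simps)
  have "(psi \<eta> \<longlongrightarrow> psi \<eta> 1) (at_left 1)"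
    by (rule continuous_on_Icc_at_leftD[OF continuous_on_psi_slice]) (use assms in auto)
  then have "psi \<eta> 1 \<ge> 0"
  proof (rule tendsto_lowerbound)
    show "\<forall>\<^sub>F y in at_left 1. 0 \<le> psi \<eta> y"
      unfolding eventually_at_left_field using pos by (intro exI[of _ 0]) (auto simp: less_imp_le)
  qed simp
  then show ?thesis using pos[of x] psi_0[of \<eta>] assms by (cases "x = 0 \<or> x = 1") (auto simp: less_imp_le)
qed

text \<open>
  At a critical point the energy is purely potential and it only decreases towards \<open>x = 1\<close>, so it stays
  above \<open>F (psi \<eta> 1)\<close>. This keeps critical points away from the minimum \<open>b\<close> of \<open>F\<close> unless \<open>psi \<eta> 1 = b\<close>.
\<close>
lemma F_critical_ge:
  assumes \<eta>: "0 < \<eta>" "\<eta> \<le> 1" "\<eta>\<^sup>2 * c < 1" and x: "0 < x" "x < 1" and crit: "dv \<eta> (\<eta> / x) = 0"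
  shows "F (psi \<eta> 1) \<le> F (psi \<eta> x)"
proof -
  have "continuous_on {x..1} (\<lambda>y. F (psi \<eta> y))"
    by (rule continuous_on_compose2[OF continuous_on_F continuous_on_subset[OF continuous_on_psi_slice[OF \<eta>(1,2)]]])
      (use psi_nonneg[OF \<eta>] x in auto)
  then have "((\<lambda>y. F (psi \<eta> y)) \<longlongrightarrow> F (psi \<eta> 1)) (at_left 1)"
    using x continuous_on_Icc_at_leftD by blast
  then show ?thesis
  proof (rule tendsto_upperbound)
    have "\<forall>\<^sub>F y in at_left 1. x < y \<and> y < (1::real)"
      using x by (auto simp: eventually_at_left_field)
    then show "\<forall>\<^sub>F y in at_left 1. F (psi \<eta> y) \<le> F (psi \<eta> x)"
    proof eventually_elim
      case (elim y)
      have lt: "\<eta> < \<eta> / y" "\<eta> / y \<le> \<eta> / x" using elim x \<eta> by (auto simp: field_simps)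
      have "F (psi \<eta> y) \<le> energy \<eta> (\<eta> / y)"
        using F_v_le_energy[of \<eta> "\<eta> / y"] lt \<eta> elim x by (simp add: psi_eq_v)
      also have "\<dots> \<le> energy \<eta> (\<eta> / x)"
        by (rule energy_mono[where ?z0.0 = \<eta>]) (use U_bounds_inv[of \<eta>] \<eta> lt in auto)
      also have "\<dots> = F (psi \<eta> x)" using crit \<eta> x by (simp add: energy_def psi_eq_v)
      finally show ?case .
    qed
  qed simp
qed

lemma small_\<eta>:
  assumes "0 < \<eta>" "\<eta> \<le> 1" "\<eta> \<le> 1 / (c + 1)" shows "\<eta>\<^sup>2 * c < 1"
proof -
  have "\<eta>\<^sup>2 \<le> \<eta>" using assms by (simp add: power2_eq_square mult_left_le)
  then have "\<eta>\<^sup>2 * c \<le> 1 / (c + 1) * c" using assms c_pos by (intro mult_right_mono) auto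
  also have "\<dots> < 1" using c_pos by simp
  finally show ?thesis .
qed

text \<open>Suppose the value at the cone always misses \<open>b\<close>. On a compact parameter
  interval critical points then stay at a fixed distance from the level \<open>b\<close>, so the
  zeros of \<open>psi \<eta> - b\<close> are simple, uniformly separated and never at an endpoint.
  Their number agrees at both ends of the interval, contrary to its growth as \<eta> tends to
  0.\<close>

lemma shooting:
  assumes "\<eta>s > 0"
  shows "\<exists>\<eta>. 0 < \<eta> \<and> \<eta> < \<eta>s \<and> psi \<eta> 1 = b"
proof (rule ccontr)
  assume "\<not> ?thesis"
  then have ne: "psi \<eta> 1 \<noteq> b" if "0 < \<eta>" "\<eta> < \<eta>s" for \<eta> using that by blast
  define B where "B = min (\<eta>s / 2) (min 1 (1 / (c + 1)))"
  have cB: "1 / (c + 1) > 0" "1 / (c + 1) < 1" using c_pos by auto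
  have B: "0 < B" "B < \<eta>s" "B \<le> 1" using assms cB by (simp_all add: B_def min_less_iff_disj min_le_iff_disj)
  have sq: "\<eta>\<^sup>2 * c < 1" if "0 < \<eta>" "\<eta> \<le> B" for \<eta>
    using small_\<eta>[of \<eta>] that by (simp add: B_def)
  define Z where "Z = (\<lambda>\<eta>. {x \<in> {0..1}. psi \<eta> x - b = 0})"
  \<comment> \<open>The lower end \<open>A\<close> is taken so small that one more crossing is
    available than the upper end \<open>B\<close> has.\<close>
  obtain A Y where A: "0 < A" "A \<le> B" and Y: "Y \<subseteq> Z A" "card Y = Suc (card (Z B))"
  proof -
    obtain \<eta>0 where \<eta>0: "\<eta>0 > 0" "\<And>\<eta>. 0 < \<eta> \<Longrightarrow> \<eta> < \<eta>0 \<Longrightarrow> 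
        \<exists>Y \<subseteq> {z. \<eta> < z \<and> v \<eta> z = b}. finite Y \<and> card Y = Suc (card (Z B))"
      using many_crossings[of "Suc (card (Z B))"] by blast
    define A where "A = min (\<eta>0 / 2) B"
    have A: "0 < A" "A \<le> B" "A < \<eta>0" using \<eta>0(1) B by (auto simp: A_def)
    from \<eta>0(2)[OF A(1,3)] obtain Y where Y: "Y \<subseteq> {z. A < z \<and> v A z = b}" "finite Y" "card Y = Suc (card (Z B))" by blast
    have "inj_on (\<lambda>z. A / z) Y" using A by (auto intro!: inj_onI)
    then have card: "card ((\<lambda>z. A / z) ` Y) = Suc (card (Z B))" by (simp add: card_image Y)
    have "(\<lambda>z. A / z) ` Y \<subseteq> Z A"
    proof clarify
      fix z assume "z \<in> Y"
      then have z: "A < z" "v A z = b" using Y by auto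
      then show "A / z \<in> Z A" using A psi_eq_v[of A "A / z"] by (simp add: Z_def)
    qed
    with that[OF A(1,2) _ card] show thesis by blast
  qed
  let ?I = "{A..B}"
  have I: "0 < \<eta>" "\<eta> \<le> 1" "\<eta>\<^sup>2 * c < 1" "\<eta> < \<eta>s" if "\<eta> \<in> ?I" for \<eta> using that A B sq by auto
  have cpsi: "continuous_on (?I \<times> {0..1}) (\<lambda>(\<eta>, x). psi \<eta> x)" using A B by (intro continuous_on_psi) auto
  have "continuous_on ?I (\<lambda>\<eta>. (\<lambda>(\<eta>, x). psi \<eta> x) (\<eta>, 1))"
    by (rule continuous_on_compose2[OF cpsi]) (auto intro!: continuous_intros)
  then have "continuous_on ?I (\<lambda>\<eta>. F (psi \<eta> 1))"
    by (intro continuous_on_compose2[OF continuous_on_F]) (use psi_nonneg I in auto)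
  \<comment> \<open>The least potential on the cone over all parameters makes the gap uniform;
    continuity of \<open>F\<close> at \<open>b\<close> then converts it into the distance
    \<open>d\<close>.\<close>
  then obtain w where w: "w \<in> ?I" "\<And>\<eta>. \<eta> \<in> ?I \<Longrightarrow> F (psi w 1) \<le> F (psi \<eta> 1)"
    using continuous_attains_inf[of ?I "\<lambda>\<eta>. F (psi \<eta> 1)"] A by (metis atLeastatMost_empty_iff2 compact_Icc)
  have "F b < F (psi w 1)" using I[OF w(1)] ne psi_nonneg by (intro F_min) auto
  moreover have "isCont F b" using DERIV_F[OF b_pos] by (rule DERIV_isCont)
  ultimately have "\<forall>\<^sub>F x in at b. F x < F (psi w 1)" by (intro order_tendstoD(2)) (auto simp: isCont_def)
  then obtain d where d0: "d > 0" "\<forall>x. x \<noteq> b \<and> dist x b < d \<longrightarrow> F x < F (psi w 1)"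
    unfolding eventually_at by auto
  then have d: "F x < F (psi w 1)" if "\<bar>x - b\<bar> < d" for x
    using that \<open>F b < F (psi w 1)\<close> by (cases "x = b") (auto simp: dist_real_def)
  have crit: "\<bar>psi \<eta> x - b\<bar> \<ge> d" if "\<eta> \<in> ?I" "0 < x" "x < 1" "dv \<eta> (\<eta> / x) = 0" for \<eta> x
    using F_critical_ge[of \<eta> x] I[OF that(1)] w(2)[OF that(1)] d[of "psi \<eta> x"] that by fastforce
  \<comment> \<open>Origin of the separation \<delta>: two zeros closer than this would, by Rolle's
    theorem, enclose a critical point where \<open>psi\<close> is within \<open>d\<close> of
    \<open>b\<close>.\<close>
  have "uniformly_continuous_on (?I \<times> {0..1}) (\<lambda>(\<eta>, x). psi \<eta> x)"
    by (intro compact_uniformly_continuous cpsi compact_Times) auto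
  then obtain \<delta> where \<delta>: "\<delta> > 0" "\<And>u u'. \<lbrakk>u \<in> ?I \<times> {0..1}; u' \<in> ?I \<times> {0..1}; dist u' u < \<delta>\<rbrakk> \<Longrightarrow>
       dist ((\<lambda>(\<eta>, x). psi \<eta> x) u') ((\<lambda>(\<eta>, x). psi \<eta> x) u) < d"
    using d0(1) unfolding uniformly_continuous_on_def by metis
  have \<delta>': "\<bar>psi \<eta> x' - psi \<eta> x\<bar> < d" if "\<eta> \<in> ?I" "x \<in> {0..1}" "x' \<in> {0..1}" "\<bar>x' - x\<bar> < \<delta>" for \<eta> x x'
    using \<delta>(2)[of "(\<eta>, x)" "(\<eta>, x')"] that by (simp add: dist_Pair_Pair dist_real_def)
  have inside: "0 < x \<and> x < 1" if "\<eta> \<in> ?I" "0 \<le> x" "x \<le> 1" "psi \<eta> x - b = 0" for \<eta> x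
    using that ne[of \<eta>] I[OF that(1)] psi_0[of \<eta>] b_pos by (cases "x = 0 \<or> x = 1") auto
  have sep: "\<delta> \<le> y - x"
    if \<eta>: "\<eta> \<in> ?I" and xy: "0 \<le> x" "x < y" "y \<le> 1" and zero: "psi \<eta> x - b = 0" "psi \<eta> y - b = 0" for \<eta> x y
  proof (rule ccontr)
    assume "\<not> \<delta> \<le> y - x"
    have in': "0 < x" "y < 1" using inside[OF \<eta> _ _ zero(1)] inside[OF \<eta> _ _ zero(2)] xy by auto
    have "\<exists>z. x < z \<and> z < y \<and> psi \<eta> y - psi \<eta> x = (y - x) * (dv \<eta> (\<eta> / z) * - (\<eta> / z\<^sup>2))"
      by (rule MVT2[OF xy(2)]) (use psi_deriv I[OF \<eta>] in' in auto)
    then obtain z where z: "x < z" "z < y" "dv \<eta> (\<eta> / z) = 0"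
      using zero xy in' I[OF \<eta>] by auto
    have "\<bar>psi \<eta> z - psi \<eta> x\<bar> < d"
      using z in' \<open>\<not> \<delta> \<le> y - x\<close> by (intro \<delta>' \<eta>) auto
    with crit[OF \<eta> _ _ z(3)] z in' zero show False by auto
  qed
  have cross: "\<exists>x1 x2. 0 \<le> x1 \<and> x - e < x1 \<and> x1 < x2 \<and> x2 < x + e \<and> x2 \<le> 1 \<and> (psi \<eta> x1 - b) * (psi \<eta> x2 - b) < 0"
    if \<eta>: "\<eta> \<in> ?I" and x: "0 \<le> x" "x \<le> 1" "psi \<eta> x - b = 0" and e: "e > 0" for \<eta> x e
  proof -
    have x': "0 < x" "x < 1" using inside[OF \<eta> x] by auto
    define l where "l = dv \<eta> (\<eta> / x) * - (\<eta> / x\<^sup>2)"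
    have D: "((\<lambda>x. psi \<eta> x - b) has_real_derivative l) (at x)"
      using DERIV_diff[OF psi_deriv DERIV_const, of \<eta> x b] I[OF \<eta>] x' by (simp add: l_def)
    \<comment> \<open>At a zero the distance from \<open>b\<close> is 0, less than \<open>d\<close>,
      so the zero is not critical and the sign changes.\<close>
    have "dv \<eta> (\<eta> / x) \<noteq> 0" using crit[OF \<eta> x'] x d0 by auto
    then have "l \<noteq> 0" using I[OF \<eta>] x' by (simp add: l_def)
    have "\<exists>h>0. h < min e (min x (1 - x)) \<and> (psi \<eta> (x - h) - b) * (psi \<eta> (x + h) - b) < 0"
    proof (cases "l > 0")
      case True
      from DERIV_pos_inc_right[OF D True] obtain d1 where d1: "d1 > 0" "\<And>h. 0 < h \<Longrightarrow> h < d1 \<Longrightarrow> psi \<eta> x - b < psi \<eta> (x + h) - b" by blast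
      from DERIV_pos_inc_left[OF D True] obtain d2 where d2: "d2 > 0" "\<And>h. 0 < h \<Longrightarrow> h < d2 \<Longrightarrow> psi \<eta> x - b > psi \<eta> (x - h) - b" by blast
      define h where "h = min (min d1 d2) (min e (min x (1 - x))) / 2"
      have "0 < h" "h < d1" "h < d2" "h < min e (min x (1 - x))" using d1(1) d2(1) e x' by (auto simp: h_def)
      then show ?thesis using d1(2)[of h] d2(2)[of h] x by (intro exI[of _ h]) (auto simp: mult_less_0_iff)
    next
      case False
      then have l: "l < 0" using \<open>l \<noteq> 0\<close> by simp
      from DERIV_neg_dec_right[OF D l] obtain d1 where d1: "d1 > 0" "\<And>h. 0 < h \<Longrightarrow> h < d1 \<Longrightarrow> psi \<eta> x - b > psi \<eta> (x + h) - b" by blast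
      from DERIV_neg_dec_left[OF D l] obtain d2 where d2: "d2 > 0" "\<And>h. 0 < h \<Longrightarrow> h < d2 \<Longrightarrow> psi \<eta> x - b < psi \<eta> (x - h) - b" by blast
      define h where "h = min (min d1 d2) (min e (min x (1 - x))) / 2"
      have "0 < h" "h < d1" "h < d2" "h < min e (min x (1 - x))" using d1(1) d2(1) e x' by (auto simp: h_def)
      then show ?thesis using d1(2)[of h] d2(2)[of h] x by (intro exI[of _ h]) (auto simp: mult_less_0_iff)
    qed
    then obtain h where "h > 0" "h < min e (min x (1 - x))" "(psi \<eta> (x - h) - b) * (psi \<eta> (x + h) - b) < 0" by blast
    then show ?thesis by (intro exI[of _ "x - h"] exI[of _ "x + h"]) auto
  qed
  have cont: "continuous_on (?I \<times> {0..1}) (\<lambda>(\<eta>, x). psi \<eta> x - b)"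
    using continuous_on_diff[OF cpsi continuous_on_const[of _ b]] by (simp add: case_prod_unfold)
  have "card (Z A) = card (Z B)"
    unfolding Z_def
    by (rule card_zeros_constant[where a = A and b = B and \<delta> = \<delta>]) (use A \<delta>(1) cont sep cross in auto)
  moreover have "finite (Z A)"
    by (rule finite_separated[OF \<delta>(1)]) (use sep A in \<open>auto simp: Z_def\<close>)
  then have "card Y \<le> card (Z A)" using Y(1) by (intro card_mono)
  ultimately show False using Y(2) by simp
qed

end

section \<open>Holomorphic fixed points\<close>

lemma ray_in_ball:
  fixes x :: complex
  assumes "x \<in> ball 0 s" "0 \<le> t" "t \<le> 1" shows "of_real t * x \<in> ball 0 s"
proof -
  have "\<bar>t\<bar> * norm x \<le> 1 * norm x" using assms by (intro mult_right_mono) auto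
  with assms show ?thesis by (simp add: norm_mult)
qed

lemma ray_integrable:
  fixes h :: "complex \<Rightarrow> complex" and K :: "real \<Rightarrow> real"
  assumes h: "continuous_on (ball 0 s) h" and K: "continuous_on {0..1} K" and x: "x \<in> ball 0 s"
  shows "(\<lambda>t. of_real (K t) * h (of_real t * x)) integrable_on {0..1}"
proof (rule integrable_continuous_real, intro continuous_intros K)
  have "of_real t * x \<in> ball 0 s" if "t \<in> {0..1}" for t
    using ray_in_ball[OF x] that by simp
  then show "continuous_on {0..1} (\<lambda>t. h (of_real t * x))"
    by (intro continuous_on_compose2[OF h] continuous_intros) auto
qed

lemma holomorphic_ray_integral:
  fixes h :: "complex \<Rightarrow> complex" and K :: "real \<Rightarrow> real"
  assumes h: "h holomorphic_on ball 0 s" and K: "continuous_on {0..1} K"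
  shows "(\<lambda>x. integral {0..1} (\<lambda>t. of_real (K t) * h (of_real t * x))) holomorphic_on ball 0 s"
  unfolding cbox_interval[symmetric]
proof (rule leibniz_rule_holomorphic)
  have in_ball: "of_real t * x \<in> ball 0 s" if "x \<in> ball 0 s" "t \<in> cbox 0 1" for x :: complex and t :: real
    using ray_in_ball that by simp
  show "((\<lambda>x. of_real (K t) * h (of_real t * x)) has_field_derivative of_real (K t) * (deriv h (of_real t * x) * of_real t)) (at x within ball 0 s)"
    if "x \<in> ball 0 s" "t \<in> cbox 0 1" for x t
  proof -
    have "(h has_field_derivative deriv h (of_real t * x)) (at (of_real t * x))"
      using h in_ball[OF that] by (auto intro: holomorphic_derivI)
    moreover have "((\<lambda>x. of_real t * x) has_field_derivative of_real t) (at x)"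
      by (auto intro!: derivative_eq_intros)
    ultimately have "((\<lambda>x. h (of_real t * x)) has_field_derivative deriv h (of_real t * x) * of_real t) (at x)"
      by (rule DERIV_chain2)
    from DERIV_cmult[OF this, of "of_real (K t)"] show ?thesis by (rule has_field_derivative_at_within)
  qed
  show "(\<lambda>t. of_real (K t) * h (of_real t * x)) integrable_on cbox 0 1" if "x \<in> ball 0 s" for x
    unfolding cbox_interval
    by (rule ray_integrable[OF holomorphic_on_imp_continuous_on[OF h] K that])
  have cd: "continuous_on (ball 0 s) (deriv h)"
    using h by (intro holomorphic_on_imp_continuous_on holomorphic_deriv) auto
  have "continuous_on (ball 0 s \<times> cbox 0 1) (\<lambda>u. of_real (K (snd u)) * (deriv h (of_real (snd u) * fst u) * of_real (snd u)))"
  proof (intro continuous_intros)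
    show "continuous_on (ball 0 s \<times> cbox 0 1) (\<lambda>u. K (snd u))"
      by (rule continuous_on_compose2[OF K]) (auto intro!: continuous_intros)
    show "continuous_on (ball 0 s \<times> cbox 0 1) (\<lambda>u. deriv h (of_real (snd u) * fst u))"
      by (rule continuous_on_compose2[OF cd]) (use in_ball in \<open>auto intro!: continuous_intros\<close>)
  qed
  then show "continuous_on (ball 0 s \<times> cbox 0 1) (\<lambda>(x, t). of_real (K t) * (deriv h (of_real t * x) * of_real t))"
    by (simp add: case_prod_unfold)
qed auto

lemma ray_integral_diff_bound:
  fixes f g :: "real \<Rightarrow> complex" and K :: "real \<Rightarrow> real"
  assumes "((\<lambda>t. of_real (K t) * f t) has_integral J) {0..1}" "((\<lambda>t. of_real (K t) * g t) has_integral J') {0..1}"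
    and K: "\<And>t. t \<in> {0..1} \<Longrightarrow> \<bar>K t\<bar> \<le> 1" and B: "B \<ge> 0" "\<And>t. t \<in> {0..1} \<Longrightarrow> norm (f t - g t) \<le> B"
  shows "norm (J - J') \<le> B"
proof -
  have "((\<lambda>t. of_real (K t) * f t - of_real (K t) * g t) has_integral (J - J')) (cbox 0 1)"
    unfolding cbox_interval by (intro has_integral_diff assms)
  then have "norm (J - J') \<le> B * measure lborel (cbox 0 1 :: real set)"
  proof (rule has_integral_bound[OF B(1)])
    fix t :: real assume "t \<in> cbox 0 1"
    then have t: "t \<in> {0..1}" by simp
    have "norm (of_real (K t) * f t - of_real (K t) * g t) = \<bar>K t\<bar> * norm (f t - g t)"
      by (simp add: norm_mult flip: right_diff_distrib)
    also have "\<dots> \<le> 1 * B" using K[OF t] B(2)[OF t] by (intro mult_mono) auto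
    finally show "norm (of_real (K t) * f t - of_real (K t) * g t) \<le> B" by simp
  qed
  then show ?thesis by simp
qed

text \<open>The factor \<open>x ^ j\<close> with \<open>j \<ge> 1\<close> makes the integral
  operator a contraction on a small disc. The last conclusion is uniqueness among functions
  \<open>V\<close> that live only on a real set \<open>I\<close> closed under scaling towards 0, and
  that satisfy the equation with no regularity beyond existence of the integrals. It transfers
  analyticity to the real solutions, also when \<open>I\<close> is one-sided.\<close>

lemma holomorphic_fixed_point:
  fixes P :: "complex \<Rightarrow> complex" and H :: "complex \<Rightarrow> complex \<Rightarrow> complex" and K :: "real \<Rightarrow> real"
  assumes r: "r > 0" and R: "R > 0" and P: "P holomorphic_on ball 0 r" "P 0 = w0"
    and K: "continuous_on {0..1} K" "\<And>t. t \<in> {0..1} \<Longrightarrow> \<bar>K t\<bar> \<le> 1" and j: "j \<ge> 1"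
    and H: "\<And>s W. \<lbrakk>0 < s; s \<le> r; W holomorphic_on ball 0 s; \<And>x. x \<in> ball 0 s \<Longrightarrow> W x \<in> cball w0 R\<rbrakk>
       \<Longrightarrow> (\<lambda>x. H x (W x)) holomorphic_on ball 0 s"
    and M: "\<And>x w. x \<in> ball 0 r \<Longrightarrow> w \<in> cball w0 R \<Longrightarrow> norm (H x w) \<le> M"
    and L: "\<And>x w w'. x \<in> ball 0 r \<Longrightarrow> w \<in> cball w0 R \<Longrightarrow> w' \<in> cball w0 R \<Longrightarrow> norm (H x w - H x w') \<le> L * norm (w - w')"
  obtains s W where "0 < s" "s \<le> r" "W holomorphic_on ball 0 s" "\<And>x. x \<in> ball 0 s \<Longrightarrow> W x \<in> cball w0 R"
    "\<And>x. x \<in> ball 0 s \<Longrightarrow> W x = P x + x ^ j * integral {0..1} (\<lambda>t. of_real (K t) * H (of_real t * x) (W (of_real t * x)))"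
    "\<And>I V x. \<lbrakk>\<And>x. x \<in> I \<Longrightarrow> \<bar>x\<bar> < s; \<And>x t. x \<in> I \<Longrightarrow> 0 \<le> t \<Longrightarrow> t \<le> 1 \<Longrightarrow> t * x \<in> I; \<And>x. x \<in> I \<Longrightarrow> V x \<in> cball w0 R;
       \<And>x. x \<in> I \<Longrightarrow> \<exists>J. ((\<lambda>t. of_real (K t) * H (of_real t * of_real x) (V (t * x))) has_integral J) {0..1} \<and> V x = P (of_real x) + (of_real x) ^ j * J;
       x \<in> I\<rbrakk> \<Longrightarrow> V x = W (of_real x)"
proof -
  define M' where "M' = \<bar>M\<bar> + 1"
  define L' where "L' = \<bar>L\<bar> + 1"
  have M': "M' > 0" "\<And>x w. x \<in> ball 0 r \<Longrightarrow> w \<in> cball w0 R \<Longrightarrow> norm (H x w) \<le> M'"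
    using M by (force simp: M'_def)+
  have L': "L' > 0" "\<And>x w w'. x \<in> ball 0 r \<Longrightarrow> w \<in> cball w0 R \<Longrightarrow> w' \<in> cball w0 R \<Longrightarrow> norm (H x w - H x w') \<le> L' * norm (w - w')"
    subgoal by (simp add: L'_def)
    subgoal for x w w'
      by (rule order_trans[OF L]) (auto simp: L'_def intro!: mult_right_mono)
    done
  have "continuous_on (ball 0 r) P" using P by (simp add: holomorphic_on_imp_continuous_on)
  then have "isCont P 0" using r by (simp add: continuous_on_eq_continuous_at)
  then obtain s0 where s0: "s0 > 0" "\<And>x. dist x 0 < s0 \<Longrightarrow> dist (P x) w0 < R / 2"
    using R P(2) unfolding continuous_at_eps_delta by (metis half_gt_zero)
  \<comment> \<open>The last two bounds give \<open>s * M' \<le> R / 2\<close>, so that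
    \<open>cball w0 R\<close> is preserved, and \<open>s * L' \<le> 1 / 2\<close> for the
    contraction; \<open>s \<le> 1\<close> allows \<open>norm x ^ j\<close> to be replaced by
    \<open>s\<close>.\<close>
  define s where "s = min (min r 1) (min s0 (min (R / 2 / M') (1 / 2 / L')))"
  have s: "0 < s" "s \<le> r" "s \<le> 1" "s \<le> s0" "s \<le> R / 2 / M'" "s \<le> 1 / 2 / L'"
    using r s0 R M'(1) L'(1) by (simp_all add: s_def min_le_iff_disj)
  have sM: "s * M' \<le> R / 2" and sL: "s * L' \<le> 1 / 2"
    using s(5,6) M'(1) L'(1) by (simp_all add: field_simps)
  have pw: "norm x ^ j \<le> s" if "norm x < s" for x :: complex
    using power_decreasing[of 1 j "norm x"] that j s by simp
  have ray: "of_real t * x \<in> ball 0 s" if "x \<in> ball 0 s" "t \<in> {0..1}" for x :: complex and t :: real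
    using ray_in_ball that by simp
  define T where "T = (\<lambda>W x. P x + x ^ j * integral {0..1} (\<lambda>t. of_real (K t) * H (of_real t * x) (W (of_real t * x))))"
  define S where "S = {W. W holomorphic_on ball 0 s \<and> (\<forall>x\<in>ball 0 s. W x \<in> cball w0 R)}"
  have hol: "(\<lambda>x. H x (W x)) holomorphic_on ball 0 s" if "W \<in> S" for W
    using that s by (intro H) (auto simp: S_def)
  have int: "((\<lambda>t. of_real (K t) * H (of_real t * x) (W (of_real t * x))) has_integral
      integral {0..1} (\<lambda>t. of_real (K t) * H (of_real t * x) (W (of_real t * x)))) {0..1}"
    if "W \<in> S" "x \<in> ball 0 s" for W x
    using ray_integrable[OF holomorphic_on_imp_continuous_on[OF hol[OF that(1)]] K(1) that(2)]
    by (rule integrable_integral)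
  have near: "norm (T W x - w0) \<le> R" if W: "W \<in> S" and x: "x \<in> ball 0 s" for W x
  proof -
    have "norm (integral {0..1} (\<lambda>t. of_real (K t) * H (of_real t * x) (W (of_real t * x))) - 0) \<le> M'"
    proof (rule ray_integral_diff_bound[OF int[OF W x] _ K(2), where g = "\<lambda>_. 0"])
      fix t :: real assume "t \<in> {0..1}"
      from ray[OF x this] W s show "norm (H (of_real t * x) (W (of_real t * x)) - 0) \<le> M'"
        by (simp add: S_def M'(2))
    qed (use M'(1) in auto)
    then have "norm x ^ j * norm (integral {0..1} (\<lambda>t. of_real (K t) * H (of_real t * x) (W (of_real t * x)))) \<le> s * M'"
      using pw[of x] x s by (intro mult_mono) auto
    then have "norm (x ^ j * integral {0..1} (\<lambda>t. of_real (K t) * H (of_real t * x) (W (of_real t * x)))) \<le> R / 2"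
      using sM by (simp add: norm_mult norm_power)
    moreover have "norm (P x - w0) \<le> R / 2" using s0(2)[of x] x s by (simp add: dist_norm)
    ultimately show ?thesis
      unfolding T_def using norm_triangle_ineq[of "P x - w0" "x ^ j * integral {0..1} (\<lambda>t. of_real (K t) * H (of_real t * x) (W (of_real t * x)))"]
      by (simp add: algebra_simps)
  qed
  obtain W where W: "W \<in> S" and Tfix: "\<And>x. x \<in> ball 0 s \<Longrightarrow> T W x = W x"
  proof (rule weighted_contraction_fixed_point[where X = "ball 0 s" and P = S and T = T and w = "\<lambda>_. 1" and q = "1 / 2" and D = R and ?f0.0 = "\<lambda>_. w0"])
    show 0: "(\<lambda>_. w0) \<in> S" using R by (simp add: S_def)
    show "norm (T (\<lambda>_. w0) x - w0) \<le> R * 1" if "x \<in> ball 0 s" for x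
      using near[OF 0 that] by simp
    show "T W \<in> S" if W: "W \<in> S" for W
    proof -
      have "T W holomorphic_on ball 0 s"
        unfolding T_def using s P(1)
        by (intro holomorphic_intros holomorphic_ray_integral[OF hol[OF W] K(1)])
          (auto intro: holomorphic_on_subset)
      then show ?thesis using near[OF W] by (simp add: S_def dist_norm norm_minus_commute)
    qed
    show "norm (T f x - T g x) \<le> 1 / 2 * d * 1"
      if fg: "f \<in> S" "g \<in> S" "0 \<le> d" "\<And>y. y \<in> ball 0 s \<Longrightarrow> norm (f y - g y) \<le> d * 1" "x \<in> ball 0 s" for f g d x
    proof -
      have "norm (integral {0..1} (\<lambda>t. of_real (K t) * H (of_real t * x) (f (of_real t * x)))
          - integral {0..1} (\<lambda>t. of_real (K t) * H (of_real t * x) (g (of_real t * x)))) \<le> L' * d"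
      proof (rule ray_integral_diff_bound[OF int int K(2)])
        fix t :: real assume t: "t \<in> {0..1}"
        note tx = ray[OF fg(5) t]
        have "norm (H (of_real t * x) (f (of_real t * x)) - H (of_real t * x) (g (of_real t * x)))
            \<le> L' * norm (f (of_real t * x) - g (of_real t * x))"
          using fg tx s by (intro L'(2)) (auto simp: S_def)
        also have "\<dots> \<le> L' * d" using fg(4)[OF tx] L'(1) by (intro mult_left_mono) auto
        finally show "norm (H (of_real t * x) (f (of_real t * x)) - H (of_real t * x) (g (of_real t * x))) \<le> L' * d" .
      qed (use fg L'(1) in auto)
      then have "norm x ^ j * norm (integral {0..1} (\<lambda>t. of_real (K t) * H (of_real t * x) (f (of_real t * x)))
          - integral {0..1} (\<lambda>t. of_real (K t) * H (of_real t * x) (g (of_real t * x)))) \<le> s * (L' * d)"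
        using pw[of x] fg s by (intro mult_mono) auto
      also have "\<dots> \<le> 1 / 2 * d" using sL fg(3) mult_right_mono[of "s * L'" "1 / 2" d] by (simp add: mult.assoc)
      finally show ?thesis by (simp add: T_def norm_mult norm_power flip: right_diff_distrib)
    qed
    show "f \<in> S" if F: "\<And>n. F n \<in> S"
      and lim: "\<And>e. 0 < e \<Longrightarrow> \<forall>\<^sub>F n in sequentially. \<forall>x\<in>ball 0 s. norm (F n x - f x) \<le> e * 1" for F f
    proof -
      have ul: "uniform_limit (ball 0 s) F f sequentially"
      proof (rule uniform_limitI)
        fix e :: real assume "e > 0"
        from lim[of "e / 2"] this show "\<forall>\<^sub>F n in sequentially. \<forall>x\<in>ball 0 s. dist (F n x) (f x) < e"
          by (auto elim!: eventually_mono simp: dist_norm intro: le_less_trans)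
      qed
      have "f holomorphic_on ball 0 s"
      proof (rule holomorphic_uniform_sequence[where f = F])
        show "F n holomorphic_on ball 0 s" for n using F by (simp add: S_def)
        show "\<exists>d>0. cball x d \<subseteq> ball 0 s \<and> uniform_limit (cball x d) F f sequentially" if x: "x \<in> ball 0 s" for x
        proof -
          obtain d where "d > 0" "cball x d \<subseteq> ball 0 s"
            using open_contains_cball[THEN iffD1, OF open_ball, rule_format, OF x] by metis
          then show ?thesis using uniform_limit_on_subset[OF ul, of "cball x d"] by (intro exI[of _ d]) simp
        qed
      qed simp
      moreover have "f x \<in> cball w0 R" if x: "x \<in> ball 0 s" for x
      proof (rule Lim_in_closed_set[OF closed_cball _ _ tendsto_uniform_limitI[OF ul x]])
        show "\<forall>\<^sub>F n in sequentially. F n x \<in> cball w0 R" using F x unfolding S_def by (intro always_eventually) auto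
      qed simp
      ultimately show ?thesis by (simp add: S_def)
    qed
  qed (use R in auto)
  show thesis
  proof (rule that[OF s(1,2), of W])
    show "W x \<in> cball w0 R" if "x \<in> ball 0 s" for x
      using W that by (auto simp: S_def)
    show "W holomorphic_on ball 0 s" using W by (simp add: S_def)
    show "W x = P x + x ^ j * integral {0..1} (\<lambda>t. of_real (K t) * H (of_real t * x) (W (of_real t * x)))" if "x \<in> ball 0 s" for x
      using Tfix[OF that] by (simp add: T_def)
    fix I :: "real set" and V x
    assume I: "\<And>x. x \<in> I \<Longrightarrow> \<bar>x\<bar> < s" "\<And>x t. x \<in> I \<Longrightarrow> 0 \<le> t \<Longrightarrow> t \<le> 1 \<Longrightarrow> t * x \<in> I" and VR: "\<And>x. x \<in> I \<Longrightarrow> V x \<in> cball w0 R"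
      and V: "\<And>x. x \<in> I \<Longrightarrow> \<exists>J. ((\<lambda>t. of_real (K t) * H (of_real t * of_real x) (V (t * x))) has_integral J) {0..1} \<and> V x = P (of_real x) + (of_real x) ^ j * J"
      and x: "x \<in> I"
    \<comment> \<open>\<open>V\<close> is not in the space where the fixed point was found, so the
      contraction estimate is iterated on the difference directly; \<open>2 * R\<close> is the
      diameter of the common disc.\<close>
    have bound: "\<forall>x\<in>I. norm (V x - W (of_real x)) \<le> 2 * R / 2 ^ n" for n
    proof (induction n)
      case 0
      show ?case
      proof
        fix x assume "x \<in> I"
        then have "V x \<in> cball w0 R" "W (of_real x) \<in> cball w0 R" using VR W I(1)[of x] by (auto simp: S_def)
        then show "norm (V x - W (of_real x)) \<le> 2 * R / 2 ^ 0"
          using dist_triangle[of "V x" "W (of_real x)" w0] by (simp add: dist_norm norm_minus_commute)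
      qed
    next
      case (Suc n)
      show ?case
      proof
        fix x assume x: "x \<in> I"
        then have xs: "of_real x \<in> ball (0::complex) s" using I(1)[of x] by simp
        obtain J where J: "((\<lambda>t. of_real (K t) * H (of_real t * of_real x) (V (t * x))) has_integral J) {0..1}"
          "V x = P (of_real x) + (of_real x) ^ j * J" using V[OF x] by blast
        let ?J = "integral {0..1} (\<lambda>t. of_real (K t) * H (of_real t * of_real x) (W (of_real t * of_real x)))"
        have "norm (J - ?J) \<le> L' * (2 * R / 2 ^ n)"
        proof (rule ray_integral_diff_bound[OF J(1) int[OF W xs] K(2)])
          fix t :: real assume t: "t \<in> {0..1}"
          then have tx: "t * x \<in> I" using I(2)[OF x] by simp
          have "norm (H (of_real t * of_real x) (V (t * x)) - H (of_real t * of_real x) (W (of_real t * of_real x)))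
            \<le> L' * norm (V (t * x) - W (of_real t * of_real x))"
            using ray[OF xs t] s VR[OF tx] W by (intro L'(2)) (auto simp: S_def)
          also have "\<dots> \<le> L' * (2 * R / 2 ^ n)"
            using bspec[OF Suc tx] L'(1) by (intro mult_left_mono) auto
          finally show "norm (H (of_real t * of_real x) (V (t * x)) - H (of_real t * of_real x) (W (of_real t * of_real x))) \<le> L' * (2 * R / 2 ^ n)" .
        qed (use L'(1) R in auto)
        then have "norm (of_real x :: complex) ^ j * norm (J - ?J) \<le> s * (L' * (2 * R / 2 ^ n))"
          using pw[of "of_real x"] xs s by (intro mult_mono) auto
        also have "\<dots> \<le> 1 / 2 * (2 * R / 2 ^ n)"
          using sL R mult_right_mono[of "s * L'" "1 / 2" "2 * R / 2 ^ n"] by (simp add: mult.assoc)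
        also have "V x - W (of_real x) = of_real x ^ j * (J - ?J)"
          using Tfix[OF xs] J(2) by (simp add: T_def algebra_simps)
        then have "norm (of_real x :: complex) ^ j * norm (J - ?J) = norm (V x - W (of_real x))"
          by (simp add: norm_mult norm_power)
        finally show "norm (V x - W (of_real x)) \<le> 2 * R / 2 ^ Suc n" by (simp add: field_simps)
      qed
    qed
    have "(\<lambda>n. 2 * R / 2 ^ n) \<longlonglongrightarrow> 0" using LIMSEQ_divide_realpow_zero[of 2 "2 * R"] by simp
    then have "norm (V x - W (of_real x)) \<le> 0"
      by (rule LIMSEQ_le_const) (use bound x in auto)
    then show "V x = W (of_real x)" by simp
  qed
qed

lemma holomorphic_bound_Lipschitz:
  assumes f: "f holomorphic_on S" and S: "open S" "cball w0 R \<subseteq> S"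
  obtains B where "B > 0" "\<And>w. w \<in> cball w0 R \<Longrightarrow> norm (f w) \<le> B"
    "\<And>w w'. w \<in> cball w0 R \<Longrightarrow> w' \<in> cball w0 R \<Longrightarrow> norm (f w - f w') \<le> B * norm (w - w')"
proof -
  have c: "continuous_on (cball w0 R) f" "continuous_on (cball w0 R) (deriv f)"
    using f S holomorphic_deriv[OF f S(1)]
    by (auto intro: holomorphic_on_imp_continuous_on continuous_on_subset)
  obtain B1 where B1: "\<And>w. w \<in> cball w0 R \<Longrightarrow> norm (f w) \<le> B1"
    using compact_imp_bounded[OF compact_continuous_image[OF c(1) compact_cball]]
    unfolding bounded_iff by blast
  obtain B2 where B2: "\<And>w. w \<in> cball w0 R \<Longrightarrow> norm (deriv f w) \<le> B2"
    using compact_imp_bounded[OF compact_continuous_image[OF c(2) compact_cball]]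
    unfolding bounded_iff by blast
  define B where "B = \<bar>B1\<bar> + \<bar>B2\<bar> + 1"
  show thesis
  proof (rule that[of B])
    show "norm (f w) \<le> B" if "w \<in> cball w0 R" for w using B1[OF that] by (simp add: B_def)
    show "norm (f w - f w') \<le> B * norm (w - w')" if w: "w \<in> cball w0 R" "w' \<in> cball w0 R" for w w'
    proof (rule field_differentiable_bound[OF convex_cball _ _ w])
      fix z assume z: "z \<in> cball w0 R"
      then show "(f has_field_derivative deriv f z) (at z within cball w0 R)"
        using f S by (auto intro: has_field_derivative_at_within[OF holomorphic_derivI])
      show "norm (deriv f z) \<le> B" using B2[OF z] by (simp add: B_def)
    qed
  qed (simp add: B_def)
qed

text \<open>The form taken by the equation at the centre and at regular points, where the
  coefficient \<open>a x\<close> and the nonlinearity \<open>f w\<close> separate. Halving the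
  radius makes \<open>a\<close> bounded by compactness.\<close>

lemma product_fixed_point:
  fixes P a f :: "complex \<Rightarrow> complex" and K :: "real \<Rightarrow> real"
  assumes r: "r > 0" and R: "R > 0" and P: "P holomorphic_on ball 0 r" "P 0 = w0"
    and K: "continuous_on {0..1} K" "\<And>t. t \<in> {0..1} \<Longrightarrow> \<bar>K t\<bar> \<le> 1" and j: "j \<ge> 1"
    and a: "a holomorphic_on ball 0 r" and f: "f holomorphic_on S" "open S" "cball w0 R \<subseteq> S"
  obtains s W where "0 < s" "s \<le> r" "W holomorphic_on ball 0 s"
    "\<And>I V x. \<lbrakk>\<And>x. x \<in> I \<Longrightarrow> \<bar>x\<bar> < s; \<And>x t. x \<in> I \<Longrightarrow> 0 \<le> t \<Longrightarrow> t \<le> 1 \<Longrightarrow> t * x \<in> I; \<And>x. x \<in> I \<Longrightarrow> V x \<in> cball w0 R;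
       \<And>x. x \<in> I \<Longrightarrow> \<exists>J. ((\<lambda>t. of_real (K t) * (a (of_real t * of_real x) * f (V (t * x)))) has_integral J) {0..1} \<and> V x = P (of_real x) + (of_real x) ^ j * J;
       x \<in> I\<rbrakk> \<Longrightarrow> V x = W (of_real x)"
proof -
  obtain B where B: "B > 0" "\<And>w. w \<in> cball w0 R \<Longrightarrow> norm (f w) \<le> B"
    "\<And>w w'. w \<in> cball w0 R \<Longrightarrow> w' \<in> cball w0 R \<Longrightarrow> norm (f w - f w') \<le> B * norm (w - w')"
    using holomorphic_bound_Lipschitz[OF f] by metis
  have sub: "cball 0 (r / 2) \<subseteq> ball (0::complex) r" using r by auto
  obtain A where A: "A > 0" "\<And>w. w \<in> cball 0 (r / 2) \<Longrightarrow> norm (a w) \<le> A"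
    using holomorphic_bound_Lipschitz[OF a open_ball sub] by metis
  show thesis
  proof (rule holomorphic_fixed_point[of "r / 2" R P w0 K j "\<lambda>x w. a x * f w" "A * B" "A * B"])
    show "r / 2 > 0" "R > 0" "P 0 = w0" "continuous_on {0..1} K" "j \<ge> 1" using r R P K j by auto
    show "\<bar>K t\<bar> \<le> 1" if "t \<in> {0..1}" for t using K(2)[OF that] .
    show "P holomorphic_on ball 0 (r / 2)" by (rule holomorphic_on_subset[OF P(1)]) (use r in auto)
    show "(\<lambda>x. a x * f (W x)) holomorphic_on ball 0 s"
      if s: "0 < s" "s \<le> r / 2" "W holomorphic_on ball 0 s" "\<And>x. x \<in> ball 0 s \<Longrightarrow> W x \<in> cball w0 R" for s W
    proof (rule holomorphic_on_mult)
      show "a holomorphic_on ball 0 s" by (rule holomorphic_on_subset[OF a]) (use s r in auto)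
      show "(\<lambda>x. f (W x)) holomorphic_on ball 0 s"
      proof -
        have "W ` ball 0 s \<subseteq> S" using s(4) f(3) by blast
        from holomorphic_on_compose_gen[OF s(3) f(1) this] show ?thesis by (simp add: o_def)
      qed
    qed
    show "norm (a x * f w) \<le> A * B" if "x \<in> ball 0 (r / 2)" "w \<in> cball w0 R" for x w
      using A B(1) B(2)[OF that(2)] that by (auto simp: norm_mult intro!: mult_mono)
    show "norm (a x * f w - a x * f w') \<le> A * B * norm (w - w')"
      if x: "x \<in> ball 0 (r / 2)" and w: "w \<in> cball w0 R" "w' \<in> cball w0 R" for x w w'
    proof -
      have "norm (a x) * norm (f w - f w') \<le> A * (B * norm (w - w'))"
        using A(1) A(2)[of x] x B(3)[OF w] by (intro mult_mono) auto
      then show ?thesis by (simp add: norm_mult flip: right_diff_distrib)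
    qed
  next
    fix s W
    assume *: "0 < s" "s \<le> r / 2" "W holomorphic_on ball 0 s"
      and **: "\<And>I V x. \<lbrakk>\<And>x. x \<in> I \<Longrightarrow> \<bar>x\<bar> < s; \<And>x t. x \<in> I \<Longrightarrow> 0 \<le> t \<Longrightarrow> t \<le> 1 \<Longrightarrow> t * x \<in> I; \<And>x. x \<in> I \<Longrightarrow> V x \<in> cball w0 R;
       \<And>x. x \<in> I \<Longrightarrow> \<exists>J. ((\<lambda>t. of_real (K t) * (a (of_real t * of_real x) * f (V (t * x)))) has_integral J) {0..1} \<and> V x = P (of_real x) + (of_real x) ^ j * J;
       x \<in> I\<rbrakk> \<Longrightarrow> V x = W (of_real x)"
    have "s \<le> r" using * r by simp
    with * show thesis by (intro that[of s W]) (assumption | rule **)+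
  qed
qed


text \<open>Second derivatives are assumed only in the open interval, because at the light cone only
  the first derivative is known to extend continuously to the endpoint. General range, since it is
  applied to real and to complex functions.\<close>

lemma taylor_integral_remainder:
  fixes \<phi> \<phi>1 \<phi>2 :: "real \<Rightarrow> 'a::real_normed_vector"
  assumes "continuous_on {0..1} \<phi>" "continuous_on {0..1} \<phi>1"
    and d: "\<And>t. 0 < t \<Longrightarrow> t < 1 \<Longrightarrow> (\<phi> has_vector_derivative \<phi>1 t) (at t)"
    "\<And>t. 0 < t \<Longrightarrow> t < 1 \<Longrightarrow> (\<phi>1 has_vector_derivative \<phi>2 t) (at t)"
  shows "((\<lambda>t. (1 - t) *\<^sub>R \<phi>2 t) has_integral (\<phi> 1 - \<phi> 0 - \<phi>1 0)) {0..1}"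
proof -
  have "((\<lambda>t. (1 - t) *\<^sub>R \<phi>2 t) has_integral (((1 - 1) *\<^sub>R \<phi>1 1 + \<phi> 1) - ((1 - 0) *\<^sub>R \<phi>1 0 + \<phi> 0))) {0..1}"
  proof (rule fundamental_theorem_of_calculus_interior)
    show "continuous_on {0..1} (\<lambda>t. (1 - t) *\<^sub>R \<phi>1 t + \<phi> t)" by (intro continuous_intros assms)
    fix t :: real assume t: "t \<in> {0<..<1}"
    have "((\<lambda>t. (1 - t) *\<^sub>R \<phi>1 t + \<phi> t) has_vector_derivative ((1 - t) *\<^sub>R \<phi>2 t + (- 1) *\<^sub>R \<phi>1 t) + \<phi>1 t) (at t)"
      by (intro has_vector_derivative_add has_vector_derivative_scaleR d) (use t in \<open>auto intro!: derivative_eq_intros\<close>)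
    then show "((\<lambda>t. (1 - t) *\<^sub>R \<phi>1 t + \<phi> t) has_vector_derivative (1 - t) *\<^sub>R \<phi>2 t) (at t)" by simp
  qed simp
  then show ?thesis by (simp add: algebra_simps)
qed

context supercritical
begin

section \<open>Analyticity at the centre and at regular points\<close>

definition fc :: "complex \<Rightarrow> complex"
  where "fc w = of_real c * w - w powr of_real p"

lemma fc_of_real: "w \<ge> 0 \<Longrightarrow> fc (of_real w) = of_real (c * w - w powr p)"
  unfolding fc_def by (subst powr_of_real) simp_all

lemma holomorphic_fc: "fc holomorphic_on {w. Re w > 0}"
  unfolding fc_def[abs_def]
  by (intro holomorphic_intros) (auto simp: complex_nonpos_Reals_iff)

lemma open_Re_pos: "open {w. Re w > 0}" using open_halfspace_Re_gt[of 0] by simp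

lemma cball_Re_pos: "0 < R \<Longrightarrow> R < x \<Longrightarrow> cball (of_real x :: complex) R \<subseteq> {w. Re w > 0}"
proof (rule subsetI)
  fix w :: complex assume R: "0 < R" "R < x" and "w \<in> cball (of_real x) R"
  then have "\<bar>Re (of_real x - w)\<bar> \<le> R" using abs_Re_le_cmod[of "of_real x - w"] by (simp add: dist_norm)
  with R show "w \<in> {w. Re w > 0}" by auto
qed

text \<open>The Volterra equation is already of fixed point form, with \<open>P = 1\<close> and
  \<open>j = 2\<close>. Its real solution is known for \<open>y \<ge> 0\<close>, so uniqueness is
  applied on a half-open interval; the radius 1/2 around 1 stays in the right half-plane, where the
  complex power is holomorphic.\<close>

lemma analytic_center:
  assumes \<eta>: "0 < \<eta>" "\<eta> \<le> 1" "\<eta>\<^sup>2 * c < 1"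
  obtains s W where "0 < s" "W holomorphic_on ball 0 s"
    "\<And>y. 0 \<le> y \<Longrightarrow> y < s \<Longrightarrow> W (of_real y) = of_real (U (\<eta>, y))"
proof -
  define a :: "complex \<Rightarrow> complex" where "a = (\<lambda>x. 1 / (1 - (of_real \<eta> * x)\<^sup>2))"
  define f :: "complex \<Rightarrow> complex" where "f = (\<lambda>w. of_real (\<eta>\<^sup>2 * c) * w - w powr of_real p)"
  have a: "a holomorphic_on ball 0 1"
    unfolding a_def
  proof (intro holomorphic_intros)
    fix x :: complex assume x: "x \<in> ball 0 1"
    have "norm (of_real \<eta> * x) < 1" using x \<eta> mult_left_le_one_le[of "norm x" \<eta>] by (simp add: norm_mult)
    then have "norm ((of_real \<eta> * x)\<^sup>2) < 1" by (simp add: norm_power power_less_one_iff)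
    then show "1 - (of_real \<eta> * x)\<^sup>2 \<noteq> 0" by auto
  qed
  have f: "f holomorphic_on {w. Re w > 0}"
    unfolding f_def by (intro holomorphic_intros) (auto simp: complex_nonpos_Reals_iff)
  have Kc: "continuous_on {0..1} K" unfolding K_def[abs_def] using k_ge by (intro continuous_intros) auto
  have K: "\<bar>K t\<bar> \<le> 1" if "t \<in> {0..1}" for t
  proof -
    have "t * (1 - t) \<le> 1 * 1" using that by (intro mult_mono) auto
    then show "\<bar>K t\<bar> \<le> 1" using K_bounds[of t] that by auto
  qed
  obtain s W where s: "0 < s" "s \<le> 1" and W: "W holomorphic_on ball 0 s"
    and uniq: "\<And>I V x. \<lbrakk>\<And>x. x \<in> I \<Longrightarrow> \<bar>x\<bar> < s; \<And>x t. x \<in> I \<Longrightarrow> 0 \<le> t \<Longrightarrow> t \<le> 1 \<Longrightarrow> t * x \<in> I; \<And>x. x \<in> I \<Longrightarrow> V x \<in> cball 1 (1 / 2);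
       \<And>x. x \<in> I \<Longrightarrow> \<exists>J. ((\<lambda>t. of_real (K t) * (a (of_real t * of_real x) * f (V (t * x)))) has_integral J) {0..1} \<and> V x = 1 + (of_real x)\<^sup>2 * J;
       x \<in> I\<rbrakk> \<Longrightarrow> V x = W (of_real x)"
  proof (rule product_fixed_point[of 1 "1 / 2" "\<lambda>_. 1" 1 K 2 a f "{w. Re w > 0}"], goal_cases)
    case (12 s W)
    show ?case by (rule that[of s W]) (fact 12)+
  qed (use a f Kc K open_Re_pos cball_Re_pos[of "1/2" 1] in auto)
  have "continuous_on {0..1} (\<lambda>y. U (\<eta>, y))"
    by (rule continuous_on_subset[OF continuous_on_U_slice]) (use \<eta> in \<open>auto intro: mult_le_one\<close>)
  then obtain s1 where s1: "s1 > 0" "\<And>y. y \<in> {0..1} \<Longrightarrow> dist y 0 < s1 \<Longrightarrow> dist (U (\<eta>, y)) (U (\<eta>, 0)) < 1 / 2"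
    unfolding continuous_on_iff by (metis atLeastAtMost_iff half_gt_zero_iff order_refl zero_le_one zero_less_one)
  define s' where "s' = min s s1"
  have s': "0 < s'" "s' \<le> s" "s' \<le> s1" using s s1 by (auto simp: s'_def)
  have Ub: "0 \<le> U (\<eta>, y) \<and> U (\<eta>, y) \<le> 1" if "0 \<le> y" "y < 1" for y
  proof (cases "y = 0")
    case False
    have "\<eta> * y < 1" using that \<eta> mult_left_le_one_le[of y \<eta>] by simp
    with False that show ?thesis using U_bounds[of \<eta> y] \<eta> by auto
  qed (use U_0 \<eta> in auto)
  show thesis
  proof (rule that[OF s'(1)])
    show "W holomorphic_on ball 0 s'" by (rule holomorphic_on_subset[OF W]) (use s' in auto)
    fix y assume y: "0 \<le> y" "y < s'"
    have "of_real (U (\<eta>, y)) = W (of_real y)"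
    proof (rule uniq[where I = "{0..<s'}" and V = "\<lambda>y. of_real (U (\<eta>, y))"])
      fix x assume x: "x \<in> {0..<s'}"
      then have x1: "x < 1" "0 \<le> x" using s s' by auto
      show "\<bar>x\<bar> < s" using x s' by auto
      show "t * x \<in> {0..<s'}" if "0 \<le> t" "t \<le> 1" for t
        using x that mult_left_le_one_le[of x t] by auto
      show "of_real (U (\<eta>, x)) \<in> cball (1::complex) (1 / 2)"
      proof -
        have "\<bar>U (\<eta>, x) - 1\<bar> \<le> 1 / 2" using s1(2)[of x] x s' x1 U_0 \<eta> by (simp add: dist_real_def)
        then have "norm (of_real (U (\<eta>, x) - 1) :: complex) \<le> 1 / 2" by (simp only: norm_of_real)
        then show ?thesis by (simp add: dist_norm norm_minus_commute)
      qed
      have X: "(\<eta>, x) \<in> X" using \<eta> x1 by (auto simp: X_def intro: mult_le_one)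
      have int: "((\<lambda>t. complex_of_real (integrand U (\<eta>, x) t)) has_integral of_real (integral {0..1} (integrand U (\<eta>, x)))) {0..1}"
        using integrable_integral[OF integrand_integrable[OF continuous_on_U X]] by (rule has_integral_of_real)
      have eq: "complex_of_real (integrand U (\<eta>, x) t) = of_real (K t) * (a (of_real t * of_real x) * f (of_real (U (\<eta>, t * x))))" if t: "t \<in> {0..1}" for t
      proof -
        have tx: "0 \<le> t * x" "t * x < 1" using x1 t mult_left_le_one_le[of x t] by auto
        have "clamp (U (\<eta>, t * x)) = U (\<eta>, t * x)" using Ub[OF tx] by (simp add: clamp_def)
        moreover have "f (of_real (U (\<eta>, t * x))) = of_real (nl \<eta> (U (\<eta>, t * x)))"
          using Ub[OF tx] by (simp add: f_def nl_def powr_of_real)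
        moreover have "a (of_real t * of_real x) = of_real (1 / (1 - (\<eta> * x)\<^sup>2 * t\<^sup>2))"
          by (simp add: a_def power_mult_distrib mult_ac)
        ultimately show ?thesis by (simp add: integrand_def)
      qed
      have "((\<lambda>t. of_real (K t) * (a (of_real t * of_real x) * f (of_real (U (\<eta>, t * x))))) has_integral of_real (integral {0..1} (integrand U (\<eta>, x)))) {0..1}"
        by (rule has_integral_eq[OF _ int]) (rule eq)
      moreover have "complex_of_real (U (\<eta>, x)) = 1 + (of_real x)\<^sup>2 * of_real (integral {0..1} (integrand U (\<eta>, x)))"
        using volterra_U[OF X] by (simp add: volterra_def flip: of_real_power of_real_mult) (metis of_real_1 of_real_add)
      ultimately show "\<exists>J. ((\<lambda>t. of_real (K t) * (a (of_real t * of_real x) * f (of_real (U (\<eta>, t * x))))) has_integral J) {0..1}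
          \<and> complex_of_real (U (\<eta>, x)) = 1 + (of_real x)\<^sup>2 * J" by blast
    qed (use y in auto)
    then show "W (of_real y) = of_real (U (\<eta>, y))" by simp
  qed
qed

text \<open>Taylor's formula with integral remainder converts the initial value problem at
  \<open>z0\<close> into a fixed point equation with kernel \<open>1 - t\<close> and affine
  \<open>P\<close>.\<close>

lemma analytic_regular:
  fixes V dV :: "real \<Rightarrow> real"
  assumes z0: "z0 > 1" and V: "\<And>z. z > 1 \<Longrightarrow> (V has_real_derivative dV z) (at z)"
    and dV: "\<And>z. z > 1 \<Longrightarrow> (dV has_real_derivative (c * V z - V z powr p) / (z\<^sup>2 - 1)) (at z)"
    and pos: "\<And>z. z > 1 \<Longrightarrow> V z > 0"
  obtains s W where "0 < s" "s \<le> z0 - 1" "W holomorphic_on ball 0 s"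
    "\<And>x. \<bar>x\<bar> < s \<Longrightarrow> W (of_real x) = of_real (V (z0 + x))"
proof -
  define a :: "complex \<Rightarrow> complex" where "a = (\<lambda>x. 1 / ((of_real z0 + x)\<^sup>2 - 1))"
  define R where "R = V z0 / 2"
  have R: "R > 0" "R < V z0" using pos[OF z0] by (auto simp: R_def)
  define P :: "complex \<Rightarrow> complex" where "P = (\<lambda>x. of_real (V z0) + of_real (dV z0) * x)"
  have a: "a holomorphic_on ball 0 (z0 - 1)"
    unfolding a_def
  proof (intro holomorphic_intros)
    fix x :: complex assume x: "x \<in> ball 0 (z0 - 1)"
    have "Re x > - (z0 - 1)" using x abs_Re_le_cmod[of x] by auto
    moreover define q where "q = of_real z0 + x"
    ultimately have "Re q > 1" by simp
    then have "q \<noteq> 1" "q \<noteq> - 1" by auto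
    then show "(of_real z0 + x)\<^sup>2 - 1 \<noteq> 0" by (simp add: power2_eq_1_iff flip: q_def)
  qed
  have P: "P holomorphic_on ball 0 (z0 - 1)" unfolding P_def by (intro holomorphic_intros)
  obtain s W where s: "0 < s" "s \<le> z0 - 1" and W: "W holomorphic_on ball 0 s"
    and uniq: "\<And>I Y x. \<lbrakk>\<And>x. x \<in> I \<Longrightarrow> \<bar>x\<bar> < s; \<And>x t. x \<in> I \<Longrightarrow> 0 \<le> t \<Longrightarrow> t \<le> 1 \<Longrightarrow> t * x \<in> I; \<And>x. x \<in> I \<Longrightarrow> Y x \<in> cball (of_real (V z0)) R;
       \<And>x. x \<in> I \<Longrightarrow> \<exists>J. ((\<lambda>t. of_real (1 - t) * (a (of_real t * of_real x) * fc (Y (t * x)))) has_integral J) {0..1} \<and> Y x = P (of_real x) + (of_real x)\<^sup>2 * J;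
       x \<in> I\<rbrakk> \<Longrightarrow> Y x = W (of_real x)"
  proof (rule product_fixed_point[of "z0 - 1" R P "of_real (V z0)" "\<lambda>t. 1 - t" 2 a fc "{w. Re w > 0}"], goal_cases)
    case (12 s W)
    show ?case by (rule that[of s W]) (fact 12)+
  qed (use a P z0 R open_Re_pos holomorphic_fc cball_Re_pos[OF R] in \<open>auto simp: P_def intro!: continuous_intros\<close>)
  have "isCont V z0" using V[OF z0] by (rule DERIV_isCont)
  then obtain s1 where s1: "s1 > 0" "\<And>z. dist z z0 < s1 \<Longrightarrow> dist (V z) (V z0) < R"
    unfolding continuous_at_eps_delta using R(1) by blast
  define s' where "s' = min s s1"
  have s': "0 < s'" "s' \<le> s" "s' \<le> s1" using s s1 by (auto simp: s'_def)
  show thesis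
  proof (rule that[OF s'(1)])
    show "s' \<le> z0 - 1" using s s' by simp
    show "W holomorphic_on ball 0 s'" by (rule holomorphic_on_subset[OF W]) (use s' in auto)
    fix y assume y: "\<bar>y\<bar> < s'"
    have "of_real (V (z0 + y)) = W (of_real y)"
    proof (rule uniq[where I = "{x. \<bar>x\<bar> < s'}" and Y = "\<lambda>x. of_real (V (z0 + x))"])
      fix x assume "x \<in> {x. \<bar>x\<bar> < s'}"
      then have x: "\<bar>x\<bar> < s'" by simp
      show "\<bar>x\<bar> < s" using x s' by simp
      have tx: "\<bar>t * x\<bar> < s'" if "0 \<le> t" "t \<le> 1" for t
        using x that mult_left_le_one_le[of "\<bar>x\<bar>" t] by (simp add: abs_mult)
      then show "t * x \<in> {x. \<bar>x\<bar> < s'}" if "0 \<le> t" "t \<le> 1" for t using that by simp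
      have "\<bar>V (z0 + x) - V z0\<bar> < R" using s1(2)[of "z0 + x"] x s' by (simp add: dist_real_def)
      then have "norm (complex_of_real (V (z0 + x) - V z0)) < R" by (simp only: norm_of_real)
      then show "of_real (V (z0 + x)) \<in> cball (complex_of_real (V z0)) R"
        by (simp add: dist_norm norm_minus_commute)
      define \<phi>2 where "\<phi>2 = (\<lambda>t. x * x * ((c * V (z0 + t * x) - V (z0 + t * x) powr p) / ((z0 + t * x)\<^sup>2 - 1)))"
      have gt: "z0 + t * x > 1" if "0 \<le> t" "t \<le> 1" for t using tx[OF that] s s' by auto
      have d1: "((\<lambda>t. V (z0 + t * x)) has_real_derivative x * dV (z0 + t * x)) (at t)" if "0 \<le> t" "t \<le> 1" for t
      proof -
        have "((\<lambda>t. V (z0 + t * x)) has_real_derivative dV (z0 + t * x) * x) (at t)"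
          by (rule DERIV_chain2[where f = V and g = "\<lambda>t. z0 + t * x", OF V[OF gt[OF that]]]) (auto intro!: derivative_eq_intros)
        then show ?thesis by (simp add: mult.commute)
      qed
      have d2: "((\<lambda>t. x * dV (z0 + t * x)) has_real_derivative \<phi>2 t) (at t)" if "0 \<le> t" "t \<le> 1" for t
      proof -
        have "((\<lambda>t. dV (z0 + t * x)) has_real_derivative (c * V (z0 + t * x) - V (z0 + t * x) powr p) / ((z0 + t * x)\<^sup>2 - 1) * x) (at t)"
          by (rule DERIV_chain2[where f = dV and g = "\<lambda>t. z0 + t * x", OF dV[OF gt[OF that]]]) (auto intro!: derivative_eq_intros)
        from DERIV_cmult[OF this, of x] show ?thesis by (simp add: \<phi>2_def mult_ac)
      qed
      have "((\<lambda>t. (1 - t) *\<^sub>R \<phi>2 t) has_integral (V (z0 + 1 * x) - V (z0 + 0 * x) - x * dV (z0 + 0 * x))) {0..1}"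
      proof (rule taylor_integral_remainder[where \<phi> = "\<lambda>t. V (z0 + t * x)" and ?\<phi>1.0 = "\<lambda>t. x * dV (z0 + t * x)"])
        show "continuous_on {0..1} (\<lambda>t. V (z0 + t * x))" "continuous_on {0..1} (\<lambda>t. x * dV (z0 + t * x))"
          using d1 d2 by (auto intro!: continuous_at_imp_continuous_on DERIV_isCont)
      qed (use d1 d2 in \<open>auto simp: has_real_derivative_iff_has_vector_derivative\<close>)
      then have int: "((\<lambda>t. complex_of_real ((1 - t) * \<phi>2 t)) has_integral of_real (V (z0 + x) - V z0 - x * dV z0)) {0..1}"
        by (intro has_integral_of_real) simp
      show "\<exists>J. ((\<lambda>t. of_real (1 - t) * (a (of_real t * of_real x) * fc (of_real (V (z0 + t * x))))) has_integral J) {0..1}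
          \<and> complex_of_real (V (z0 + x)) = P (of_real x) + (of_real x)\<^sup>2 * J"
      \<comment> \<open>The value of \<open>J\<close> is found by dividing by \<open>x^2\<close>; at
        \<open>x = 0\<close> it drops out and only integrability counts.\<close>
      proof (cases "x = 0")
        case True
        have "(\<lambda>t. complex_of_real (1 - t) * (a 0 * fc (of_real (V z0)))) integrable_on {0..1}"
          by (intro integrable_continuous_real continuous_intros)
        then show ?thesis using True by (auto simp: P_def)
      next
        case False
        have "((\<lambda>t. complex_of_real ((1 - t) * \<phi>2 t) / (of_real x)\<^sup>2) has_integral of_real (V (z0 + x) - V z0 - x * dV z0) / (of_real x)\<^sup>2) {0..1}"
          by (rule has_integral_divide[OF int])
        then have "((\<lambda>t. of_real (1 - t) * (a (of_real t * of_real x) * fc (of_real (V (z0 + t * x))))) has_integral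
            of_real (V (z0 + x) - V z0 - x * dV z0) / (of_real x)\<^sup>2) {0..1}"
        proof (rule has_integral_eq[rotated])
          fix t :: real assume t: "t \<in> {0..1}"
          have "fc (of_real (V (z0 + t * x))) = of_real (c * V (z0 + t * x) - V (z0 + t * x) powr p)"
            using pos[OF gt] t by (intro fc_of_real) (auto simp: less_imp_le)
          moreover have "a (of_real t * of_real x) = of_real (1 / ((z0 + t * x)\<^sup>2 - 1))" by (simp add: a_def)
          moreover have "(1 - t) * \<phi>2 t / x\<^sup>2 = (1 - t) * (1 / ((z0 + t * x)\<^sup>2 - 1) * (c * V (z0 + t * x) - V (z0 + t * x) powr p))"
            using False by (simp add: \<phi>2_def power2_eq_square)
          then have "complex_of_real ((1 - t) * \<phi>2 t / x\<^sup>2) = of_real ((1 - t) * (1 / ((z0 + t * x)\<^sup>2 - 1) * (c * V (z0 + t * x) - V (z0 + t * x) powr p)))"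
            by (rule arg_cong)
          ultimately show "complex_of_real ((1 - t) * \<phi>2 t) / (of_real x)\<^sup>2 = of_real (1 - t) * (a (of_real t * of_real x) * fc (of_real (V (z0 + t * x))))"
            by (simp only: of_real_mult of_real_divide of_real_power)
        qed
        moreover have "complex_of_real (V (z0 + x)) = P (of_real x) + (of_real x)\<^sup>2 * (of_real (V (z0 + x) - V z0 - x * dV z0) / (of_real x)\<^sup>2)"
          using False by (simp add: P_def)
        ultimately show ?thesis by blast
      qed
    qed (use y in auto)
    then show "W (of_real y) = of_real (V (z0 + y))" by simp
  qed
qed

end

section \<open>Regularity at the light cone\<close>

text \<open>Integrates the bound \<open>k / sqrt x\<close>. It is applied twice near the cone: to
  \<open>V\<close>, whose slope is bounded this way by the energy, and then to the slope
  itself.\<close>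

lemma sqrt_Lipschitz:
  fixes g g' :: "real \<Rightarrow> real"
  assumes d: "\<And>x. 0 < x \<Longrightarrow> x < \<delta> \<Longrightarrow> (g has_real_derivative g' x) (at x)"
    and b: "\<And>x. 0 < x \<Longrightarrow> x < \<delta> \<Longrightarrow> \<bar>g' x\<bar> \<le> k / sqrt x"
    and xy: "0 < y" "y \<le> x" "x < \<delta>"
  shows "\<bar>g x - g y\<bar> \<le> 2 * k * (sqrt x - sqrt y)"
proof -
  have *: "\<sigma> * g x - 2 * k * sqrt x \<le> \<sigma> * g y - 2 * k * sqrt y" if \<sigma>: "\<sigma> = 1 \<or> \<sigma> = - 1" for \<sigma>
  proof (rule DERIV_nonpos_imp_nonincreasing[where f = "\<lambda>x. \<sigma> * g x - 2 * k * sqrt x", OF xy(2)])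
    fix z assume z: "y \<le> z" "z \<le> x"
    then have z': "0 < z" "z < \<delta>" using xy by auto
    have "((\<lambda>x. \<sigma> * g x - 2 * k * sqrt x) has_real_derivative \<sigma> * g' z - 2 * k * (inverse (sqrt z) / 2)) (at z)"
      using DERIV_diff[OF DERIV_cmult[OF d[OF z'], of \<sigma>] DERIV_cmult[OF DERIV_real_sqrt[OF z'(1)], of "2 * k"]] .
    moreover have "2 * k * (inverse (sqrt z) / 2) = k / sqrt z" by (simp add: inverse_eq_divide)
    moreover have "\<sigma> * g' z \<le> \<bar>g' z\<bar>" using \<sigma> by auto
    ultimately have "((\<lambda>x. \<sigma> * g x - 2 * k * sqrt x) has_real_derivative \<sigma> * g' z - k / sqrt z) (at z)"
      "\<sigma> * g' z - k / sqrt z \<le> 0" using b[OF z'] by auto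
    then show "\<exists>l. ((\<lambda>x. \<sigma> * g x - 2 * k * sqrt x) has_real_derivative l) (at z) \<and> l \<le> 0" by blast
  qed
  show ?thesis using *[of 1] *[of "- 1"] by (simp add: abs_le_iff algebra_simps)
qed

text \<open>The values near 0 lie in a compact interval; any subsequential limit works, since the
  oscillation on (0, x] is at most \<open>2 * k * sqrt x\<close>.\<close>

lemma sqrt_Lipschitz_limit:
  fixes g :: "real \<Rightarrow> real"
  assumes L: "\<And>x y. 0 < y \<Longrightarrow> y \<le> x \<Longrightarrow> x < \<delta> \<Longrightarrow> \<bar>g x - g y\<bar> \<le> 2 * k * (sqrt x - sqrt y)"
    and \<delta>: "\<delta> > 0" and k: "k \<ge> 0"
  obtains l where "\<And>x. 0 < x \<Longrightarrow> x < \<delta> \<Longrightarrow> \<bar>g x - l\<bar> \<le> 2 * k * sqrt x"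
proof -
  define x0 where "x0 = \<delta> / 2"
  define a where "a = (\<lambda>n. x0 / real (Suc n))"
  have x0: "0 < x0" "x0 < \<delta>" using \<delta> by (auto simp: x0_def)
  have a: "0 < a n" "a n \<le> x0" for n using x0 by (auto simp: a_def field_simps)
  have lim: "a \<longlonglongrightarrow> 0" unfolding a_def by (rule LIMSEQ_Suc) (rule lim_const_over_n)
  have weak: "\<bar>g x - g y\<bar> \<le> 2 * k * sqrt x" if "0 < y" "y \<le> x" "x < \<delta>" for x y
  proof -
    have "0 \<le> 2 * k * sqrt y" using k that by simp
    moreover have "2 * k * (sqrt x - sqrt y) = 2 * k * sqrt x - 2 * k * sqrt y" by (simp add: algebra_simps)
    ultimately show ?thesis using L[OF that] by linarith
  qed
  have "g (a n) \<in> {g x0 - 2 * k * sqrt x0..g x0 + 2 * k * sqrt x0}" for n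
    using weak[of "a n" x0] a[of n] x0 by auto
  then obtain l r where r: "strict_mono r" and l: "((\<lambda>n. g (a n)) \<circ> r) \<longlonglongrightarrow> l"
    using compact_Icc[of "g x0 - 2 * k * sqrt x0" "g x0 + 2 * k * sqrt x0"] unfolding compact_def by metis
  have ar: "(a \<circ> r) \<longlonglongrightarrow> 0" by (rule LIMSEQ_subseq_LIMSEQ[OF lim r])
  show thesis
  proof (rule that[of l])
    fix x assume x: "0 < x" "x < \<delta>"
    have "(\<lambda>n. \<bar>g x - ((\<lambda>n. g (a n)) \<circ> r) n\<bar>) \<longlonglongrightarrow> \<bar>g x - l\<bar>" by (intro tendsto_intros l)
    moreover have "\<forall>\<^sub>F n in sequentially. \<bar>g x - ((\<lambda>n. g (a n)) \<circ> r) n\<bar> \<le> 2 * k * sqrt x"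
      using order_tendstoD(2)[OF ar x(1)]
      by eventually_elim (use weak x a in auto)
    ultimately show "\<bar>g x - l\<bar> \<le> 2 * k * sqrt x" by (rule tendsto_upperbound) simp
  qed
qed

text \<open>Fills in the limit at \<open>t = 0\<close>, the singular end of the ray, so that
  Taylor's formula can start at the light cone.\<close>

lemma continuous_on_ray_extension:
  fixes g :: "real \<Rightarrow> real"
  assumes lim: "(g \<longlongrightarrow> l) (at_right 0)" and cont: "\<And>y. 0 < y \<Longrightarrow> y \<le> x \<Longrightarrow> isCont g y" and x: "x > 0"
  shows "continuous_on {0..1} (\<lambda>t. if t = 0 then l else g (t * x))"
  unfolding continuous_on_eq_continuous_within
proof
  fix t :: real assume t: "t \<in> {0..1}"
  show "continuous (at t within {0..1}) (\<lambda>t. if t = 0 then l else g (t * x))"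
  proof (cases "t = 0")
    case True
    have "filterlim (\<lambda>t. t * x) (at_right 0) (at 0 within {0..1})"
      unfolding filterlim_at
    proof
      show "\<forall>\<^sub>F t in at 0 within {0..1}. t * x \<in> {0<..} \<and> t * x \<noteq> 0"
        using x by (auto simp: eventually_at_filter)
    qed (auto intro!: tendsto_eq_intros)
    then have "((\<lambda>t. g (t * x)) \<longlongrightarrow> l) (at 0 within {0..1})" by (rule filterlim_compose[OF lim])
    then have "((\<lambda>t. if t = 0 then l else g (t * x)) \<longlongrightarrow> l) (at 0 within {0..1})"
      by (rule Lim_transform_eventually) (auto simp: eventually_at_filter)
    then show ?thesis using True by (simp add: continuous_within)
  next
    case False
    have "isCont g (t * x)" using t x False mult_left_le_one_le[of x t] by (intro cont) auto
    then have "isCont (\<lambda>t. g (t * x)) t" by (rule isCont_o2[rotated]) (intro continuous_intros)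
    moreover have "\<forall>\<^sub>F t in nhds t. g (t * x) = (if t = 0 then l else g (t * x))"
      using t1_space_nhds[OF False] by eventually_elim simp
    ultimately have "isCont (\<lambda>t. if t = 0 then l else g (t * x)) t" using isCont_cong by fast
    then show ?thesis by (rule continuous_at_imp_continuous_within)
  qed
qed

lemma DERIV_shift_add:
  fixes f :: "real \<Rightarrow> real"
  shows "(f has_real_derivative D) (at (1 + x)) \<Longrightarrow> ((\<lambda>x. f (1 + x)) has_real_derivative D) (at x)"
  using DERIV_shift[of f D x 1] by (simp add: add.commute)

lemma DERIV_Re_of_real:
  "(f has_field_derivative f') (at (of_real x)) \<Longrightarrow> ((\<lambda>x. Re (f (of_real x))) has_real_derivative Re f') (at x)"
  using has_vector_derivative_real_field[of f f' x UNIV] bounded_linear.has_vector_derivative[OF bounded_linear_Re]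
  by (simp add: has_real_derivative_iff_has_vector_derivative)

context supercritical
begin

lemma at_light_cone_coordinate:
  assumes "\<And>z. z > 1 \<Longrightarrow> (dV has_real_derivative (c * V z - V z powr p) / (z\<^sup>2 - 1)) (at z)" "x > 0"
  shows "((\<lambda>x. dV (1 + x)) has_real_derivative (c * V (1 + x) - V (1 + x) powr p) / (x * (2 + x))) (at x)"
proof -
  have "(1 + x)\<^sup>2 - 1 = x * (2 + x)" by (simp add: power2_eq_square algebra_simps)
  then show ?thesis using DERIV_shift_add[OF assms(1), of x] assms(2) by simp
qed

text \<open>A bootstrap that hinges on the limit \<open>b\<close>. The hypothesis
  \<open>bound\<close> gives a slope of order \<open>1 / sqrt x\<close>, hence \<open>V - b\<close>
  of order \<open>sqrt x\<close>. The right-hand side is proportional to \<open>V - b\<close>, so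
  the second derivative is again of order \<open>1 / sqrt x\<close> instead of \<open>1 / x\<close>,
  and the slope converges with rate \<open>sqrt x\<close>.\<close>

lemma slope_at_light_cone:
  fixes V dV :: "real \<Rightarrow> real"
  assumes V: "\<And>z. z > 1 \<Longrightarrow> (V has_real_derivative dV z) (at z)"
    and dV: "\<And>z. z > 1 \<Longrightarrow> (dV has_real_derivative (c * V z - V z powr p) / (z\<^sup>2 - 1)) (at z)"
    and lim: "(V \<longlongrightarrow> b) (at_right 1)"
    and bound: "\<And>z. z > 1 \<Longrightarrow> z < 2 \<Longrightarrow> (z - 1) * (dV z)\<^sup>2 \<le> C"
  obtains \<delta> M w0 where "0 < \<delta>" "\<delta> \<le> 1" "M \<ge> 0"
    "\<And>x. 0 < x \<Longrightarrow> x < \<delta> \<Longrightarrow> \<bar>dV (1 + x) - w0\<bar> \<le> M * sqrt x"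
    "\<And>x. 0 < x \<Longrightarrow> x < \<delta> \<Longrightarrow> \<bar>V (1 + x) - b - x * w0\<bar> \<le> M * x * sqrt x"
proof -
  have V1: "((\<lambda>x. V (1 + x)) has_real_derivative dV (1 + x)) (at x)" if "x > 0" for x
    using DERIV_shift_add[OF V, of x] that by simp
  have dV1: "((\<lambda>x. dV (1 + x)) has_real_derivative (c * V (1 + x) - V (1 + x) powr p) / (x * (2 + x))) (at x)" if "x > 0" for x
    using at_light_cone_coordinate[OF dV, of x] that by simp
  have lim0: "((\<lambda>x. V (1 + x)) \<longlongrightarrow> b) (at_right 0)"
    using lim unfolding filterlim_at_right_to_0[of V _ 1] by (simp add: add.commute)
  define M where "M = sqrt \<bar>C\<bar>"
  have M: "M \<ge> 0" by (simp add: M_def)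
  have 1: "\<bar>dV (1 + x)\<bar> \<le> M / sqrt x" if x: "0 < x" "x < 1" for x
  proof -
    have "(\<bar>dV (1 + x)\<bar> * sqrt x)\<^sup>2 \<le> \<bar>C\<bar>"
      using bound[of "1 + x"] x by (simp add: power_mult_distrib mult.commute)
    then have "\<bar>dV (1 + x)\<bar> * sqrt x \<le> M" unfolding M_def by (rule real_le_rsqrt)
    then show ?thesis using x by (simp add: pos_le_divide_eq)
  qed
  have 2: "\<bar>V (1 + x) - b\<bar> \<le> 2 * M * sqrt x" if x: "0 < x" "x < 1" for x
  proof -
    have "((\<lambda>y. \<bar>V (1 + x) - V (1 + y)\<bar>) \<longlongrightarrow> \<bar>V (1 + x) - b\<bar>) (at_right 0)" by (intro tendsto_intros lim0)
    moreover have "\<forall>\<^sub>F y in at_right 0. \<bar>V (1 + x) - V (1 + y)\<bar> \<le> 2 * M * sqrt x"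
    proof -
      have "\<forall>\<^sub>F y in at_right 0. 0 < y \<and> y < x" using x by (auto simp: eventually_at_right_field)
      then show ?thesis
      proof eventually_elim
        case (elim y)
        have "\<bar>V (1 + x) - V (1 + y)\<bar> \<le> 2 * M * (sqrt x - sqrt y)"
          by (rule sqrt_Lipschitz[where \<delta> = 1 and g = "\<lambda>x. V (1 + x)"]) (use elim x V1 1 in auto)
        moreover have "0 \<le> 2 * M * sqrt y" using M elim by simp
        moreover have "2 * M * (sqrt x - sqrt y) = 2 * M * sqrt x - 2 * M * sqrt y" by (simp add: algebra_simps)
        ultimately show ?case by linarith
      qed
    qed
    ultimately show ?thesis by (rule tendsto_upperbound) simp
  qed
  have "(secant \<longlongrightarrow> secant b) (nhds b)"
    using isCont_secant[OF b_pos] by (simp only: isCont_def tendsto_at_iff_tendsto_nhds)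
  from order_tendstoD(2)[OF tendsto_rabs[OF this], of "\<bar>secant b\<bar> + 1"]
  have "\<forall>\<^sub>F w in nhds b. \<bar>secant w\<bar> < \<bar>secant b\<bar> + 1" by simp
  then have "\<forall>\<^sub>F x in at_right 0. \<bar>secant (V (1 + x))\<bar> < \<bar>secant b\<bar> + 1"
    using lim0 by (rule eventually_compose_filterlim)
  then obtain \<delta>0 where \<delta>0: "\<delta>0 > 0" "\<And>x. 0 < x \<Longrightarrow> x < \<delta>0 \<Longrightarrow> \<bar>secant (V (1 + x))\<bar> < \<bar>secant b\<bar> + 1"
    unfolding eventually_at_right_field by auto
  define \<delta> where "\<delta> = min \<delta>0 1"
  have \<delta>: "0 < \<delta>" "\<delta> \<le> 1" "\<delta> \<le> \<delta>0" using \<delta>0 by (auto simp: \<delta>_def)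
  define M2 where "M2 = (\<bar>secant b\<bar> + 1) * M"
  have M2: "M2 \<ge> 0" using M by (simp add: M2_def)
  have 3: "\<bar>(c * V (1 + x) - V (1 + x) powr p) / (x * (2 + x))\<bar> \<le> M2 / sqrt x" if x: "0 < x" "x < \<delta>" for x
  proof -
    have "\<bar>c * V (1 + x) - V (1 + x) powr p\<bar> = \<bar>secant (V (1 + x))\<bar> * \<bar>V (1 + x) - b\<bar>"
      using secant_eq[of "V (1 + x)"] by (metis abs_minus_commute abs_mult)
    also have "\<dots> \<le> (\<bar>secant b\<bar> + 1) * (2 * M * sqrt x)"
      using \<delta>0(2)[of x] 2[of x] x \<delta> by (intro mult_mono) auto
    finally have "\<bar>c * V (1 + x) - V (1 + x) powr p\<bar> / (x * (2 + x)) \<le> (\<bar>secant b\<bar> + 1) * (2 * M * sqrt x) / (x * 2)"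
      using x M by (intro frac_le mult_left_mono) auto
    also have "\<dots> = M2 * (sqrt x / x)" by (simp add: M2_def)
    also have "sqrt x / x = 1 / sqrt x" using x by (simp add: field_simps)
    finally show ?thesis using x by (simp add: abs_divide abs_mult)
  qed
  obtain w0 where w0: "\<And>x. 0 < x \<Longrightarrow> x < \<delta> \<Longrightarrow> \<bar>dV (1 + x) - w0\<bar> \<le> 2 * M2 * sqrt x"
  proof (rule sqrt_Lipschitz_limit[where g = "\<lambda>x. dV (1 + x)" and \<delta> = \<delta> and k = M2])
    show "\<bar>dV (1 + x) - dV (1 + y)\<bar> \<le> 2 * M2 * (sqrt x - sqrt y)" if "0 < y" "y \<le> x" "x < \<delta>" for x y
      by (rule sqrt_Lipschitz[where \<delta> = \<delta> and g = "\<lambda>x. dV (1 + x)"]) (use that dV1 3 in auto)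
  qed (use \<delta> M2 in auto)
  have "\<bar>V (1 + x) - b - x * w0\<bar> \<le> 2 * M2 * x * sqrt x" if x: "0 < x" "x < \<delta>" for x
  proof -
    have "((\<lambda>y. \<bar>V (1 + x) - V (1 + y) - (x - y) * w0\<bar>) \<longlongrightarrow> \<bar>V (1 + x) - b - (x - 0) * w0\<bar>) (at_right 0)"
      by (intro tendsto_intros lim0)
    moreover have "\<forall>\<^sub>F y in at_right 0. \<bar>V (1 + x) - V (1 + y) - (x - y) * w0\<bar> \<le> 2 * M2 * x * sqrt x"
    proof -
      have "\<forall>\<^sub>F y in at_right 0. 0 < y \<and> y < x" using x by (auto simp: eventually_at_right_field)
      then show ?thesis
      proof eventually_elim
        case (elim y)
        have "\<exists>z. y < z \<and> z < x \<and> V (1 + x) - V (1 + y) = (x - y) * dV (1 + z)"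
          by (rule MVT2[where f = "\<lambda>x. V (1 + x)"]) (use elim V1 in auto)
        then obtain z where z: "y < z" "z < x" "V (1 + x) - V (1 + y) = (x - y) * dV (1 + z)" by blast
        have "\<bar>V (1 + x) - V (1 + y) - (x - y) * w0\<bar> = (x - y) * \<bar>dV (1 + z) - w0\<bar>"
          using z elim by (simp add: abs_mult flip: right_diff_distrib)
        also have "\<dots> \<le> x * (2 * M2 * sqrt x)"
        proof (rule mult_mono)
          have "\<bar>dV (1 + z) - w0\<bar> \<le> 2 * M2 * sqrt z" using z elim x by (intro w0) auto
          also have "\<dots> \<le> 2 * M2 * sqrt x" using z M2 by (intro mult_left_mono) auto
          finally show "\<bar>dV (1 + z) - w0\<bar> \<le> 2 * M2 * sqrt x" .
        qed (use elim in auto)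
        finally show ?case by (simp add: mult_ac)
      qed
    qed
    ultimately have "\<bar>V (1 + x) - b - (x - 0) * w0\<bar> \<le> 2 * M2 * x * sqrt x" by (rule tendsto_upperbound) simp
    then show ?thesis by simp
  qed
  with w0 \<delta> M2 show thesis by (intro that[of \<delta> "2 * M2" w0]) auto
qed

section \<open>The singular equation among holomorphic functions\<close>

text \<open>The complex counterpart of \<open>- secant\<close> in the variable
  \<open>y = w - b\<close>, with the removable singularity filled by the derivative of
  \<open>fc\<close> at \<open>b\<close>.\<close>

definition fc1 :: "complex \<Rightarrow> complex"
  where "fc1 y = (if y = 0 then of_real (c - p * c) else fc (of_real b + y) / y)"

lemma fc_b: "fc (of_real b) = 0"
  using fc_of_real[of b] b_pos b_powr_p by simp

lemma fc1_mult: "y * fc1 y = fc (of_real b + y)"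
  using fc_b by (simp add: fc1_def)

lemma ball_b_Re_pos: "y \<in> ball 0 b \<Longrightarrow> Re (of_real b + y) > 0"
  using abs_Re_le_cmod[of y] by auto

lemma holomorphic_fc1: "fc1 holomorphic_on ball 0 b"
proof -
  define g where "g = (\<lambda>y. fc (of_real b + y))"
  have g: "g holomorphic_on ball 0 b"
  proof -
    have im: "(\<lambda>y. of_real b + y) ` ball 0 b \<subseteq> {w. Re w > 0}"
      by (intro image_subsetI CollectI ball_b_Re_pos)
    have "(\<lambda>y. of_real b + y) holomorphic_on ball 0 b" by (intro holomorphic_intros)
    from holomorphic_on_compose_gen[OF this holomorphic_fc im] show ?thesis by (simp add: g_def o_def)
  qed
  have bR: "complex_of_real b \<notin> \<real>\<^sub>\<le>\<^sub>0" using b_pos by (simp add: complex_nonpos_Reals_iff)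
  have "((\<lambda>w. w powr of_real p) has_field_derivative of_real p * of_real b powr (of_real p - 1)) (at (complex_of_real b))"
    by (rule has_field_derivative_powr[OF bR])
  moreover have "complex_of_real b powr (of_real p - 1) = of_real c"
    using powr_of_real[of b "p - 1"] b_pos b_powr by simp
  ultimately have "(fc has_field_derivative of_real c - of_real p * of_real c) (at (complex_of_real b + 0))"
    unfolding fc_def[abs_def] by (auto intro!: DERIV_diff DERIV_cmult_Id)
  then have "(g has_field_derivative (of_real c - of_real p * of_real c) * 1) (at 0)"
    unfolding g_def by (rule DERIV_chain2) (auto intro!: derivative_eq_intros)
  from DERIV_imp_deriv[OF this] have dg: "deriv g 0 = of_real (c - p * c)" by simp
  have "(\<lambda>z. if z = 0 then deriv g 0 else (g z - g 0) / (z - 0)) holomorphic_on ball 0 b"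
    by (rule pole_lemma[OF g]) (use b_pos in auto)
  also have "(\<lambda>z. if z = 0 then deriv g 0 else (g z - g 0) / (z - 0)) = fc1"
    unfolding dg by (auto simp: fun_eq_iff fc1_def g_def fc_b)
  finally show ?thesis .
qed

text \<open>Reflection symmetry is the way to see that the holomorphic solution is real on the real
  axis, including the side of the cone where no real solution is given beforehand.\<close>

lemma fc1_cnj: assumes "y \<in> ball 0 b" shows "fc1 (cnj y) = cnj (fc1 y)"
proof (cases "y = 0")
  case False
  have "cnj ((of_real b + y) powr of_real p) = cnj (of_real b + y) powr cnj (of_real p)"
    by (rule cnj_powr) (use ball_b_Re_pos[OF assms] in auto)
  then show ?thesis using False by (simp add: fc1_def fc_def)
qed (simp add: fc1_def)

end

text \<open>Exhibits the integral term as a second primitive, which allows the fixed point equation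
  to be differentiated back into the differential equation.\<close>

lemma holomorphic_double_primitive:
  assumes h: "h holomorphic_on ball 0 s" and s: "s > 0"
  obtains h1 h2 :: "complex \<Rightarrow> complex"
  where "\<And>x. x \<in> ball 0 s \<Longrightarrow> (h1 has_field_derivative h x) (at x)"
    "\<And>x. x \<in> ball 0 s \<Longrightarrow> (h2 has_field_derivative h1 x) (at x)"
    "\<And>x. x \<in> ball 0 s \<Longrightarrow> x\<^sup>2 * integral {0..1} (\<lambda>t. of_real (1 - t) * h (of_real t * x)) = h2 x"
proof -
  have prim: "\<exists>g. g 0 = 0 \<and> (\<forall>x\<in>ball 0 s. (g has_field_derivative f x) (at x))"
    if f: "f holomorphic_on ball 0 s" for f :: "complex \<Rightarrow> complex"
  proof -
    obtain g where g: "\<And>x. x \<in> ball 0 s \<Longrightarrow> (g has_field_derivative f x) (at x within ball 0 s)"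
      using holomorphic_convex_primitive'[OF convex_ball open_ball f] by blast
    have "((\<lambda>x. g x - g 0) has_field_derivative f x) (at x)" if x: "x \<in> ball 0 s" for x
      using DERIV_diff[OF g[OF x] DERIV_const[of "g 0"]] by (simp add: at_within_open[OF x])
    then show ?thesis by (intro exI[of _ "\<lambda>x. g x - g 0"]) simp
  qed
  obtain h1 where h1: "h1 0 = 0" "\<And>x. x \<in> ball 0 s \<Longrightarrow> (h1 has_field_derivative h x) (at x)"
    using prim[OF h] by blast
  have "h1 holomorphic_on ball 0 s" unfolding holomorphic_on_open[OF open_ball] using h1(2) by blast
  then obtain h2 where h2: "h2 0 = 0" "\<And>x. x \<in> ball 0 s \<Longrightarrow> (h2 has_field_derivative h1 x) (at x)"
    using prim by blast
  show thesis
  proof (rule that[OF h1(2) h2(2)])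
    fix x :: complex assume x: "x \<in> ball 0 s"
    have J: "((\<lambda>t. of_real (1 - t) * h (of_real t * x)) has_integral integral {0..1} (\<lambda>t. of_real (1 - t) * h (of_real t * x))) {0..1}"
      by (rule integrable_integral[OF ray_integrable[OF holomorphic_on_imp_continuous_on[OF h] _ x]]) (intro continuous_intros)
    have tx: "of_real t * x \<in> ball 0 s" if "0 \<le> t" "t \<le> 1" for t
      using ray_in_ball[OF x] that by simp
    have d: "((\<lambda>t. f (of_real t * x)) has_vector_derivative f' * x) (at t)"
      if "(f has_field_derivative f') (at (of_real t * x))" for f :: "complex \<Rightarrow> complex" and f' t
    proof -
      have "((\<lambda>y. f (y * x)) has_field_derivative f' * x) (at (of_real t))"
        by (rule DERIV_chain2[where f = f and g = "\<lambda>y. y * x", OF that]) (auto intro!: derivative_eq_intros)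
      then show ?thesis by (rule has_vector_derivative_real_field)
    qed
    have d1: "((\<lambda>t. h2 (of_real t * x)) has_vector_derivative x * h1 (of_real t * x)) (at t)"
      and d2: "((\<lambda>t. x * h1 (of_real t * x)) has_vector_derivative x\<^sup>2 * h (of_real t * x)) (at t)"
      if "0 \<le> t" "t \<le> 1" for t
    proof -
      show "((\<lambda>t. h2 (of_real t * x)) has_vector_derivative x * h1 (of_real t * x)) (at t)"
        using d[OF h2(2)[OF tx[OF that]]] by (simp add: mult.commute)
      have "((\<lambda>t. x * h1 (of_real t * x)) has_vector_derivative x * (h (of_real t * x) * x)) (at t)"
        by (intro has_vector_derivative_mult_right d h1(2) tx that)
      then show "((\<lambda>t. x * h1 (of_real t * x)) has_vector_derivative x\<^sup>2 * h (of_real t * x)) (at t)"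
        by (simp add: power2_eq_square mult_ac)
    qed
    have "((\<lambda>t. (1 - t) *\<^sub>R (x\<^sup>2 * h (of_real t * x))) has_integral (h2 (of_real 1 * x) - h2 (of_real 0 * x) - x * h1 (of_real 0 * x))) {0..1}"
      by (rule taylor_integral_remainder[where \<phi> = "\<lambda>t. h2 (of_real t * x)" and ?\<phi>1.0 = "\<lambda>t. x * h1 (of_real t * x)"])
        (use d1 d2 in \<open>auto intro!: continuous_at_imp_continuous_on has_vector_derivative_continuous\<close>)
    then have "((\<lambda>t. x\<^sup>2 * (of_real (1 - t) * h (of_real t * x))) has_integral h2 x) {0..1}"
      using h1(1) h2(1) by (simp add: scaleR_conv_of_real mult_ac)
    moreover have "((\<lambda>t. x\<^sup>2 * (of_real (1 - t) * h (of_real t * x))) has_integral x\<^sup>2 * integral {0..1} (\<lambda>t. of_real (1 - t) * h (of_real t * x))) {0..1}"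
      by (rule has_integral_mult_right[OF J])
    ultimately show "x\<^sup>2 * integral {0..1} (\<lambda>t. of_real (1 - t) * h (of_real t * x)) = h2 x" by (rule has_integral_unique[rotated])
  qed
qed

context supercritical
begin

text \<open>
  Writing \<open>V (1 + x) = b + x W x\<close> turns the singular equation at \<open>x = 0\<close> into a fixed point problem with
  holomorphic data, whose solutions are determined by \<open>W 0\<close>.
\<close>
lemma analytic_singular:
  fixes V dV :: "real \<Rightarrow> real"
  assumes V: "\<And>z. z > 1 \<Longrightarrow> (V has_real_derivative dV z) (at z)"
    and dV: "\<And>z. z > 1 \<Longrightarrow> (dV has_real_derivative (c * V z - V z powr p) / (z\<^sup>2 - 1)) (at z)"
    and pos: "\<And>z. z > 1 \<Longrightarrow> V z > 0"
    and lim: "(V \<longlongrightarrow> b) (at_right 1)"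
    and bound: "\<And>z. z > 1 \<Longrightarrow> z < 2 \<Longrightarrow> (z - 1) * (dV z)\<^sup>2 \<le> C"
  obtains s G Y dY d2Y where "0 < s" "s \<le> 1 / 2" "G holomorphic_on ball 0 s"
    "\<And>x. \<bar>x\<bar> < s \<Longrightarrow> G (of_real x) = of_real (Y x)"
    "\<And>x. 0 < x \<Longrightarrow> x < s \<Longrightarrow> Y x = V (1 + x)" "Y 0 = b"
    "\<And>x. \<bar>x\<bar> < s \<Longrightarrow> Y x > 0"
    "\<And>x. \<bar>x\<bar> < s \<Longrightarrow> (Y has_real_derivative dY x) (at x)"
    "\<And>x. \<bar>x\<bar> < s \<Longrightarrow> (dY has_real_derivative d2Y x) (at x)"
    "\<And>x. \<bar>x\<bar> < s \<Longrightarrow> x * (2 + x) * d2Y x = c * Y x - Y x powr p"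
proof -
  obtain \<delta> M w0 where \<delta>: "0 < \<delta>" "\<delta> \<le> 1" "M \<ge> 0"
    and slope: "\<And>x. 0 < x \<Longrightarrow> x < \<delta> \<Longrightarrow> \<bar>dV (1 + x) - w0\<bar> \<le> M * sqrt x"
    and offset: "\<And>x. 0 < x \<Longrightarrow> x < \<delta> \<Longrightarrow> \<bar>V (1 + x) - b - x * w0\<bar> \<le> M * x * sqrt x"
    using slope_at_light_cone[OF V dV lim bound] by metis
  define w where "w = complex_of_real w0"
  \<comment> \<open>\<open>Bw\<close> bounds the disc of radius 1 around \<open>w\<close>, and
    \<open>r * Bw \<le> b / 2\<close> keeps \<open>x * W x\<close> well inside the disc of radius
    \<open>b\<close> on which \<open>fc1\<close> is holomorphic.\<close>
  define Bw where "Bw = \<bar>w0\<bar> + 1"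
  have Bw: "Bw \<ge> 1" by (simp add: Bw_def)
  have Bw': "norm u \<le> Bw" if "u \<in> cball w 1" for u
    using that norm_triangle_ineq2[of u w] by (simp add: w_def Bw_def dist_norm norm_minus_commute)
  define r where "r = min (1 / 2) (b / 2 / Bw)"
  have r: "r > 0" "r \<le> 1 / 2" "r * Bw \<le> b / 2"
  proof -
    show "r > 0" "r \<le> 1 / 2" using b_pos Bw by (auto simp: r_def)
    have "r \<le> b / 2 / Bw" by (simp add: r_def)
    then show "r * Bw \<le> b / 2" using Bw by (simp add: pos_le_divide_eq)
  qed
  have small: "norm (x * u) \<le> b / 2" if "norm x < r" "u \<in> cball w 1" for x u
  proof -
    have "norm x * norm u \<le> r * Bw" using that Bw'[OF that(2)] r by (intro mult_mono) auto
    with r show ?thesis by (simp add: norm_mult)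
  qed
  have sub: "cball 0 (b / 2) \<subseteq> ball (0::complex) b" using b_pos by auto
  obtain B where B: "B > 0" "\<And>y. y \<in> cball 0 (b / 2) \<Longrightarrow> norm (fc1 y) \<le> B"
    "\<And>y y'. y \<in> cball 0 (b / 2) \<Longrightarrow> y' \<in> cball 0 (b / 2) \<Longrightarrow> norm (fc1 y - fc1 y') \<le> B * norm (y - y')"
    using holomorphic_bound_Lipschitz[OF holomorphic_fc1 open_ball sub] by metis
  \<comment> \<open>The equation is \<open>x * (2 + x) * (x * W)'' = fc (b + x * W)\<close>, and the
    right side equals \<open>x * W * fc1 (x * W)\<close>. Cancelling \<open>x\<close> leaves
    \<open>(x * W)'' = H x W\<close>. Two integrations from the values 0 and \<open>w\<close> at
    \<open>x = 0\<close>, and a division by \<open>x\<close>, give the fixed point equation with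
    \<open>j = 1\<close>.\<close>
  define H where "H = (\<lambda>x u. u * fc1 (x * u) / (2 + x))"
  have den: "norm (2 + x) \<ge> 1" "2 + x \<noteq> 0" if "norm x < r" for x :: complex
  proof -
    have "norm (2 + x) \<ge> norm (2::complex) - norm x" by (metis norm_diff_ineq)
    then show "norm (2 + x) \<ge> 1" using that r by simp
    then show "2 + x \<noteq> 0" by auto
  qed
  have Hhol: "(\<lambda>x. H x (W x)) holomorphic_on ball 0 s"
    if s: "0 < s" "s \<le> r" and W: "W holomorphic_on ball 0 s" "\<And>x. x \<in> ball 0 s \<Longrightarrow> W x \<in> cball w 1" for s W
  proof -
    have "(\<lambda>x. x * W x) holomorphic_on ball 0 s" by (intro holomorphic_intros W)
    moreover have "(\<lambda>x. x * W x) ` ball 0 s \<subseteq> ball 0 b"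
    proof (rule image_subsetI)
      fix x assume x: "x \<in> ball (0::complex) s"
      have "norm (x * W x) \<le> b / 2" by (rule small) (use x s W in auto)
      then show "x * W x \<in> ball 0 b" using b_pos by simp
    qed
    ultimately have "(\<lambda>x. fc1 (x * W x)) holomorphic_on ball 0 s"
      using holomorphic_on_compose_gen[OF _ holomorphic_fc1] by (fastforce simp: o_def)
    then show ?thesis unfolding H_def using den s by (intro holomorphic_intros W) auto
  qed
  have Hbound: "norm (H x u) \<le> Bw * B" if "x \<in> ball 0 r" "u \<in> cball w 1" for x u
  proof -
    have "norm (H x u) \<le> norm u * norm (fc1 (x * u)) / 1"
      unfolding H_def norm_divide norm_mult using den[of x] that by (intro frac_le) auto
    also have "\<dots> \<le> Bw * B"
      using Bw'[OF that(2)] B(2)[of "x * u"] small[of x u] that Bw by (auto intro!: mult_mono)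
    finally show ?thesis .
  qed
  have HLip: "norm (H x u - H x u') \<le> (B + Bw * B) * norm (u - u')"
    if x: "x \<in> ball 0 r" and u: "u \<in> cball w 1" "u' \<in> cball w 1" for x u u'
  proof -
    have x': "norm x < r" using x by simp
    have "H x u - H x u' = ((u - u') * fc1 (x * u) + u' * (fc1 (x * u) - fc1 (x * u'))) / (2 + x)"
      unfolding H_def by (simp add: diff_divide_distrib[symmetric] algebra_simps)
    also have "norm \<dots> \<le> norm ((u - u') * fc1 (x * u) + u' * (fc1 (x * u) - fc1 (x * u'))) / 1"
      unfolding norm_divide using den[OF x'] by (intro frac_le) auto
    also have "\<dots> \<le> norm (u - u') * norm (fc1 (x * u)) + norm u' * norm (fc1 (x * u) - fc1 (x * u'))"
      by (metis div_by_1 norm_mult norm_triangle_ineq)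
    also have "\<dots> \<le> norm (u - u') * B + Bw * (B * (1 * norm (u - u')))"
    proof (intro add_mono mult_mono mult_left_mono)
      show "norm (fc1 (x * u)) \<le> B" using B(2) small[OF x' u(1)] by simp
      show "norm u' \<le> Bw" by (rule Bw'[OF u(2)])
      have "norm (fc1 (x * u) - fc1 (x * u')) \<le> B * norm (x * u - x * u')"
        by (rule B(3)) (use small[OF x' u(1)] small[OF x' u(2)] in auto)
      also have "norm (x * u - x * u') = norm x * norm (u - u')" by (simp add: norm_mult flip: right_diff_distrib)
      also have "B * (norm x * norm (u - u')) \<le> B * (1 * norm (u - u'))"
        using B(1) x' r by (intro mult_left_mono mult_right_mono) auto
      finally show "norm (fc1 (x * u) - fc1 (x * u')) \<le> B * (1 * norm (u - u'))" .
    qed (use Bw B(1) in auto)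
    also have "\<dots> = (B + Bw * B) * norm (u - u')" by (simp add: algebra_simps)
    finally show ?thesis .
  qed
  obtain s W where s: "0 < s" "s \<le> r" and W: "W holomorphic_on ball 0 s"
    and Wball: "\<And>x. x \<in> ball 0 s \<Longrightarrow> W x \<in> cball w 1"
    and Weq: "\<And>x. x \<in> ball 0 s \<Longrightarrow> W x = w + x ^ 1 * integral {0..1} (\<lambda>t. of_real (1 - t) * H (of_real t * x) (W (of_real t * x)))"
    and uniq: "\<And>I V x. \<lbrakk>\<And>x. x \<in> I \<Longrightarrow> \<bar>x\<bar> < s; \<And>x t. x \<in> I \<Longrightarrow> 0 \<le> t \<Longrightarrow> t \<le> 1 \<Longrightarrow> t * x \<in> I; \<And>x. x \<in> I \<Longrightarrow> V x \<in> cball w 1;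
       \<And>x. x \<in> I \<Longrightarrow> \<exists>J. ((\<lambda>t. of_real (1 - t) * H (of_real t * of_real x) (V (t * x))) has_integral J) {0..1} \<and> V x = w + (of_real x) ^ 1 * J;
       x \<in> I\<rbrakk> \<Longrightarrow> V x = W (of_real x)"
  proof (rule holomorphic_fixed_point[of r 1 "\<lambda>_. w" w "\<lambda>t. 1 - t" 1 H "Bw * B" "B + Bw * B"], goal_cases)
    case (11 s W)
    show ?case by (rule that[of s W]) (fact 11)+
  qed (use r Hhol Hbound HLip in \<open>auto intro!: continuous_intros\<close>)
  have fact1: "x * W x \<in> ball 0 b" "norm (x * W x) \<le> b / 2" if "x \<in> ball 0 s" for x
    using small[of x "W x"] Wball[OF that] that s b_pos by auto
  have ray: "of_real t * x \<in> ball 0 s" if "x \<in> ball 0 s" "t \<in> {0..1}" for x :: complex and t :: real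
    using ray_in_ball that by simp
  define h where "h = (\<lambda>x. H x (W x))"
  have h: "h holomorphic_on ball 0 s" unfolding h_def using s W Wball by (intro Hhol)
  have hint: "((\<lambda>t. of_real (1 - t) * h (of_real t * x)) has_integral integral {0..1} (\<lambda>t. of_real (1 - t) * h (of_real t * x))) {0..1}"
    if "x \<in> ball 0 s" for x
    by (rule integrable_integral[OF ray_integrable[OF holomorphic_on_imp_continuous_on[OF h] _ that]]) (intro continuous_intros)
  \<comment> \<open>The conjugate of \<open>W\<close> solves the same equation on the symmetric
    interval, so uniqueness makes \<open>W\<close> real there.\<close>
  have Wreal: "cnj (W (of_real x)) = W (of_real x)" if x: "\<bar>x\<bar> < s" for x
  proof (rule uniq[where I = "{x. \<bar>x\<bar> < s}" and V = "\<lambda>x. cnj (W (of_real x))"])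
    fix x assume "x \<in> {x. \<bar>x\<bar> < s}"
    then have x: "\<bar>x\<bar> < s" and xs: "of_real x \<in> ball (0::complex) s" by auto
    show "\<bar>x\<bar> < s" by fact
    show "t * x \<in> {x. \<bar>x\<bar> < s}" if "0 \<le> t" "t \<le> 1" for t
      using x that mult_left_le_one_le[of "\<bar>x\<bar>" t] by (simp add: abs_mult)
    show "cnj (W (of_real x)) \<in> cball w 1"
    proof -
      have "norm (w - cnj (W (of_real x))) = norm (cnj (w - W (of_real x)))" by (simp add: w_def)
      also have "\<dots> = norm (w - W (of_real x))" by (rule complex_mod_cnj)
      finally show ?thesis using Wball[OF xs] by (simp add: dist_norm)
    qed
    let ?J = "integral {0..1} (\<lambda>t. of_real (1 - t) * h (of_real t * of_real x))"
    have "((cnj \<circ> (\<lambda>t. of_real (1 - t) * h (of_real t * of_real x))) has_integral cnj ?J) {0..1}"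
      unfolding has_integral_cnj by (rule hint[OF xs])
    then have "((\<lambda>t. of_real (1 - t) * H (of_real t * of_real x) (cnj (W (of_real (t * x))))) has_integral cnj ?J) {0..1}"
    proof (rule has_integral_eq[rotated])
      fix t :: real assume t: "t \<in> {0..1}"
      have "fc1 (cnj (of_real t * of_real x * W (of_real t * of_real x))) = cnj (fc1 (of_real t * of_real x * W (of_real t * of_real x)))"
        by (rule fc1_cnj) (rule fact1(1)[OF ray[OF xs t]])
      then show "(cnj \<circ> (\<lambda>t. of_real (1 - t) * h (of_real t * of_real x))) t = of_real (1 - t) * H (of_real t * of_real x) (cnj (W (of_real (t * x))))"
        by (simp add: h_def H_def)
    qed
    moreover have "cnj (W (of_real x)) = w + (of_real x) ^ 1 * cnj ?J"
      by (subst Weq[OF xs]) (simp add: h_def w_def)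
    ultimately show "\<exists>J. ((\<lambda>t. of_real (1 - t) * H (of_real t * of_real x) (cnj (W (of_real (t * x))))) has_integral J) {0..1}
        \<and> cnj (W (of_real x)) = w + (of_real x) ^ 1 * J" by blast
  qed (use x in auto)
  obtain h1 h2 where h1: "\<And>x. x \<in> ball 0 s \<Longrightarrow> (h1 has_field_derivative h x) (at x)"
    and h2: "\<And>x. x \<in> ball 0 s \<Longrightarrow> (h2 has_field_derivative h1 x) (at x)"
    and h2eq: "\<And>x. x \<in> ball 0 s \<Longrightarrow> x\<^sup>2 * integral {0..1} (\<lambda>t. of_real (1 - t) * h (of_real t * x)) = h2 x"
    using holomorphic_double_primitive[OF h s(1)] by blast
  have xW: "x * W x = x * w + h2 x" if x: "x \<in> ball 0 s" for x
    using Weq[OF x] h2eq[OF x] by (simp add: h_def power2_eq_square algebra_simps)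
  define Y where "Y = (\<lambda>x. b + x * w0 + Re (h2 (of_real x)))"
  define dY where "dY = (\<lambda>x. w0 + Re (h1 (of_real x)))"
  define G where "G = (\<lambda>x. of_real b + x * W x)"
  have GY: "G (of_real x) = of_real (Y x)" if x: "\<bar>x\<bar> < s" for x
  proof -
    have xs: "of_real x \<in> ball (0::complex) s" using x by simp
    have "Im (W (of_real x)) = 0" using Wreal[OF x] by (simp add: complex_eq_iff)
    moreover have "Re (of_real x * W (of_real x)) = x * w0 + Re (h2 (of_real x))"
      unfolding xW[OF xs] by (simp add: w_def)
    ultimately show ?thesis by (simp add: G_def Y_def complex_eq_iff)
  qed
  \<comment> \<open>The last bound gives \<open>M * sqrt x \<le> 1\<close>, which keeps the
    difference quotient of \<open>V\<close> in the disc of radius 1 around \<open>w\<close>.\<close>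
  define s' where "s' = min s (min \<delta> (1 / (M + 1)\<^sup>2))"
  have s': "0 < s'" "s' \<le> s" "s' \<le> \<delta>" "s' \<le> 1 / (M + 1)\<^sup>2" using s \<delta> by (auto simp: s'_def)
  have Msqrt: "M * sqrt x \<le> 1" if "0 < x" "x < s'" for x
  proof -
    have "sqrt x \<le> sqrt (1 / (M + 1)\<^sup>2)" using that s' by (intro real_sqrt_le_mono) auto
    also have "\<dots> = 1 / (M + 1)" using \<delta>(3) by (simp add: real_sqrt_divide)
    finally have "M * sqrt x \<le> M * (1 / (M + 1))" using \<delta>(3) by (intro mult_left_mono)
    also have "\<dots> \<le> 1" using \<delta>(3) by (simp add: field_simps)
    finally show ?thesis .
  qed
  \<comment> \<open>Uniqueness on the half-open interval identifies the quotient
    \<open>(V (1 + x) - b) / x\<close>, completed by the limit slope, with the holomorphic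
    solution.\<close>
  have agree: "of_real (if x = 0 then w0 else (V (1 + x) - b) / x) = W (of_real x)" if x: "0 \<le> x" "x < s'" for x
  proof (rule uniq[where I = "{0..<s'}" and V = "\<lambda>x. of_real (if x = 0 then w0 else (V (1 + x) - b) / x)"])
    fix x assume x: "x \<in> {0..<s'}"
    show "\<bar>x\<bar> < s" using x s' by auto
    show "t * x \<in> {0..<s'}" if "0 \<le> t" "t \<le> 1" for t
      using x that mult_left_le_one_le[of x t] by auto
    define \<omega> where "\<omega> = (\<lambda>x. if x = 0 then w0 else (V (1 + x) - b) / x)"
    have "\<bar>\<omega> x - w0\<bar> \<le> 1"
    proof (cases "x = 0")
      case False
      then have x': "0 < x" "x < \<delta>" using x s' by auto
      have "\<bar>\<omega> x - w0\<bar> = \<bar>V (1 + x) - b - x * w0\<bar> / x"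
        using False x' by (simp add: \<omega>_def divide_simps abs_divide mult.commute)
      also have "\<dots> \<le> M * x * sqrt x / x" using offset[OF x'] x' by (intro divide_right_mono) auto
      also have "\<dots> \<le> 1" using Msqrt[of x] x x' by simp
      finally show ?thesis .
    qed (simp add: \<omega>_def)
    then have "norm (complex_of_real (\<omega> x - w0)) \<le> 1" by (simp only: norm_of_real)
    then have "complex_of_real (\<omega> x) \<in> cball w 1"
      unfolding w_def by (simp add: dist_norm norm_minus_commute)
    then show "complex_of_real (if x = 0 then w0 else (V (1 + x) - b) / x) \<in> cball w 1"
      by (simp only: \<omega>_def)
    have "\<exists>J. ((\<lambda>t. of_real (1 - t) * H (of_real t * of_real x) (of_real (\<omega> (t * x)))) has_integral J) {0..1}
        \<and> complex_of_real (\<omega> x) = w + (of_real x) ^ 1 * J"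
    proof (cases "x = 0")
      case True
      have "(\<lambda>t. complex_of_real (1 - t) * H 0 w) integrable_on {0..1}"
        by (intro integrable_continuous_real continuous_intros)
      then show ?thesis using True by (auto simp: \<omega>_def w_def)
    next
      case False
      then have x': "0 < x" "x < \<delta>" using x s' by auto
      have V1: "((\<lambda>x. V (1 + x)) has_real_derivative dV (1 + x)) (at x)" if "x > 0" for x
        using DERIV_shift_add[OF V, of x] that by simp
      have dV1: "((\<lambda>x. dV (1 + x)) has_real_derivative (c * V (1 + x) - V (1 + x) powr p) / (x * (2 + x))) (at x)" if "x > 0" for x
        using at_light_cone_coordinate[OF dV, of x] that by simp
      have near: "\<forall>\<^sub>F x in at_right 0. 0 < x \<and> x < \<delta>"
        using \<delta> by (auto simp: eventually_at_right_field)
      have limV: "((\<lambda>x. V (1 + x)) \<longlongrightarrow> b) (at_right 0)"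
        using lim unfolding filterlim_at_right_to_0[of V _ 1] by (simp add: add.commute)
      have limdV: "((\<lambda>x. dV (1 + x)) \<longlongrightarrow> w0) (at_right 0)"
      proof (rule LIM_zero_cancel, rule Lim_null_comparison)
        show "\<forall>\<^sub>F x in at_right 0. norm (dV (1 + x) - w0) \<le> M * sqrt x"
          using near by eventually_elim (use slope in auto)
        show "((\<lambda>x. M * sqrt x) \<longlongrightarrow> 0) (at_right 0)" by (auto intro!: tendsto_eq_intros)
      qed
      define \<phi> where "\<phi> = (\<lambda>t. if t = 0 then b else V (1 + t * x))"
      define \<phi>1 where "\<phi>1 = (\<lambda>t. x * (if t = 0 then w0 else dV (1 + t * x)))"
      define \<phi>2 where "\<phi>2 = (\<lambda>t. x * x * ((c * V (1 + t * x) - V (1 + t * x) powr p) / (t * x * (2 + t * x))))"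
      have c\<phi>: "continuous_on {0..1} \<phi>"
        unfolding \<phi>_def using x' V1 by (intro continuous_on_ray_extension[OF limV]) (auto intro: DERIV_isCont)
      have c\<phi>1: "continuous_on {0..1} \<phi>1"
        unfolding \<phi>1_def using x' dV1
        by (intro continuous_on_mult continuous_on_const continuous_on_ray_extension[OF limdV]) (auto intro: DERIV_isCont)
      have d1: "(\<phi> has_real_derivative \<phi>1 t) (at t)" if t: "0 < t" "t < 1" for t
      proof -
        have "((\<lambda>t. V (1 + t * x)) has_real_derivative dV (1 + t * x) * x) (at t)"
          by (rule DERIV_chain2[where f = "\<lambda>x. V (1 + x)" and g = "\<lambda>t. t * x", OF V1]) (use t x' in \<open>auto intro!: derivative_eq_intros\<close>)
        moreover have "\<forall>\<^sub>F t in nhds t. V (1 + t * x) = \<phi> t"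
          by (rule eventually_mono[OF t1_space_nhds[of t 0]]) (use t in \<open>auto simp: \<phi>_def\<close>)
        ultimately show ?thesis
          using DERIV_cong_ev[of t t "\<lambda>t. V (1 + t * x)" \<phi>] t by (simp add: \<phi>1_def mult.commute)
      qed
      have d2: "(\<phi>1 has_real_derivative \<phi>2 t) (at t)" if t: "0 < t" "t < 1" for t
      proof -
        have "((\<lambda>t. dV (1 + t * x)) has_real_derivative (c * V (1 + t * x) - V (1 + t * x) powr p) / (t * x * (2 + t * x)) * x) (at t)"
          by (rule DERIV_chain2[where f = "\<lambda>x. dV (1 + x)" and g = "\<lambda>t. t * x", OF dV1]) (use t x' in \<open>auto intro!: derivative_eq_intros\<close>)
        from DERIV_cmult[OF this, where c = x] have "((\<lambda>t. x * dV (1 + t * x)) has_real_derivative \<phi>2 t) (at t)"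
          by (rule DERIV_cong) (simp add: \<phi>2_def)
        moreover have "\<forall>\<^sub>F t in nhds t. x * dV (1 + t * x) = \<phi>1 t"
          by (rule eventually_mono[OF t1_space_nhds[of t 0]]) (use t in \<open>auto simp: \<phi>1_def\<close>)
        ultimately show ?thesis using DERIV_cong_ev[of t t "\<lambda>t. x * dV (1 + t * x)" \<phi>1] by simp
      qed
      have "((\<lambda>t. (1 - t) *\<^sub>R \<phi>2 t) has_integral (\<phi> 1 - \<phi> 0 - \<phi>1 0)) {0..1}"
        by (rule taylor_integral_remainder[OF c\<phi> c\<phi>1]) (use d1 d2 in \<open>auto simp: has_real_derivative_iff_has_vector_derivative\<close>)
      then have "((\<lambda>t. complex_of_real ((1 - t) * \<phi>2 t) / (of_real x)\<^sup>2) has_integral of_real (V (1 + x) - b - x * w0) / (of_real x)\<^sup>2) {0..1}"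
        by (intro has_integral_divide has_integral_of_real) (simp add: \<phi>_def \<phi>1_def)
      then have "((\<lambda>t. of_real (1 - t) * H (of_real t * of_real x) (of_real (\<omega> (t * x)))) has_integral of_real (V (1 + x) - b - x * w0) / (of_real x)\<^sup>2) {0..1}"
      \<comment> \<open>At \<open>t = 0\<close> the divisor \<open>t * x\<close> in
        \<open>\<phi>2\<close> vanishes and its value there is meaningless; a single point does not
        affect the integral.\<close>
      proof (rule has_integral_spike_finite[where S = "{0}", rotated 2])
        fix t :: real assume t: "t \<in> {0..1} - {0}"
        then have tx: "t * x > 0" using x' by simp
        have "complex_of_real (t * x) * fc1 (of_real (t * x) * of_real (\<omega> (t * x))) * of_real (\<omega> (t * x))
            = fc (of_real b + of_real (t * x) * of_real (\<omega> (t * x)))"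
          using fc1_mult[of "of_real (t * x) * of_real (\<omega> (t * x))"] by (simp only: mult_ac)
        also have "of_real b + of_real (t * x) * of_real (\<omega> (t * x)) = complex_of_real (V (1 + t * x))"
        proof -
          have "t * x * \<omega> (t * x) = V (1 + t * x) - b"
            unfolding \<omega>_def by (subst if_not_P) (use tx in auto)
          then have "b + t * x * \<omega> (t * x) = V (1 + t * x)" by simp
          then show ?thesis by (simp only: of_real_add[symmetric] of_real_mult[symmetric])
        qed
        also have "fc (of_real (V (1 + t * x))) = of_real (c * V (1 + t * x) - V (1 + t * x) powr p)"
          using pos[of "1 + t * x"] tx by (intro fc_of_real) auto
        finally have e: "complex_of_real (t * x) * fc1 (of_real (t * x) * of_real (\<omega> (t * x))) * of_real (\<omega> (t * x))
            = complex_of_real (c * V (1 + t * x) - V (1 + t * x) powr p)" .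
        have ne: "complex_of_real (t * x) \<noteq> 0" using tx by (simp only: of_real_eq_0_iff)
        have *: "of_real (\<omega> (t * x)) * fc1 (of_real (t * x) * of_real (\<omega> (t * x)))
            = complex_of_real ((c * V (1 + t * x) - V (1 + t * x) powr p) / (t * x))"
          unfolding of_real_divide nonzero_eq_divide_eq[OF ne] by (subst e[symmetric]) (simp only: mult_ac)
        have "H (of_real t * of_real x) (of_real (\<omega> (t * x))) = complex_of_real ((c * V (1 + t * x) - V (1 + t * x) powr p) / (t * x) / (2 + t * x))"
          unfolding H_def of_real_mult[of t x, symmetric] * by (simp only: of_real_divide of_real_add of_real_numeral)
        moreover have "\<phi>2 t / x\<^sup>2 = (c * V (1 + t * x) - V (1 + t * x) powr p) / (t * x) / (2 + t * x)"
          using False by (simp add: \<phi>2_def power2_eq_square)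
        ultimately have "H (of_real t * of_real x) (of_real (\<omega> (t * x))) = complex_of_real (\<phi>2 t / x\<^sup>2)" by (simp only:)
        then show "of_real (1 - t) * H (of_real t * of_real x) (of_real (\<omega> (t * x))) = complex_of_real ((1 - t) * \<phi>2 t) / (of_real x)\<^sup>2"
          by (simp only: of_real_mult of_real_divide of_real_power times_divide_eq_right)
      qed auto
      moreover have "complex_of_real (\<omega> x) = w + (of_real x) ^ 1 * (of_real (V (1 + x) - b - x * w0) / (of_real x)\<^sup>2)"
      proof -
        have "\<omega> x = w0 + x * ((V (1 + x) - b - x * w0) / x\<^sup>2)"
          using False by (simp add: \<omega>_def field_simps power2_eq_square)
        then have "complex_of_real (\<omega> x) = of_real (w0 + x * ((V (1 + x) - b - x * w0) / x\<^sup>2))" by (simp only:)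
        then show ?thesis unfolding w_def
          by (simp only: of_real_add of_real_mult of_real_divide of_real_power power_one_right)
      qed
      ultimately show ?thesis by blast
    qed
    then show "\<exists>J. ((\<lambda>t. of_real (1 - t) * H (of_real t * of_real x) (of_real (if t * x = 0 then w0 else (V (1 + t * x) - b) / (t * x)))) has_integral J) {0..1}
        \<and> complex_of_real (if x = 0 then w0 else (V (1 + x) - b) / x) = w + (of_real x) ^ 1 * J"
      by (simp only: \<omega>_def)
  qed (use x in auto)
  show thesis
  proof (rule that[of s' G Y dY "\<lambda>x. Re (h (of_real x))"])
    show "0 < s'" "s' \<le> 1 / 2" using s s' r by auto
    show "G holomorphic_on ball 0 s'"
      unfolding G_def by (intro holomorphic_intros holomorphic_on_subset[OF W]) (use s' in auto)
    show "G (of_real x) = of_real (Y x)" if "\<bar>x\<bar> < s'" for x using GY that s' by simp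
    show "Y x = V (1 + x)" if x: "0 < x" "x < s'" for x
    proof -
      have "complex_of_real (Y x) = of_real b + of_real x * of_real ((V (1 + x) - b) / x)"
        using GY[of x] agree[of x] x s' by (simp add: G_def)
      also have "\<dots> = of_real (V (1 + x))" using x by simp
      finally show ?thesis by simp
    qed
    show "Y 0 = b"
      using GY[of 0] s by (simp add: G_def)
    show Ypos: "Y x > 0" if x: "\<bar>x\<bar> < s'" for x
    proof -
      have xs: "of_real x \<in> ball (0::complex) s" using x s' by simp
      have xs': "\<bar>x\<bar> < s" using x s' by simp
      have "complex_of_real (Y x - b) = of_real x * W (of_real x)"
        unfolding of_real_diff GY[OF xs', symmetric] G_def by simp
      then have "\<bar>Y x - b\<bar> \<le> b / 2" using fact1(2)[OF xs] by (metis norm_of_real)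
      then show ?thesis using b_pos by linarith
    qed
    show "(Y has_real_derivative dY x) (at x)" if x: "\<bar>x\<bar> < s'" for x
    proof -
      have "((\<lambda>x. b + x * w0 + Re (h2 (of_real x))) has_real_derivative 0 + 1 * w0 + Re (h1 (of_real x))) (at x)"
        by (intro DERIV_add DERIV_const DERIV_cmult_right DERIV_ident DERIV_Re_of_real h2) (use x s' in simp)
      then show ?thesis by (simp add: Y_def dY_def)
    qed
    show "(dY has_real_derivative Re (h (of_real x))) (at x)" if x: "\<bar>x\<bar> < s'" for x
    proof -
      have "((\<lambda>x. w0 + Re (h1 (of_real x))) has_real_derivative 0 + Re (h (of_real x))) (at x)"
        by (intro DERIV_add DERIV_const DERIV_Re_of_real h1) (use x s' in simp)
      then show ?thesis by (simp add: dY_def)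
    qed
    show "x * (2 + x) * Re (h (of_real x)) = c * Y x - Y x powr p" if x: "\<bar>x\<bar> < s'" for x
    proof -
      have x2: "2 + complex_of_real x \<noteq> 0" using den[of "of_real x"] x s s' by simp
      have "of_real (x * (2 + x)) * h (of_real x) = of_real x * W (of_real x) * fc1 (of_real x * W (of_real x))"
        using x2 by (simp add: h_def H_def)
      also have "\<dots> = fc (G (of_real x))" by (simp add: fc1_mult G_def)
      also have "\<dots> = fc (of_real (Y x))" using GY[of x] x s' by simp
      also have "\<dots> = of_real (c * Y x - Y x powr p)" using Ypos[OF x] by (intro fc_of_real) simp
      finally have "Re (of_real (x * (2 + x)) * h (of_real x)) = c * Y x - Y x powr p" by simp
      then show ?thesis by simp
    qed
  qed
qed

end

section \<open>The self-similar profile\<close>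

text \<open>Since \<open>u\<close> and \<open>y - x\<close> are real, the real parts of the complex
  Taylor coefficients serve. Agreement is asked on \<open>S\<close> only, which permits a one-sided
  expansion at 0.\<close>

lemma real_analytic_at:
  assumes r: "r > 0" and G: "G holomorphic_on ball (of_real x) r"
    and eq: "\<And>y. y \<in> S \<Longrightarrow> \<bar>y - x\<bar> < r \<Longrightarrow> G (of_real y) = of_real (u y)"
  shows "\<exists>a r. 0 < r \<and> (\<forall>y\<in>S. \<bar>y - x\<bar> < r \<longrightarrow> (\<lambda>n. a n * (y - x) ^ n) sums u y)"
proof (intro exI[of _ "\<lambda>n. Re ((deriv ^^ n) G (of_real x) / fact n)"] exI[of _ r] conjI r ballI impI)
  fix y assume y: "y \<in> S" "\<bar>y - x\<bar> < r"
  have "norm (complex_of_real (y - x)) < r" using y by (simp only: norm_of_real)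
  then have "of_real y \<in> ball (complex_of_real x) r" by (simp add: dist_norm norm_minus_commute)
  from holomorphic_power_series[OF G this]
  have "(\<lambda>n. (deriv ^^ n) G (of_real x) / fact n * of_real ((y - x) ^ n)) sums of_real (u y)"
    using eq[OF y] by simp
  then have "(\<lambda>n. Re ((deriv ^^ n) G (of_real x) / fact n * of_real ((y - x) ^ n))) sums Re (of_real (u y))"
    by (rule sums_Re)
  moreover have "Re (a * of_real t) = Re a * t" for a t by simp
  ultimately show "(\<lambda>n. Re ((deriv ^^ n) G (of_real x) / fact n) * (y - x) ^ n) sums u y"
    by (simp only: Re_complex_of_real)
qed

text \<open>The preimage of the disc under \<open>1 / w\<close> within the right half-plane is open,
  which supplies \<open>r'\<close>; the half-plane keeps the complex power off its branch
  cut.\<close>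

lemma holomorphic_inversion:
  fixes \<rho> \<alpha> :: real
  assumes \<rho>: "\<rho> > 0" and r: "r > 0" and g: "g holomorphic_on ball (complex_of_real (1 / \<rho>)) r"
    and eq: "\<And>x. \<bar>x - 1 / \<rho>\<bar> < r \<Longrightarrow> g (of_real x) = of_real (V x)"
  obtains r' G where "r' > 0" "G holomorphic_on ball (of_real \<rho>) r'"
    "\<And>y. \<bar>y - \<rho>\<bar> < r' \<Longrightarrow> y > 0 \<and> G (of_real y) = of_real (y powr - \<alpha> * V (1 / y))"
proof -
  define T where "T = {w. Re w > 0} \<inter> (\<lambda>w. 1 / w) -` ball (complex_of_real (1 / \<rho>)) r"
  have oR: "open {w. Re w > 0}" using open_halfspace_Re_gt[of 0] by simp
  have "continuous_on {w. Re w > 0} (\<lambda>w::complex. 1 / w)" by (intro continuous_intros) auto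
  then have "open T"
    unfolding T_def by (intro continuous_open_preimage oR open_ball)
  moreover have "of_real \<rho> \<in> T" using \<rho> r by (simp add: T_def)
  ultimately obtain r' where r': "r' > 0" "ball (of_real \<rho>) r' \<subseteq> T"
    unfolding open_contains_ball by blast
  have T_pos: "Re w > 0" if "w \<in> ball (of_real \<rho>) r'" for w using r'(2) that by (auto simp: T_def)
  show thesis
  proof (rule that[of r' "\<lambda>w. w powr of_real (- \<alpha>) * g (1 / w)"])
    have "(\<lambda>w. 1 / w) ` ball (of_real \<rho>) r' \<subseteq> ball (complex_of_real (1 / \<rho>)) r" using r'(2) by (auto simp: T_def)
    moreover have "(\<lambda>w. 1 / w) holomorphic_on ball (of_real \<rho>) r'"
      using T_pos[of 0] by (intro holomorphic_intros) auto
    ultimately have "(\<lambda>w. g (1 / w)) holomorphic_on ball (of_real \<rho>) r'"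
      using holomorphic_on_compose_gen[OF _ g] by (fastforce simp: o_def)
    moreover have "(\<lambda>w. w powr of_real (- \<alpha>)) holomorphic_on ball (of_real \<rho>) r'"
    proof (intro holomorphic_intros)
      fix x assume "x \<in> ball (complex_of_real \<rho>) r'"
      from T_pos[OF this] show "x \<notin> \<real>\<^sub>\<le>\<^sub>0" by (simp add: complex_nonpos_Reals_iff)
    qed
    ultimately show "(\<lambda>w. w powr of_real (- \<alpha>) * g (1 / w)) holomorphic_on ball (of_real \<rho>) r'"
      by (intro holomorphic_on_mult)
    fix y assume y: "\<bar>y - \<rho>\<bar> < r'"
    then have "norm (complex_of_real (y - \<rho>)) < r'" by (simp only: norm_of_real)
    then have "of_real y \<in> ball (complex_of_real \<rho>) r'" by (simp add: dist_norm norm_minus_commute)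
    then have yT: "complex_of_real y \<in> T" using r'(2) by blast
    then have pos: "y > 0" by (simp add: T_def)
    have "norm (complex_of_real (1 / \<rho> - 1 / y)) < r" using yT by (simp add: T_def dist_norm)
    then have "\<bar>1 / y - 1 / \<rho>\<bar> < r" unfolding norm_of_real by (simp add: abs_minus_commute)
    from eq[OF this] have "g (1 / of_real y) = of_real (V (1 / y))" by simp
    moreover have "complex_of_real y powr of_real (- \<alpha>) = of_real (y powr - \<alpha>)"
      using pos by (intro powr_of_real) simp
    ultimately show "y > 0 \<and> complex_of_real y powr of_real (- \<alpha>) * g (1 / of_real y) = of_real (y powr - \<alpha> * V (1 / y))"
      using pos by (simp only: of_real_mult simp_thms)
  qed (rule r'(1))
qed

context supercritical
begin

section \<open>Continuation across the cone and return to the original variable\<close>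

text \<open>The variable is scaled so that the cone sits at \<open>z = 1\<close>. The solution from
  the centre and the holomorphic one at the cone agree on (1, 1 + s), so they can be glued. The
  equation is kept in multiplied form because it must hold at \<open>z = 1\<close> too.\<close>

lemma continued_profile:
  assumes \<eta>: "0 < \<eta>" "\<eta> \<le> 1" "\<eta>\<^sup>2 * c < 1" and endpt: "psi \<eta> 1 = b"
  obtains s V dV d2V where "0 < s" "s < 1" "V 1 = b"
    "\<And>z. z > 1 \<Longrightarrow> V z = v \<eta> (\<eta> * z)"
    "\<And>z. z > 1 - s \<Longrightarrow> V z > 0"
    "\<And>z. z > 1 - s \<Longrightarrow> (V has_real_derivative dV z) (at z)"
    "\<And>z. z > 1 - s \<Longrightarrow> (dV has_real_derivative d2V z) (at z)"
    "\<And>z. z > 1 - s \<Longrightarrow> (z\<^sup>2 - 1) * d2V z = c * V z - V z powr p"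
    "\<And>z. z > 1 - s \<Longrightarrow> \<exists>r>0. \<exists>g. g holomorphic_on ball (of_real z) r \<and> (\<forall>x. \<bar>x - z\<bar> < r \<longrightarrow> g (of_real x) = of_real (V x))"
proof -
  define V0 where "V0 = (\<lambda>z. v \<eta> (\<eta> * z))"
  define dV0 where "dV0 = (\<lambda>z. \<eta> * dv \<eta> (\<eta> * z))"
  have gt: "\<eta> < \<eta> * z" if "z > 1" for z using that \<eta> by simp
  have lin: "((\<lambda>z. \<eta> * z) has_real_derivative \<eta>) (at z)" for z by (auto intro!: derivative_eq_intros)
  have V0: "(V0 has_real_derivative dV0 z) (at z)" if "z > 1" for z
  proof -
    have "((\<lambda>z. v \<eta> (\<eta> * z)) has_real_derivative dv \<eta> (\<eta> * z) * \<eta>) (at z)"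
      by (rule DERIV_chain2[where f = "v \<eta>" and g = "\<lambda>z. \<eta> * z", OF _ lin]) (use v_derivs(1)[of \<eta> "\<eta> * z"] \<eta> gt[OF that] in auto)
    then show ?thesis by (simp add: V0_def dV0_def mult.commute[of \<eta> "dv \<eta> (\<eta> * z)"])
  qed
  have dV0: "(dV0 has_real_derivative (c * V0 z - V0 z powr p) / (z\<^sup>2 - 1)) (at z)" if z: "z > 1" for z
  proof -
    have "((\<lambda>z. dv \<eta> (\<eta> * z)) has_real_derivative (c * v \<eta> (\<eta> * z) - v \<eta> (\<eta> * z) powr p) / ((\<eta> * z)\<^sup>2 - \<eta>\<^sup>2) * \<eta>) (at z)"
      by (rule DERIV_chain2[where f = "dv \<eta>" and g = "\<lambda>z. \<eta> * z", OF _ lin]) (use v_derivs(2)[of \<eta> "\<eta> * z"] \<eta> gt[OF z] in auto)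
    from DERIV_cmult[OF this, where c = \<eta>]
    have "(dV0 has_real_derivative \<eta> * ((c * v \<eta> (\<eta> * z) - v \<eta> (\<eta> * z) powr p) / ((\<eta> * z)\<^sup>2 - \<eta>\<^sup>2) * \<eta>)) (at z)"
      by (simp add: dV0_def)
    moreover have "(\<eta> * z)\<^sup>2 - \<eta>\<^sup>2 = \<eta> * \<eta> * (z\<^sup>2 - 1)" by (simp add: power2_eq_square algebra_simps)
    ultimately show ?thesis using \<eta> by (simp add: V0_def)
  qed
  have V0pos: "V0 z > 0" if "z > 1" for z
    using v_pos[of \<eta> "\<eta> * z"] \<eta> gt[OF that] by (simp add: V0_def)
  have lim: "(V0 \<longlongrightarrow> b) (at_right 1)"
  proof -
    have ev: "\<forall>\<^sub>F z in at_right 1. 1 < (z::real)" by (simp add: eventually_at_right_less)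
    have "((\<lambda>z. psi \<eta> (1 / z)) \<longlongrightarrow> psi \<eta> 1) (at_right 1)"
    proof (rule continuous_on_tendsto_compose[OF continuous_on_psi_slice[OF \<eta>(1,2)]])
      show "((\<lambda>z. 1 / z) \<longlongrightarrow> 1) (at_right (1::real))" by (auto intro!: tendsto_eq_intros)
      show "\<forall>\<^sub>F z in at_right 1. 1 / z \<in> {0..1::real}" using ev by eventually_elim simp
    qed simp
    then have "((\<lambda>z. psi \<eta> (1 / z)) \<longlongrightarrow> b) (at_right 1)" by (simp add: endpt)
    then show ?thesis
      by (rule Lim_transform_eventually) (use ev in eventually_elim, use \<eta> in \<open>simp add: psi_eq_v V0_def\<close>)
  qed
  \<comment> \<open>The growth bound on the slope comes from negative energy: the kinetic part is at
    most \<open>c * v^2 / 2\<close>, and \<open>v\<close> is at most \<open>v_max\<close>.\<close>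
  have bound: "(z - 1) * (dV0 z)\<^sup>2 \<le> c * v_max\<^sup>2" if z: "z > 1" "z < 2" for z
  proof -
    note g = gt[OF z(1)]
    have v: "0 < v \<eta> (\<eta> * z)" "v \<eta> (\<eta> * z) \<le> v_max" using v_bounds[of \<eta> "\<eta> * z"] \<eta> g by auto
    have "energy \<eta> (\<eta> * z) < 0" using v_derivs(4)[of \<eta> "\<eta> * z"] \<eta> g by auto
    moreover have "0 \<le> v \<eta> (\<eta> * z) powr (p + 1) / (p + 1)" using p_gt by (intro divide_nonneg_pos) auto
    ultimately have "((\<eta> * z)\<^sup>2 - \<eta>\<^sup>2) * (dv \<eta> (\<eta> * z))\<^sup>2 \<le> c * (v \<eta> (\<eta> * z))\<^sup>2"
      unfolding energy_def F_def by linarith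
    also have "\<dots> \<le> c * v_max\<^sup>2" using v c_pos by (intro mult_left_mono power_mono) auto
    also have "((\<eta> * z)\<^sup>2 - \<eta>\<^sup>2) * (dv \<eta> (\<eta> * z))\<^sup>2 = (z\<^sup>2 - 1) * (dV0 z)\<^sup>2"
      by (simp add: dV0_def power2_eq_square algebra_simps)
    finally have "(z\<^sup>2 - 1) * (dV0 z)\<^sup>2 \<le> c * v_max\<^sup>2" .
    moreover have "z \<le> z\<^sup>2" using z by (simp add: power2_eq_square)
    then have "(z - 1) * (dV0 z)\<^sup>2 \<le> (z\<^sup>2 - 1) * (dV0 z)\<^sup>2" by (intro mult_right_mono) auto
    ultimately show ?thesis by simp
  qed
  obtain s G Y dY d2Y where s: "0 < s" "s \<le> 1 / 2" and G: "G holomorphic_on ball 0 s"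
    and GY: "\<And>x. \<bar>x\<bar> < s \<Longrightarrow> G (of_real x) = of_real (Y x)"
    and YV: "\<And>x. 0 < x \<Longrightarrow> x < s \<Longrightarrow> Y x = V0 (1 + x)" and Y0: "Y 0 = b"
    and Ypos: "\<And>x. \<bar>x\<bar> < s \<Longrightarrow> Y x > 0"
    and Y: "\<And>x. \<bar>x\<bar> < s \<Longrightarrow> (Y has_real_derivative dY x) (at x)"
    and dY: "\<And>x. \<bar>x\<bar> < s \<Longrightarrow> (dY has_real_derivative d2Y x) (at x)"
    and Yode: "\<And>x. \<bar>x\<bar> < s \<Longrightarrow> x * (2 + x) * d2Y x = c * Y x - Y x powr p"
    using analytic_singular[OF V0 dV0 V0pos lim bound] by blast
  define V where "V = (\<lambda>z. if z > 1 then V0 z else Y (z - 1))"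
  define dV where "dV = (\<lambda>z. if z > 1 then dV0 z else dY (z - 1))"
  define d2V where "d2V = (\<lambda>z. if z > 1 then (c * V0 z - V0 z powr p) / (z\<^sup>2 - 1) else d2Y (z - 1))"
  have V_near: "V z = Y (z - 1)" if "\<bar>z - 1\<bar> < s" for z
    using YV[of "z - 1"] that by (auto simp: V_def)
  have shift: "((\<lambda>z. f (z - 1)) has_real_derivative D) (at z)" if "(f has_real_derivative D) (at (z - 1))" for f D and z :: real
  proof -
    have "((\<lambda>z. z - 1) has_real_derivative 1) (at z)" by (auto intro!: derivative_eq_intros)
    from DERIV_chain2[where f = f and g = "\<lambda>z. z - 1", OF that this] show ?thesis by simp
  qed
  have near_ev: "\<forall>\<^sub>F x in nhds z. \<bar>x - 1\<bar> < s" if "\<bar>z - 1\<bar> < s" for z :: real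
    using that eventually_nhds_in_open[of "ball 1 s" z] by (simp add: dist_real_def abs_minus_commute)
  have far_ev: "\<forall>\<^sub>F x in nhds z. x > 1" if "z > 1" for z :: real
    using that eventually_nhds_in_open[of "{1<..}" z] by simp
  have V_d1: "(V has_real_derivative dV0 z) (at z)" if z: "z > 1" for z
  proof -
    have "\<forall>\<^sub>F x in nhds z. V x = V0 x" using far_ev[OF z] by eventually_elim (simp add: V_def)
    then show ?thesis using DERIV_cong_ev[of z z V V0] V0[OF z] by simp
  qed
  have V_d2: "(V has_real_derivative dY (z - 1)) (at z)" if z: "\<bar>z - 1\<bar> < s" for z
  proof -
    have "\<forall>\<^sub>F x in nhds z. V x = Y (x - 1)" using near_ev[OF z] by eventually_elim (rule V_near)
    then show ?thesis using DERIV_cong_ev[of z z V "\<lambda>x. Y (x - 1)"] shift[OF Y[OF z]] by simp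
  qed
  \<comment> \<open>On the overlap both expressions are derivatives of the same \<open>V\<close>, so
    they coincide.\<close>
  have dV_near: "dV z = dY (z - 1)" if "\<bar>z - 1\<bar> < s" for z
    using DERIV_unique[OF V_d1 V_d2] that by (auto simp: dV_def)
  show thesis
  proof (rule that[of s V dV d2V])
    show "0 < s" "s < 1" using s by auto
    show "V 1 = b" using Y0 by (simp add: V_def)
    show "V z = v \<eta> (\<eta> * z)" if "z > 1" for z using that by (simp add: V_def V0_def)
    fix z assume z: "z > 1 - s"
    show "V z > 0" using V0pos[of z] Ypos[of "z - 1"] z by (auto simp: V_def)
    show "(V has_real_derivative dV z) (at z)"
      using V_d1[of z] V_d2[of z] z by (auto simp: dV_def)
    show "(dV has_real_derivative d2V z) (at z)"
    proof (cases "z > 1")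
      case True
      have "\<forall>\<^sub>F x in nhds z. dV x = dV0 x" using far_ev[OF True] by eventually_elim (simp add: dV_def)
      then show ?thesis using DERIV_cong_ev[of z z dV dV0] dV0[OF True] True by (simp add: d2V_def)
    next
      case False
      then have zs: "\<bar>z - 1\<bar> < s" using z by simp
      have "\<forall>\<^sub>F x in nhds z. dV x = dY (x - 1)" using near_ev[OF zs] by eventually_elim (rule dV_near)
      then show ?thesis
        using DERIV_cong_ev[of z z dV "\<lambda>x. dY (x - 1)"] shift[OF dY[OF zs]] False by (simp add: d2V_def)
    qed
    show "(z\<^sup>2 - 1) * d2V z = c * V z - V z powr p"
    proof (cases "z > 1")
      case True
      then have "z\<^sup>2 > 1" by (simp add: one_less_power)
      then have "z\<^sup>2 \<noteq> 1" by linarith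
      then show ?thesis using True by (simp add: d2V_def V_def)
    next
      case False
      then have "\<bar>z - 1\<bar> < s" using z by simp
      from Yode[OF this] have "(z - 1) * (2 + (z - 1)) * d2V z = c * V z - V z powr p"
        using False by (simp add: d2V_def V_def)
      moreover have "(z - 1) * (2 + (z - 1)) = z\<^sup>2 - 1" by (simp add: power2_eq_square algebra_simps)
      ultimately show ?thesis by simp
    qed
    show "\<exists>r>0. \<exists>g. g holomorphic_on ball (of_real z) r \<and> (\<forall>x. \<bar>x - z\<bar> < r \<longrightarrow> g (of_real x) = of_real (V x))"
    proof (cases "z > 1")
      case True
      obtain r W where r: "0 < r" "r \<le> z - 1" and W: "W holomorphic_on ball 0 r"
        and WV: "\<And>x. \<bar>x\<bar> < r \<Longrightarrow> W (of_real x) = of_real (V0 (z + x))"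
        using analytic_regular[OF True V0 dV0 V0pos] by blast
      have im: "(\<lambda>x. x - of_real z) ` ball (of_real z) r \<subseteq> ball (0::complex) r"
        by (auto simp: dist_norm norm_minus_commute)
      have "(\<lambda>x. x - of_real z) holomorphic_on ball (of_real z) r" by (intro holomorphic_intros)
      from holomorphic_on_compose_gen[OF this W im]
      have "(\<lambda>x. W (x - of_real z)) holomorphic_on ball (of_real z) r" by (simp add: o_def)
      moreover have "W (of_real x - of_real z) = of_real (V x)" if "\<bar>x - z\<bar> < r" for x
        using WV[OF that] that r by (auto simp: V_def)
      ultimately show ?thesis using r(1) by blast
    next
      case False
      define r where "r = s - \<bar>z - 1\<bar>"
      have r: "r > 0" using False z by (simp add: r_def)
      have im: "(\<lambda>x. x - 1) ` ball (of_real z) r \<subseteq> ball (0::complex) s"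
      proof (rule image_subsetI)
        fix x assume "x \<in> ball (complex_of_real z) r"
        then have "norm (x - of_real z) < r" by (simp add: dist_norm norm_minus_commute)
        moreover have "norm (complex_of_real z - 1) = \<bar>z - 1\<bar>" by (metis norm_of_real of_real_1 of_real_diff)
        moreover have "norm (x - 1) \<le> norm (x - of_real z) + norm (complex_of_real z - 1)"
          using norm_triangle_ineq[of "x - of_real z" "of_real z - 1"] by simp
        ultimately show "x - 1 \<in> ball 0 s" by (simp add: r_def)
      qed
      have "(\<lambda>x. x - 1) holomorphic_on ball (of_real z) r" by (intro holomorphic_intros)
      from holomorphic_on_compose_gen[OF this G im]
      have "(\<lambda>x. G (x - 1)) holomorphic_on ball (of_real z) r" by (simp add: o_def)
      moreover have "G (of_real x - 1) = of_real (V x)" if "\<bar>x - z\<bar> < r" for x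
      proof -
        have xs: "\<bar>x - 1\<bar> < s" using that by (simp add: r_def)
        show ?thesis using GY[OF xs] V_near[OF xs] by simp
      qed
      ultimately show ?thesis using r by blast
    qed
  qed
qed

text \<open>The multiplied form of the equation for \<open>D\<close> suffices, since
  \<open>u''\<close> enters only through \<open>(1 - \<rho>\<^sup>2) * u''\<close>; thus \<rho> = 1
  is included.\<close>

lemma similarity_ode:
  fixes \<rho> w d D :: real
  assumes \<rho>: "\<rho> > 0" and w: "w > 0" and D: "((1 / \<rho>)\<^sup>2 - 1) * D = c * w - w powr p"
  defines "u \<equiv> \<rho> powr - \<alpha> * w" and "u' \<equiv> - \<alpha> * \<rho> powr (- \<alpha> - 1) * w - \<rho> powr (- \<alpha> - 2) * d"
    and "u'' \<equiv> \<rho> powr (- \<alpha> - 4) * (\<alpha> * (\<alpha> + 1) * \<rho>\<^sup>2 * w + 2 * (\<alpha> + 1) * \<rho> * d + D)"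
  shows "(1 - \<rho>\<^sup>2) * u'' + ((2 * \<alpha> + 2) / \<rho> - 2 * (\<alpha> + 1) * \<rho>) * u' - \<alpha> * (\<alpha> + 1) * u + \<bar>u\<bar> powr (p - 1) * u = 0"
proof -
  define q where "q = \<rho> powr (- \<alpha> - 4)"
  have pq: "\<rho> powr a = q * \<rho> ^ n" if "a = - \<alpha> - 4 + real n" for a n
    using \<rho> by (simp only: that q_def powr_add powr_realpow)
  have pows: "\<rho> powr (- \<alpha> - 1) = q * \<rho> ^ 3" "\<rho> powr (- \<alpha> - 2) = q * \<rho> ^ 2" "\<rho> powr - \<alpha> = q * \<rho> ^ 4"
    by (rule pq; simp)+
  have "u > 0" using \<rho> w by (simp add: u_def)
  then have "\<bar>u\<bar> powr (p - 1) * u = u powr p" using powr_add[of u "p - 1" 1] by simp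
  also have "\<dots> = \<rho> powr (- \<alpha> * p) * w powr p" using \<rho> w by (simp add: u_def powr_mult powr_powr)
  also have "- \<alpha> * p = - \<alpha> - 2" using \<alpha>_pos by (simp add: p_def algebra_simps)
  finally have up: "\<bar>u\<bar> powr (p - 1) * u = q * \<rho>\<^sup>2 * w powr p" by (simp add: pows)
  have D': "(1 - \<rho>\<^sup>2) * D = \<rho>\<^sup>2 * (c * w - w powr p)"
    unfolding D[symmetric] using \<rho> by (simp add: field_simps)
  have B: "((2 * \<alpha> + 2) / \<rho> - 2 * (\<alpha> + 1) * \<rho>) * u' = - (2 * \<alpha> + 2) * (1 - \<rho>\<^sup>2) * q * (\<alpha> * \<rho>\<^sup>2 * w + \<rho> * d)"
    unfolding u'_def pows using \<rho> by (simp add: field_simps power2_eq_square power3_eq_cube)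
  have A: "(1 - \<rho>\<^sup>2) * u'' = q * ((1 - \<rho>\<^sup>2) * (\<alpha> * (\<alpha> + 1) * \<rho>\<^sup>2 * w + 2 * (\<alpha> + 1) * \<rho> * d) + (1 - \<rho>\<^sup>2) * D)"
    unfolding u''_def q_def[symmetric] by (simp add: algebra_simps)
  show ?thesis
    unfolding A B D' up unfolding u_def pows c_def
    by (simp add: algebra_simps power2_eq_square power4_eq_xxxx)
qed

text \<open>All requirements on \<eta> are upper bounds and \<open>shooting\<close> finds parameters
  below any given bound, so one choice of \<eta> meets the number of zeros, the size at the centre
  and the value at the cone together.\<close>

theorem similarity_profile:
  fixes C :: real and n :: nat
  assumes C: "C > 0"
  obtains \<rho>0 u u' u'' where "\<rho>0 > 1" "u real_analytic_on {0..<\<rho>0}" "\<And>\<rho>. 0 \<le> \<rho> \<Longrightarrow> \<rho> < \<rho>0 \<Longrightarrow> u \<rho> > 0"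
    "\<And>\<rho>. 0 < \<rho> \<Longrightarrow> \<rho> < \<rho>0 \<Longrightarrow> (u has_real_derivative u' \<rho>) (at \<rho>)"
    "\<And>\<rho>. 0 < \<rho> \<Longrightarrow> \<rho> < \<rho>0 \<Longrightarrow> (u' has_real_derivative u'' \<rho>) (at \<rho>)"
    "\<And>\<rho>. 0 < \<rho> \<Longrightarrow> \<rho> < \<rho>0 \<Longrightarrow> (1 - \<rho>\<^sup>2) * u'' \<rho> + ((2 * \<alpha> + 2) / \<rho> - 2 * (\<alpha> + 1) * \<rho>) * u' \<rho>
        - \<alpha> * (\<alpha> + 1) * u \<rho> + \<bar>u \<rho>\<bar> powr (p - 1) * u \<rho> = 0"
    "u 0 > C" "u 1 = b" "\<exists>Z \<subseteq> {\<rho>. 0 < \<rho> \<and> \<rho> < 1 \<and> u \<rho> = b * \<rho> powr - \<alpha>}. finite Z \<and> card Z = n"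
proof -
  obtain \<eta>0 where \<eta>0: "\<eta>0 > 0" "\<And>\<eta>. 0 < \<eta> \<Longrightarrow> \<eta> < \<eta>0 \<Longrightarrow> \<exists>Z \<subseteq> {z. \<eta> < z \<and> v \<eta> z = b}. finite Z \<and> card Z = n"
    using many_crossings[of n] by blast
  \<comment> \<open>Solves \<open>\<eta> powr - \<alpha> = C\<close>; smaller parameters give
    \<open>u 0 > C\<close>.\<close>
  define \<eta>C where "\<eta>C = C powr - (1 / \<alpha>)"
  have \<eta>C: "\<eta>C > 0" using C by (simp add: \<eta>C_def)
  define \<eta>s where "\<eta>s = min (min \<eta>0 \<eta>C) (min 1 (1 / (c + 1)))"
  have c1: "1 / (c + 1) > 0" using c_pos by simp
  have "\<eta>s > 0" using \<eta>0(1) \<eta>C c1 by (simp add: \<eta>s_def)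
  then obtain \<eta> where \<eta>s: "0 < \<eta>" "\<eta> < \<eta>s" and endpt: "psi \<eta> 1 = b" using shooting by blast
  have lt: "\<eta> < \<eta>0" "\<eta> < \<eta>C" "\<eta> \<le> 1" "\<eta> < 1 / (c + 1)" using \<eta>s by (auto simp: \<eta>s_def)
  have sq: "\<eta>\<^sup>2 * c < 1" using small_\<eta>[of \<eta>] \<eta>s lt by simp
  note \<eta> = \<eta>s(1) lt(3) sq
  obtain s V dV d2V where s: "0 < s" "s < 1" and V1: "V 1 = b"
    and Vv: "\<And>z. z > 1 \<Longrightarrow> V z = v \<eta> (\<eta> * z)" and Vpos: "\<And>z. z > 1 - s \<Longrightarrow> V z > 0"
    and V: "\<And>z. z > 1 - s \<Longrightarrow> (V has_real_derivative dV z) (at z)"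
    and dV: "\<And>z. z > 1 - s \<Longrightarrow> (dV has_real_derivative d2V z) (at z)"
    and ode: "\<And>z. z > 1 - s \<Longrightarrow> (z\<^sup>2 - 1) * d2V z = c * V z - V z powr p"
    and hol: "\<And>z. z > 1 - s \<Longrightarrow> \<exists>r>0. \<exists>g. g holomorphic_on ball (of_real z) r \<and> (\<forall>x. \<bar>x - z\<bar> < r \<longrightarrow> g (of_real x) = of_real (V x))"
    using continued_profile[OF \<eta> endpt] by blast
  \<comment> \<open>The reciprocal of the end \<open>1 - s\<close> of the continued
    interval.\<close>
  define \<rho>0 where "\<rho>0 = 1 / (1 - s)"
  have \<rho>0: "\<rho>0 > 1" using s by (simp add: \<rho>0_def)
  have inv: "1 / \<rho> > 1 - s" if "0 < \<rho>" "\<rho> < \<rho>0" for \<rho>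
    using that s by (simp add: \<rho>0_def field_simps)
  define u where "u = (\<lambda>\<rho>. if \<rho> > 0 then \<rho> powr - \<alpha> * V (1 / \<rho>) else \<eta> powr - \<alpha>)"
  define u' where "u' = (\<lambda>\<rho>. - \<alpha> * \<rho> powr (- \<alpha> - 1) * V (1 / \<rho>) - \<rho> powr (- \<alpha> - 2) * dV (1 / \<rho>))"
  define u'' where "u'' = (\<lambda>\<rho>. \<rho> powr (- \<alpha> - 4) * (\<alpha> * (\<alpha> + 1) * \<rho>\<^sup>2 * V (1 / \<rho>) + 2 * (\<alpha> + 1) * \<rho> * dV (1 / \<rho>) + d2V (1 / \<rho>)))"
  \<comment> \<open>The formula through \<open>V (1 / \<rho>)\<close> degenerates at the centre;
    this second description extends to \<rho> = 0 and gives the expansion there.\<close>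
  have uU: "u \<rho> = \<eta> powr - \<alpha> * U (\<eta>, \<rho> / \<eta>)" if \<rho>: "0 \<le> \<rho>" "\<rho> < 1" for \<rho>
  proof (cases "\<rho> = 0")
    case True
    then show ?thesis using U_0 \<eta> by (simp add: u_def)
  next
    case False
    then have "V (1 / \<rho>) = (\<eta> / \<rho>) powr - \<alpha> * U (\<eta>, \<rho> / \<eta>)"
      using \<rho> by (simp add: Vv v_def)
    moreover have "\<rho> powr - \<alpha> * (\<eta> / \<rho>) powr - \<alpha> = \<eta> powr - \<alpha>"
      using False \<rho> \<eta> by (simp add: powr_divide)
    ultimately show ?thesis using False \<rho> by (simp add: u_def flip: mult.assoc)
  qed
  have C0: "u 0 > C"
  proof -
    have "\<eta>C powr - \<alpha> < \<eta> powr - \<alpha>" using \<eta>s lt \<alpha>_pos by (intro powr_less_mono2_neg) auto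
    moreover have "\<eta>C powr - \<alpha> = C" using C \<alpha>_pos by (simp add: \<eta>C_def powr_powr)
    ultimately show ?thesis by (simp add: u_def)
  qed
  have pos: "u \<rho> > 0" if "0 \<le> \<rho>" "\<rho> < \<rho>0" for \<rho>
    using that Vpos[OF inv[of \<rho>]] \<eta> by (auto simp: u_def)
  have "\<exists>a r. 0 < r \<and> (\<forall>y\<in>{0..<\<rho>0}. \<bar>y - \<rho>\<bar> < r \<longrightarrow> (\<lambda>n. a n * (y - \<rho>) ^ n) sums u y)" if \<rho>: "\<rho> \<in> {0..<\<rho>0}" for \<rho>
  proof (cases "\<rho> = 0")
    case True
    obtain r W where r: "0 < r" and W: "W holomorphic_on ball 0 r"
      and WU: "\<And>y. 0 \<le> y \<Longrightarrow> y < r \<Longrightarrow> W (of_real y) = of_real (U (\<eta>, y))"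
      using analytic_center[OF \<eta>] by blast
    define R where "R = min 1 (\<eta> * r)"
    have R: "0 < R" "R \<le> 1" "R \<le> \<eta> * r" using \<eta> r by (auto simp: R_def)
    define G where "G = (\<lambda>y. of_real (\<eta> powr - \<alpha>) * W (y / of_real \<eta>))"
    have im: "(\<lambda>y. y / of_real \<eta>) ` ball 0 R \<subseteq> ball (0::complex) r"
    proof (rule image_subsetI)
      fix y assume "y \<in> ball (0::complex) R"
      then have "norm y < \<eta> * r" using R by simp
      then show "y / of_real \<eta> \<in> ball 0 r" using \<eta> by (simp add: norm_divide field_simps)
    qed
    have "(\<lambda>y. y / of_real \<eta>) holomorphic_on ball 0 R" using \<eta> by (intro holomorphic_intros) auto
    from holomorphic_on_compose_gen[OF this W im] have "(\<lambda>y. W (y / of_real \<eta>)) holomorphic_on ball 0 R"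
      by (simp add: o_def)
    then have G: "G holomorphic_on ball (of_real \<rho>) R"
      unfolding G_def True by (intro holomorphic_intros) simp
    show ?thesis
    proof (rule real_analytic_at[OF R(1) G])
      fix y assume "y \<in> {0..<\<rho>0}" "\<bar>y - \<rho>\<bar> < R"
      then have y: "0 \<le> y" "y < 1" "y / \<eta> < r" using True R \<eta> by (auto simp: field_simps)
      then show "G (of_real y) = of_real (u y)"
        using WU[of "y / \<eta>"] \<eta> uU[of y] by (simp add: G_def)
    qed
  next
    case False
    then have \<rho>': "0 < \<rho>" "\<rho> < \<rho>0" using \<rho> by auto
    obtain r g where r: "r > 0" and g: "g holomorphic_on ball (of_real (1 / \<rho>)) r"
      and gV: "\<And>x. \<bar>x - 1 / \<rho>\<bar> < r \<Longrightarrow> g (of_real x) = of_real (V x)"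
      using hol[OF inv[OF \<rho>']] by blast
    obtain r' G where r': "r' > 0" and G: "G holomorphic_on ball (of_real \<rho>) r'"
      and Gu: "\<And>y. \<bar>y - \<rho>\<bar> < r' \<Longrightarrow> y > 0 \<and> G (of_real y) = of_real (y powr - \<alpha> * V (1 / y))"
      using holomorphic_inversion[OF \<rho>'(1) r g gV, of \<alpha>] by blast
    show ?thesis
      by (rule real_analytic_at[OF r' G]) (use Gu in \<open>simp add: u_def\<close>)
  qed
  then have analytic: "u real_analytic_on {0..<\<rho>0}" unfolding real_analytic_on_def by blast
  obtain Z where Z: "Z \<subseteq> {z. \<eta> < z \<and> v \<eta> z = b}" "finite Z" "card Z = n"
    using \<eta>0(2)[OF \<eta>s(1) lt(1)] by blast
  have zeros: "(\<lambda>z. \<eta> / z) ` Z \<subseteq> {\<rho>. 0 < \<rho> \<and> \<rho> < 1 \<and> u \<rho> = b * \<rho> powr - \<alpha>}"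
  proof (rule image_subsetI, rule CollectI)
    fix z assume "z \<in> Z"
    then have z: "\<eta> < z" "v \<eta> z = b" using Z by auto
    then have "V (1 / (\<eta> / z)) = b" using Vv[of "z / \<eta>"] \<eta> by simp
    then show "0 < \<eta> / z \<and> \<eta> / z < 1 \<and> u (\<eta> / z) = b * (\<eta> / z) powr - \<alpha>"
      using z \<eta> by (simp add: u_def)
  qed
  have "inj_on (\<lambda>z. \<eta> / z) Z" using \<eta> by (auto intro!: inj_onI)
  then have card: "card ((\<lambda>z. \<eta> / z) ` Z) = n" by (simp add: card_image Z)
  show thesis
  proof (rule that[OF \<rho>0 analytic pos])
    show "u 0 > C" by (rule C0)
    show "u 1 = b" by (simp add: u_def V1)
    show "\<exists>Z \<subseteq> {\<rho>. 0 < \<rho> \<and> \<rho> < 1 \<and> u \<rho> = b * \<rho> powr - \<alpha>}. finite Z \<and> card Z = n"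
      using zeros card Z(2) by (intro exI[of _ "(\<lambda>z. \<eta> / z) ` Z"]) auto
    fix \<rho> assume \<rho>: "0 < \<rho>" "\<rho> < \<rho>0"
    note i = inv[OF \<rho>]
    show "(u has_real_derivative u' \<rho>) (at \<rho>)"
    proof -
      have "((\<lambda>x. x powr - \<alpha> * V (1 / x)) has_real_derivative u' \<rho>) (at \<rho>)"
        unfolding u'_def by (rule inversion_deriv[where V = V and dV = dV, OF \<rho>(1) V[OF i]])
      moreover have "\<forall>\<^sub>F x in nhds \<rho>. u x = x powr - \<alpha> * V (1 / x)"
        using eventually_nhds_in_open[of "{0<..}" \<rho>] \<rho> by (auto elim!: eventually_mono simp: u_def)
      ultimately show ?thesis using DERIV_cong_ev[of \<rho> \<rho> u "\<lambda>x. x powr - \<alpha> * V (1 / x)"] by simp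
    qed
    show "(u' has_real_derivative u'' \<rho>) (at \<rho>)"
      unfolding u'_def u''_def by (rule inversion_deriv2[where V = V and dV = dV, OF \<rho>(1) V[OF i] dV[OF i]])
    show "(1 - \<rho>\<^sup>2) * u'' \<rho> + ((2 * \<alpha> + 2) / \<rho> - 2 * (\<alpha> + 1) * \<rho>) * u' \<rho>
        - \<alpha> * (\<alpha> + 1) * u \<rho> + \<bar>u \<rho>\<bar> powr (p - 1) * u \<rho> = 0"
      using similarity_ode[OF \<rho>(1) Vpos[OF i] ode[OF i], of "dV (1 / \<rho>)"] \<rho>
      by (simp add: u_def u'_def u''_def)
  qed
qed

end

theorem theorem1p2:
  fixes N :: nat and p C\<^sub>0 :: real and n\<^sub>0 :: int
  assumes "N \<ge> 4"
    and "p = 1 + 4 / (real N - 3)"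
    and "C\<^sub>0 > 0"
  shows "\<exists>(\<rho>\<^sub>0::real) (u :: real \<Rightarrow> real).
    \<rho>\<^sub>0 > 1 \<and>
    u real_analytic_on {0..<\<rho>\<^sub>0} \<and>
    (\<forall>\<rho>\<in>{0..<\<rho>\<^sub>0}. u \<rho> > 0) \<and>
    ode_solution_on N p u {0<..<\<rho>\<^sub>0} \<and>
    u 0 > C\<^sub>0 \<and>
    u 1 = b_zero p \<and>
    (\<exists>Z. Z \<subseteq> {\<rho>\<in>{0<..<1}. u \<rho> - u_infty N p \<rho> = 0} \<and> finite Z \<and> int (card Z) \<ge> n\<^sub>0)"
proof -
  \<comment> \<open>This is \<open>2 / (p - 1)\<close>, the scaling exponent \<alpha>.\<close>
  define a where "a = (real N - 3) / 2"
  have a: "a \<ge> 1 / 2" using assms(1) by (simp add: a_def)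
  interpret supercritical "N - 1" a
    by unfold_locales (use assms(1) a in \<open>auto simp: a_def of_nat_diff field_simps\<close>)
  have N: "real N - 1 = 2 * a + 2" "real N - 2 - a = a + 1" by (auto simp: a_def field_simps)
  have p: "supercritical.p a = p" unfolding p_def by (simp add: assms(2) a_def)
  have al: "alpha p = a" using a by (simp add: alpha_def assms(2) a_def)
  have pa: "p - 1 = 2 / a" using a by (simp add: assms(2) a_def)
  have binf: "b_infty N p = b" by (simp add: b_infty_def al N b_def c_def)
  have "2 * (p + 1) / (p - 1)\<^sup>2 = c"
  proof -
    have pe: "p + 1 = 2 + 2 / a" using pa by simp
    show ?thesis unfolding pa pe c_def using a by (simp add: field_simps power2_eq_square)
  qed
  moreover have "1 / (p - 1) = a / 2" by (simp add: pa)
  ultimately have bz: "b_zero p = b" by (simp only: b_zero_def b_def)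
  \<comment> \<open>For negative \<open>n\<^sub>0\<close> the requested number
    \<open>nat n\<^sub>0\<close> is 0, and the empty set of zeros is enough.\<close>
  obtain \<rho>0 u u' u'' where u: "\<rho>0 > 1" "u real_analytic_on {0..<\<rho>0}" "\<And>\<rho>. 0 \<le> \<rho> \<Longrightarrow> \<rho> < \<rho>0 \<Longrightarrow> u \<rho> > 0"
    and d: "\<And>\<rho>. 0 < \<rho> \<Longrightarrow> \<rho> < \<rho>0 \<Longrightarrow> (u has_real_derivative u' \<rho>) (at \<rho>)"
    "\<And>\<rho>. 0 < \<rho> \<Longrightarrow> \<rho> < \<rho>0 \<Longrightarrow> (u' has_real_derivative u'' \<rho>) (at \<rho>)"
    "\<And>\<rho>. 0 < \<rho> \<Longrightarrow> \<rho> < \<rho>0 \<Longrightarrow> (1 - \<rho>\<^sup>2) * u'' \<rho> + ((2 * a + 2) / \<rho> - 2 * (a + 1) * \<rho>) * u' \<rho>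
        - a * (a + 1) * u \<rho> + \<bar>u \<rho>\<bar> powr (supercritical.p a - 1) * u \<rho> = 0"
    and e: "u 0 > C\<^sub>0" "u 1 = b"
    and Z: "\<exists>Z \<subseteq> {\<rho>. 0 < \<rho> \<and> \<rho> < 1 \<and> u \<rho> = b * \<rho> powr - a}. finite Z \<and> card Z = nat n\<^sub>0"
    using similarity_profile[OF assms(3), of "nat n\<^sub>0"] by blast
  have "ode_solution_on N p u {0<..<\<rho>0}"
    unfolding ode_solution_on_def al N using d unfolding p by (intro exI[of _ u'] exI[of _ u'']) auto
  moreover from Z obtain Z where "Z \<subseteq> {\<rho>. 0 < \<rho> \<and> \<rho> < 1 \<and> u \<rho> = b * \<rho> powr - a}" "finite Z" "card Z = nat n\<^sub>0" by blast
  then have "\<exists>Z. Z \<subseteq> {\<rho>\<in>{0<..<1}. u \<rho> - u_infty N p \<rho> = 0} \<and> finite Z \<and> int (card Z) \<ge> n\<^sub>0"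
    by (intro exI[of _ Z]) (auto simp: u_infty_def binf al)
  ultimately show ?thesis using u e bz by (intro exI[of _ \<rho>0] exI[of _ u]) auto
qed

end
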